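(* Let $\beta>1$ and let $\tau$ be the $\beta$-transformation. If $1$ is not eventually periodic under $\tau$, then $DG(\tau)$ is isomorphic as a group to $\mathbb Z[t,t^{-1}]$, with the action of $\mathcal L_*$ given by multiplication by $t$. The unique state is given by $p\mapsto p(\beta)$, and $DG(\tau)$ has the strict order from this state.
   Context: Let $I=[0,1]$. For $\beta>1$ the $\beta$-transformation is $\tau(x)=\beta x\bmod 1$ on $[0,1)$, with $\tau(1)=\lim_{x\to1^-}\tau(x)$. It is piecewise monotonic with associated partition $0=a_0<a_1<\dots$ consisting of the distinct points among $0,1/\beta,\dots,\lfloor\beta\rfloor/\beta,1$. On each partition interval $[a_{i-1},a_i]$ let $\tau_i$ be the continuous extension of $\tau|_{(a_{i-1},a_i)}$; values at discontinuities are ignored: $\widehat\tau(x)$ is the set of left and right limits of $\tau$ at $x$, $\widehat\tau(A)=\bigcup_i\tau_i(A\cap[a_{i-1},a_i])$, $\widehat\tau^{-1}(A)=\bigcup_i\{x\in[a_{i-1},a_i]:\tau_i(x)\in A\}$. The point $1$ is eventually periodic if its orbit under $\tau$ is finite. The generalized orbit of $x\in I$ is the smallest subset of $I$ containing $x$ that is forward and backward invariant under $\widehat\tau$. $I_1$ is the union of the generalized orbits of the partition points, and $I_0=I\setminus I_1$. $X$ is the totally ordered set obtained from $I$ by replacing each $x\in I_1\setminus\{0,1\}$ by two points $x^-<x^+$, with the order topology (homeomorphic to a compact subset of $\mathbb R$); $\pi:X\to I$ is the collapse map ($\pi(x^\pm)=x$), and $X_0=\pi^{-1}(I_0)$. The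 local homeomorphism associated with $\tau$ is the unique continuous map $\sigma:X\to X$ with $\pi\circ\sigma=\tau\circ\pi$ on $X_0$. Let $(\mathcal L f)(x)=\sum_{\sigma y=x}f(y)$ for $f\in C(X,\mathbb Z)$. $DG(\tau)$ is $C(X,\mathbb Z)$ modulo $f\sim g$ iff $\mathcal L^nf=\mathcal L^ng$ for some $n\ge0$, ordered by $[f]\ge0$ iff $\mathcal L^nf\ge0$ for some $n$, with order unit $[1]$, and $\mathcal L_*[f]=[\mathcal Lf]$. A state is a positive homomorphism $\omega:DG(\tau)\to\mathbb R$ with $\omega([1])=1$; the strict order given by $\omega$ is: $x\le y$ iff $\omega(x)<\omega(y)$ or $x=y$. The description of the state as $p\mapsto p(\beta)$ is via the isomorphism of $DG(\tau)$ with $\mathbb Z[t,t^{-1}]$, under which $p$ corresponds to $p(\mathcal L_* )[1]$. *)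

theory Defs
  imports "HOL-Analysis.Analysis" "HOL-Algebra.Algebra" "HOL-Library.Poly_Mapping"
begin

text \<open>A piecewise monotonic map is given by \<open>\<tau>\<close> on \<open>[0,1]\<close> and the strictly increasing list
  \<open>a = [a\<^sub>0, \<dots>, a\<^sub>n]\<close> of its partition points.
  The branches are numbered \<open>1, \<dots>, n\<close>.\<close>

definition branch :: "(real \<Rightarrow> real) \<Rightarrow> real list \<Rightarrow> nat \<Rightarrow> real \<Rightarrow> real" where
  "branch \<tau> a i x = Lim (at x within {a ! (i - 1)<..<a ! i}) \<tau>"

definition hat_image :: "(real \<Rightarrow> real) \<Rightarrow> real list \<Rightarrow> real set \<Rightarrow> real set" where
  "hat_image \<tau> a A = (\<Union>i\<in>{1..<length a}. branch \<tau> a i ` (A \<inter> {a ! (i - 1)..a ! i}))"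

definition hat_vimage :: "(real \<Rightarrow> real) \<Rightarrow> real list \<Rightarrow> real set \<Rightarrow> real set" where
  "hat_vimage \<tau> a A = (\<Union>i\<in>{1..<length a}. {x \<in> {a ! (i - 1)..a ! i}. branch \<tau> a i x \<in> A})"

definition gen_orbit :: "(real \<Rightarrow> real) \<Rightarrow> real list \<Rightarrow> real \<Rightarrow> real set" where
  "gen_orbit \<tau> a x =
     \<Inter> {A. A \<subseteq> {0..1} \<and> x \<in> A \<and> hat_image \<tau> a A \<subseteq> A \<and> hat_vimage \<tau> a A \<subseteq> A}"

definition I1 :: "(real \<Rightarrow> real) \<Rightarrow> real list \<Rightarrow> real set" where
  "I1 \<tau> a = (\<Union>x\<in>set a. gen_orbit \<tau> a x)"

definition I0 :: "(real \<Rightarrow> real) \<Rightarrow> real list \<Rightarrow> real set" where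
  "I0 \<tau> a = {0..1} - I1 \<tau> a"

text \<open>A point of \<open>X\<close> is a pair: \<open>(x, False)\<close> is \<open>x\<^sup>-\<close> and \<open>(x, True)\<close> is \<open>x\<^sup>+\<close> if \<open>x\<close> is doubled,
  and an undoubled \<open>x\<close> (in particular \<open>0\<close> and \<open>1\<close>) is \<open>(x, False)\<close>.
  The collapse map \<open>\<pi>\<close> is \<open>fst\<close>.\<close>

type_synonym split_point = "real \<times> bool"

definition X_set :: "(real \<Rightarrow> real) \<Rightarrow> real list \<Rightarrow> split_point set" where
  "X_set \<tau> a = {(x, b). x \<in> {0..1} \<and> (b \<longrightarrow> x \<in> I1 \<tau> a - {0, 1})}"

definition X_less :: "split_point \<Rightarrow> split_point \<Rightarrow> bool" where
  "X_less p q \<longleftrightarrow> fst p < fst q \<or> fst p = fst q \<and> \<not> snd p \<and> snd q"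

definition X_top :: "(real \<Rightarrow> real) \<Rightarrow> real list \<Rightarrow> split_point topology" where
  "X_top \<tau> a = topology_generated_by
     (insert (X_set \<tau> a)
       ((\<lambda>p. {q \<in> X_set \<tau> a. X_less q p}) ` X_set \<tau> a \<union>
        (\<lambda>p. {q \<in> X_set \<tau> a. X_less p q}) ` X_set \<tau> a))"

text \<open>Functions on \<open>X\<close>, and below states on \<open>DG(\<tau>)\<close>, are represented by total functions that are \<open>undefined\<close> outside their domain
  (\<^const>\<open>extensional\<close>), so that equality (and uniqueness) of maps is that of HOL functions.\<close>

definition assoc_map :: "(real \<Rightarrow> real) \<Rightarrow> real list \<Rightarrow> split_point \<Rightarrow> split_point" where
  "assoc_map \<tau> a = (THE \<sigma>. \<sigma> \<in> extensional (X_set \<tau> a)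
     \<and> continuous_map (X_top \<tau> a) (X_top \<tau> a) \<sigma>
     \<and> (\<forall>p\<in>X_set \<tau> a. fst p \<in> I0 \<tau> a \<longrightarrow> fst (\<sigma> p) = \<tau> (fst p)))"

definition CXZ :: "(real \<Rightarrow> real) \<Rightarrow> real list \<Rightarrow> (split_point \<Rightarrow> int) set" where
  "CXZ \<tau> a = {f \<in> extensional (X_set \<tau> a).
     continuous_map (X_top \<tau> a) (discrete_topology UNIV) f}"

text \<open>The sum is over a finite set, since \<open>\<sigma>\<close> has at most one preimage of a point
  for each branch.\<close>

definition transfer_op :: "(real \<Rightarrow> real) \<Rightarrow> real list \<Rightarrow> (split_point \<Rightarrow> int) \<Rightarrow> split_point \<Rightarrow> int" where
  "transfer_op \<tau> a f =
     (\<lambda>x\<in>X_set \<tau> a. \<Sum>y\<in>{y \<in> X_set \<tau> a. assoc_map \<tau> a y = x}. f y)"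

definition DG_rel :: "(real \<Rightarrow> real) \<Rightarrow> real list \<Rightarrow> ((split_point \<Rightarrow> int) \<times> (split_point \<Rightarrow> int)) set" where
  "DG_rel \<tau> a = {(f, g). f \<in> CXZ \<tau> a \<and> g \<in> CXZ \<tau> a
     \<and> (\<exists>n. (transfer_op \<tau> a ^^ n) f = (transfer_op \<tau> a ^^ n) g)}"

text \<open>The abelian group \<open>DG(\<tau>)\<close>. As for \<^const>\<open>integer_group\<close>, the group operation, which is
  addition of classes, is the \<^const>\<open>monoid.mult\<close> of the record.\<close>

definition DG :: "(real \<Rightarrow> real) \<Rightarrow> real list \<Rightarrow> (split_point \<Rightarrow> int) set monoid" where
  "DG \<tau> a = \<lparr>carrier = CXZ \<tau> a // DG_rel \<tau> a,
     monoid.mult = (\<lambda>A B. DG_rel \<tau> a `` {(\<lambda>x\<in>X_set \<tau> a. f x + g x) | f g. f \<in> A \<and> g \<in> B}),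
     one = DG_rel \<tau> a `` {\<lambda>x\<in>X_set \<tau> a. 0}\<rparr>"

definition DG_nonneg :: "(real \<Rightarrow> real) \<Rightarrow> real list \<Rightarrow> (split_point \<Rightarrow> int) set \<Rightarrow> bool" where
  "DG_nonneg \<tau> a A \<longleftrightarrow> (\<exists>f\<in>A. \<exists>n. \<forall>x\<in>X_set \<tau> a. 0 \<le> (transfer_op \<tau> a ^^ n) f x)"

definition DG_le :: "(real \<Rightarrow> real) \<Rightarrow> real list \<Rightarrow>
    (split_point \<Rightarrow> int) set \<Rightarrow> (split_point \<Rightarrow> int) set \<Rightarrow> bool" where
  "DG_le \<tau> a A B \<longleftrightarrow> DG_nonneg \<tau> a (B \<otimes>\<^bsub>DG \<tau> a\<^esub> inv\<^bsub>DG \<tau> a\<^esub> A)"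

definition DG_unit :: "(real \<Rightarrow> real) \<Rightarrow> real list \<Rightarrow> (split_point \<Rightarrow> int) set" where
  "DG_unit \<tau> a = DG_rel \<tau> a `` {\<lambda>x\<in>X_set \<tau> a. 1}"

definition L_star :: "(real \<Rightarrow> real) \<Rightarrow> real list \<Rightarrow>
    (split_point \<Rightarrow> int) set \<Rightarrow> (split_point \<Rightarrow> int) set" where
  "L_star \<tau> a A = DG_rel \<tau> a `` (transfer_op \<tau> a ` A)"

definition real_add_group :: "real monoid" where
  "real_add_group = \<lparr>carrier = UNIV, monoid.mult = (+), one = 0\<rparr>"

definition is_state :: "(real \<Rightarrow> real) \<Rightarrow> real list \<Rightarrow> ((split_point \<Rightarrow> int) set \<Rightarrow> real) \<Rightarrow> bool" where
  "is_state \<tau> a \<omega> \<longleftrightarrow> \<omega> \<in> extensional (carrier (DG \<tau> a)) \<and> \<omega> \<in> hom (DG \<tau> a) real_add_group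
     \<and> (\<forall>A\<in>carrier (DG \<tau> a). DG_nonneg \<tau> a A \<longrightarrow> 0 \<le> \<omega> A) \<and> \<omega> (DG_unit \<tau> a) = 1"

text \<open>\<open>\<int>[t, t\<^sup>-\<^sup>1]\<close> is the group ring of \<open>\<int>\<close> over \<open>\<int>\<close>: multiplication on \<^typ>\<open>int \<Rightarrow>\<^sub>0 int\<close>
  is convolution.\<close>

type_synonym laurent = "int \<Rightarrow>\<^sub>0 int"

definition laurent_t :: laurent where
  "laurent_t = Poly_Mapping.single 1 1"

definition laurent_group :: "laurent monoid" where
  "laurent_group = \<lparr>carrier = UNIV, monoid.mult = (+), one = 0\<rparr>"

definition laurent_eval :: "laurent \<Rightarrow> real \<Rightarrow> real" where
  "laurent_eval p x = (\<Sum>k\<in>Poly_Mapping.keys p. of_int (Poly_Mapping.lookup p k) * x powi k)"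

definition L_star_pow :: "(real \<Rightarrow> real) \<Rightarrow> real list \<Rightarrow> int \<Rightarrow>
    (split_point \<Rightarrow> int) set \<Rightarrow> (split_point \<Rightarrow> int) set" where
  "L_star_pow \<tau> a k = (if 0 \<le> k then L_star \<tau> a ^^ nat k
     else inv_into (carrier (DG \<tau> a)) (L_star \<tau> a) ^^ nat (- k))"

text \<open>The map \<open>p \<mapsto> p(\<L>\<^sub>*)[1]\<close>; the group \<open>DG(\<tau>)\<close> being written multiplicatively, integer multiples
  are powers and the sum over the monomials of \<open>p\<close> is a \<^const>\<open>finprod\<close>.\<close>

definition laurent_act :: "(real \<Rightarrow> real) \<Rightarrow> real list \<Rightarrow> laurent \<Rightarrow> (split_point \<Rightarrow> int) set" where
  "laurent_act \<tau> a p = (\<Otimes>\<^bsub>DG \<tau> a\<^esub>k\<in>Poly_Mapping.keys p.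
     L_star_pow \<tau> a k (DG_unit \<tau> a) [^]\<^bsub>DG \<tau> a\<^esub> Poly_Mapping.lookup p k)"

definition beta_map :: "real \<Rightarrow> real \<Rightarrow> real" where
  "beta_map \<beta> x = (if x = 1 then Lim (at_left 1) (\<lambda>y. frac (\<beta> * y)) else frac (\<beta> * x))"

definition beta_partition :: "real \<Rightarrow> real list" where
  "beta_partition \<beta> = sorted_list_of_set (insert 1 ((\<lambda>k. of_int k / \<beta>) ` {0..\<lfloor>\<beta>\<rfloor>}))"

definition eventually_periodic :: "(real \<Rightarrow> real) \<Rightarrow> real \<Rightarrow> bool" where
  "eventually_periodic \<tau> x \<longleftrightarrow> finite (range (\<lambda>n. (\<tau> ^^ n) x))"

end

theory Submission
  imports Defs
begin

text \<open>Write \<open>e\<^sub>c\<close> for the indicator function of \<open>[0, c\<^sup>-]\<close>. The functions \<open>e\<^sub>c\<close> with \<open>c\<close> in the generalized orbit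
  span \<open>C(X, \<int>)\<close>, and \<open>\<L> e\<^sub>c = d + e\<^bsub>T c\<^esub>\<close> where \<open>T\<close> is the left-continuous version of \<open>\<tau>\<close> and \<open>d\<close> is the
  integer part removed by \<open>T\<close>. Every \<open>c\<close> is eventually mapped into the orbit of \<open>1\<close>, so \<open>[1]\<close> generates
  \<open>DG(\<tau>)\<close> as a \<open>\<int>[t, t\<^sup>-\<^sup>1]\<close>-module; it does so freely since the jump of \<open>\<L>\<^sup>n 1\<close> at \<open>T\<^sup>n 1\<close> is \<open>1\<close> and the
  points \<open>T\<^sup>n 1\<close> are distinct.

  Lebesgue measure is scaled by \<open>\<beta>\<close> under \<open>\<L>\<close> and gives the state \<open>p(\<beta>)\<close>. Its order is strict because
  \<open>\<L>\<^sup>n 1 = \<Sum>\<^sub>k R\<^bsub>n-k\<^esub> e\<^bsub>T\<^sup>k 1\<^esub>\<close>, where \<open>R\<^sub>n / \<beta>\<^sup>n\<close> solves the renewal equation whose weights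
  come from the \<open>\<beta>\<close>-expansion of \<open>1\<close>. By the renewal theorem \<open>\<beta>\<^sup>-\<^sup>n \<L>\<^sup>n 1\<close> converges uniformly to a positive
  multiple of \<open>\<Sum>\<^sub>k \<beta>\<^sup>-\<^sup>k e\<^bsub>T\<^sup>k 1\<^esub> \<ge> 1\<close>, so \<open>\<L>\<^sup>n p(\<L>) 1\<close> is eventually positive when \<open>p(\<beta>) > 0\<close>.
  The strict order in turn forces the state to be unique.\<close>

section \<open>Renewal sequences\<close>

text \<open>Aperiodicity enters in two ways. The orbit of 1 never meets a discontinuity, so \<tau>
  and \<open>T\<close> agree along it; and its points are distinct, so the jump of the highest
  iterate of 1 cannot be cancelled by lower ones. The point 0 is exceptional: it is not doubled and
  is fixed by \<open>T\<close>, so it never serves as an index of an indicator. Points k / \<beta>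
  with k \<ge> 1 reach it only through their right-hand limit, and \<open>T\<close> sends them to 1
  instead.

  The recursion for \<open>R\<close> is linear and homogeneous, so by itself it cannot determine the
  limit. The missing equation is a conserved sum: integrating \<L>^n 1 against Lebesgue measure
  gives exactly \<beta>^n for every n. Periodic behaviour is excluded because the first digit of 1
  is positive, so the lag 1 has positive weight.

  For strictness of the order, eventual positivity when p(\<beta>) > 0 is only half. The other half
  is that Lebesgue measure has full support: a nonnegative continuous function with integral 0
  vanishes, so no nonzero positive class has value 0.\<close>

lemma filterlim_minus_const_nat:
  assumes "filterlim f at_top F"
  shows "filterlim (\<lambda>i. f i - (k::nat)) at_top F"
  unfolding filterlim_at_top
proof
  fix Z :: nat
  have "eventually (\<lambda>i. Z + k \<le> f i) F" using assms by (simp add: filterlim_at_top)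
  then show "eventually (\<lambda>i. Z \<le> f i - k) F" by eventually_elim simp
qed

text \<open>Tannery's theorem, with terms dominated by \<open>B * \<bar>c k\<bar>\<close>.
  Convergence is asked only along \<open>\<phi>\<close> and for each fixed lag, so that the lemma
  serves both full sequences and subsequences that realize an upper limit.\<close>

lemma convolution_tendsto:
  fixes s c :: "nat \<Rightarrow> real"
  assumes lim: "\<And>j. (\<lambda>i. s (\<phi> i - j)) \<longlonglongrightarrow> L"
    and bd: "\<And>n. \<bar>s n\<bar> \<le> B" and c: "summable (\<lambda>k. \<bar>c k\<bar>)"
    and \<phi>: "filterlim \<phi> at_top sequentially"
  shows "(\<lambda>i. \<Sum>k\<le>\<phi> i. s (\<phi> i - k) * c k) \<longlonglongrightarrow> L * suminf c"
proof -
  define f where "f k i = (if k \<le> \<phi> i then s (\<phi> i - k) * c k else 0)" for k i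
  have lim1: "((\<lambda>i. f k i) \<longlongrightarrow> L * c k) sequentially" for k
  proof (rule Lim_transform_eventually)
    show "(\<lambda>i. s (\<phi> i - k) * c k) \<longlonglongrightarrow> L * c k"
      by (intro tendsto_intros lim)
    have "eventually (\<lambda>i. k \<le> \<phi> i) sequentially"
      using \<phi> by (simp add: filterlim_at_top)
    then show "eventually (\<lambda>i. s (\<phi> i - k) * c k = f k i) sequentially"
      by eventually_elim (simp add: f_def)
  qed
  have "B \<ge> 0" using bd[of 0] by linarith
  have fb: "norm (f k i) \<le> B * \<bar>c k\<bar>" for k i
    using bd[of "\<phi> i - k"] \<open>B \<ge> 0\<close> by (auto simp: f_def abs_mult intro: mult_right_mono)
  have "(\<lambda>i. suminf (\<lambda>k. f k i)) \<longlonglongrightarrow> suminf (\<lambda>k. L * c k)"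
    using tannerys_theorem[OF lim1, where M = "\<lambda>k. B * \<bar>c k\<bar>"] fb c
    by (simp add: summable_mult always_eventually)
  moreover have "suminf (\<lambda>k. f k i) = (\<Sum>k\<le>\<phi> i. s (\<phi> i - k) * c k)" for i
    by (subst suminf_finite[of "{..\<phi> i}"]) (auto simp: f_def)
  moreover have "suminf (\<lambda>k. L * c k) = L * suminf c"
    using c by (intro suminf_mult) (simp add: summable_rabs_cancel)
  ultimately show ?thesis by simp
qed

text \<open>At times where a solution of a renewal equation is close to its upper limit,
  the convex combination on the right-hand side forces the previous value to be close as well;
  this uses that the first weight does not vanish.\<close>

lemma renewal_shift:
  fixes r w :: "nat \<Rightarrow> real"
  assumes w: "\<And>k. 0 \<le> w k" "0 < w 0" "w sums 1"
    and bd: "\<And>n. \<bar>r n\<bar> \<le> B"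
    and rec: "\<And>n. r (Suc n) = (\<Sum>k\<le>n. w k * r (n - k))"
    and up: "(\<lambda>n. max 0 (r n - M)) \<longlonglongrightarrow> 0"
    and \<phi>: "filterlim \<phi> at_top sequentially" "(\<lambda>i. r (\<phi> i)) \<longlonglongrightarrow> M"
  shows "(\<lambda>i. r (\<phi> i - 1)) \<longlonglongrightarrow> M"
proof -
  define s where "s n = max 0 (r n - M)" for n
  have s0: "s \<longlonglongrightarrow> 0" using up by (simp add: s_def[abs_def])
  have sb: "\<bar>s n\<bar> \<le> B + \<bar>M\<bar>" for n using bd[of n] by (auto simp: s_def)
  \<comment> \<open>Every \<open>r (n - k)\<close> is at most \<open>M + s (n - k)\<close>, so
    \<open>q n\<close> bounds the right-hand side of the recursion, and it tends to
    \<open>M\<close>. Keeping the term k = 0 exact leaves \<open>w 0 * (M - r n)\<close> as the gap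
    to be controlled.\<close>
  define q where "q n = M * (\<Sum>k\<le>n. w k) + (\<Sum>k\<le>n. s (n - k) * w k)" for n
  have sw: "summable (\<lambda>k. \<bar>w k\<bar>)" using w by (simp add: sums_iff)
  have "(\<lambda>n. \<Sum>k\<le>n. s (n - k) * w k) \<longlonglongrightarrow> 0 * suminf w"
  proof (rule convolution_tendsto[where \<phi> = "\<lambda>n. n" and B = "B + \<bar>M\<bar>"])
    show "(\<lambda>i. s (i - j)) \<longlonglongrightarrow> 0" for j
      by (rule filterlim_compose[OF s0 filterlim_minus_const_nat]) (rule filterlim_ident)
  qed (use sb sw filterlim_ident in auto)
  moreover have "(\<lambda>n. \<Sum>k\<le>n. w k) \<longlonglongrightarrow> 1" using w(3) by (simp add: sums_def_le)
  ultimately have q: "q \<longlonglongrightarrow> M * 1 + 0 * suminf w"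
    unfolding q_def by (intro tendsto_intros)
  have key: "w 0 * (M - r n) \<le> q n - r (Suc n)" for n
  proof -
    have "r (Suc n) = w 0 * r n + (\<Sum>k\<in>{..n} - {0}. w k * r (n - k))"
      unfolding rec by (subst sum.remove[of _ 0]) auto
    also have "(\<Sum>k\<in>{..n} - {0}. w k * r (n - k)) \<le> (\<Sum>k\<in>{..n} - {0}. w k * M + s (n - k) * w k)"
    proof (rule sum_mono)
      fix k
      have "w k * r (n - k) \<le> w k * (M + s (n - k))"
        by (intro mult_left_mono w) (auto simp: s_def)
      then show "w k * r (n - k) \<le> w k * M + s (n - k) * w k" by (simp add: algebra_simps)
    qed
    also have "\<dots> = (\<Sum>k\<le>n. w k * M + s (n - k) * w k) - (w 0 * M + s n * w 0)"
      by (subst sum.remove[of "{..n}" 0]) auto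
    also have "\<dots> \<le> q n - w 0 * M"
      using w(2) by (simp add: q_def sum.distrib sum_distrib_left mult.commute s_def)
    finally show ?thesis by (simp add: algebra_simps)
  qed
  have \<phi>1: "filterlim (\<lambda>i. \<phi> i - 1) at_top sequentially"
    by (rule filterlim_minus_const_nat) fact
  have lim: "(\<lambda>i. w 0 * (M - r (\<phi> i - 1))) \<longlonglongrightarrow> 0"
  proof (rule tendsto_sandwich)
    show "eventually (\<lambda>i. - (w 0 * s (\<phi> i - 1)) \<le> w 0 * (M - r (\<phi> i - 1))) sequentially"
    proof (rule always_eventually, rule allI)
      fix i
      have "w 0 * (- s (\<phi> i - 1)) \<le> w 0 * (M - r (\<phi> i - 1))"
        using w(2) by (intro mult_left_mono) (auto simp: s_def)
      then show "- (w 0 * s (\<phi> i - 1)) \<le> w 0 * (M - r (\<phi> i - 1))" by simp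
    qed
    have "eventually (\<lambda>i. 1 \<le> \<phi> i) sequentially" using \<phi>(1) by (simp add: filterlim_at_top)
    then show "eventually (\<lambda>i. w 0 * (M - r (\<phi> i - 1)) \<le> q (\<phi> i - 1) - r (\<phi> i)) sequentially"
      by eventually_elim (metis Suc_diff_1 key zero_less_one less_le_trans)
    have "(\<lambda>i. - (w 0 * s (\<phi> i - 1))) \<longlonglongrightarrow> - (w 0 * 0)"
      by (intro tendsto_intros filterlim_compose[OF s0 \<phi>1])
    then show "(\<lambda>i. - (w 0 * s (\<phi> i - 1))) \<longlonglongrightarrow> 0" by simp
    have "(\<lambda>i. q (\<phi> i - 1) - r (\<phi> i)) \<longlonglongrightarrow> (M * 1 + 0 * suminf w) - M"
      by (intro tendsto_diff filterlim_compose[OF q \<phi>1] \<phi>)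
    then show "(\<lambda>i. q (\<phi> i - 1) - r (\<phi> i)) \<longlonglongrightarrow> 0" by simp
  qed
  have "(\<lambda>i. M - (w 0 * (M - r (\<phi> i - 1))) / w 0) \<longlonglongrightarrow> M - 0 / w 0"
    by (intro tendsto_intros lim) (use w in auto)
  then show ?thesis using w(2) by simp
qed

text \<open>Iterating \<open>renewal_shift\<close> yields
  \<open>r (\<phi> i - j) \<longlonglongrightarrow> M\<close> for every fixed lag \<open>j\<close>,
  and the conserved convolution with \<open>c\<close> then passes to the limit. Thus any upper limit
  must have the value dictated by \<open>C\<close>.\<close>

lemma renewal_limit_value:
  fixes r w c :: "nat \<Rightarrow> real"
  assumes w: "\<And>k. 0 \<le> w k" "0 < w 0" "w sums 1"
    and bd: "\<And>n. \<bar>r n\<bar> \<le> B"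
    and rec: "\<And>n. r (Suc n) = (\<Sum>k\<le>n. w k * r (n - k))"
    and c: "summable (\<lambda>k. \<bar>c k\<bar>)" "\<And>n. (\<Sum>k\<le>n. r (n - k) * c k) = C"
    and up: "(\<lambda>n. max 0 (r n - M)) \<longlonglongrightarrow> 0"
    and \<phi>: "filterlim \<phi> at_top sequentially" "(\<lambda>i. r (\<phi> i)) \<longlonglongrightarrow> M"
  shows "M * suminf c = C"
proof -
  have shift: "filterlim (\<lambda>i. \<phi> i - j) at_top sequentially \<and> (\<lambda>i. r (\<phi> i - j)) \<longlonglongrightarrow> M" for j
  proof (induction j)
    case (Suc j)
    then show ?case
      using renewal_shift[OF w bd rec up, of "\<lambda>i. \<phi> i - j"] filterlim_minus_const_nat[OF \<phi>(1)]
      by simp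
  qed (use \<phi> in simp)
  have "(\<lambda>i. \<Sum>k\<le>\<phi> i. r (\<phi> i - k) * c k) \<longlonglongrightarrow> M * suminf c"
    by (rule convolution_tendsto) (use shift bd c \<phi> in auto)
  then show ?thesis using c(2) by (simp add: LIMSEQ_const_iff)
qed

text \<open>\<open>M\<close> is the upper limit of \<open>r\<close>. Its upper-bound property is
  phrased as a null sequence of excesses, the form in which it can be put into a
  convolution.\<close>

lemma limsup_real_excess:
  fixes r :: "nat \<Rightarrow> real"
  assumes bd: "\<And>n. \<bar>r n\<bar> \<le> B"
  obtains M \<phi> where "(\<lambda>n. max 0 (r n - M)) \<longlonglongrightarrow> 0"
    and "filterlim \<phi> at_top sequentially" and "(\<lambda>i. r (\<phi> i)) \<longlonglongrightarrow> M"
proof -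
  obtain \<phi> :: "nat \<Rightarrow> nat" where \<phi>: "strict_mono \<phi>" "((\<lambda>n. ereal (r n)) \<circ> \<phi>) \<longlonglongrightarrow> limsup (\<lambda>n. ereal (r n))"
    using limsup_subseq_lim by blast
  have "limsup (\<lambda>n. ereal (r n)) \<le> ereal B"
    by (rule Limsup_bounded) (use bd in \<open>auto simp: abs_le_iff intro!: always_eventually\<close>)
  moreover have "ereal (- B) \<le> liminf (\<lambda>n. ereal (r n))"
    using bd by (intro Liminf_bounded always_eventually) (simp add: abs_le_iff minus_le_iff)
  moreover have "liminf (\<lambda>n. ereal (r n)) \<le> limsup (\<lambda>n. ereal (r n))"
    by (rule Liminf_le_Limsup) simp
  ultimately obtain M where M: "limsup (\<lambda>n. ereal (r n)) = ereal M"
    by (cases "limsup (\<lambda>n. ereal (r n))") (auto dest: order_trans)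
  show ?thesis
  proof (rule that)
    show "filterlim \<phi> at_top sequentially" by (rule filterlim_subseq) fact
    show "(\<lambda>i. r (\<phi> i)) \<longlonglongrightarrow> M" using \<phi>(2) unfolding M by (simp add: o_def)
    show "(\<lambda>n. max 0 (r n - M)) \<longlonglongrightarrow> 0"
    proof (rule LIMSEQ_I)
      fix e :: real assume "e > 0"
      then have "limsup (\<lambda>n. ereal (r n)) < ereal (M + e)" by (simp add: M)
      then have "eventually (\<lambda>n. ereal (r n) < ereal (M + e)) sequentially"
        by (rule Limsup_lessD)
      then obtain n0 where n0: "\<And>n. n \<ge> n0 \<Longrightarrow> r n < M + e"
        unfolding eventually_sequentially by auto
      show "\<exists>n0. \<forall>n\<ge>n0. norm (max 0 (r n - M) - 0) < e"
        using \<open>e > 0\<close> n0 by (intro exI[of _ n0]) (auto simp: max_def abs_if dest: n0)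
    qed
  qed
qed

text \<open>The recursion and the conserved sum are linear, so \<open>renewal_limit_value\<close>
  applies to \<open>r\<close> and to \<open>- r\<close>: upper and lower limit both equal
  \<open>C / suminf c\<close>.\<close>

lemma renewal_tendsto:
  fixes r w c :: "nat \<Rightarrow> real"
  assumes w: "\<And>k. 0 \<le> w k" "0 < w 0" "w sums 1"
    and bd: "\<And>n. \<bar>r n\<bar> \<le> B"
    and rec: "\<And>n. r (Suc n) = (\<Sum>k\<le>n. w k * r (n - k))"
    and c: "summable (\<lambda>k. \<bar>c k\<bar>)" "\<And>n. (\<Sum>k\<le>n. r (n - k) * c k) = C" "suminf c \<noteq> 0"
  shows "r \<longlonglongrightarrow> C / suminf c"
proof -
  obtain M \<phi> where M: "(\<lambda>n. max 0 (r n - M)) \<longlonglongrightarrow> 0"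
    "filterlim \<phi> at_top sequentially" "(\<lambda>i. r (\<phi> i)) \<longlonglongrightarrow> M"
    using limsup_real_excess[of r B] bd by blast
  obtain m \<psi> where m: "(\<lambda>n. max 0 (- r n - m)) \<longlonglongrightarrow> 0"
    "filterlim \<psi> at_top sequentially" "(\<lambda>i. - r (\<psi> i)) \<longlonglongrightarrow> m"
    using limsup_real_excess[of "\<lambda>n. - r n" B] bd by auto
  have "M * suminf c = C" by (rule renewal_limit_value[OF w bd rec c(1,2) M])
  moreover have "m * suminf c = - C"
    by (rule renewal_limit_value[OF w _ _ c(1) _ m])
      (use bd c rec in \<open>simp_all add: sum_negf\<close>)
  ultimately have "(m + M) * suminf c = 0" "M = C / suminf c"
    using c(3) by (auto simp: field_simps)
  then have mM: "m = - M" "M = C / suminf c" using c(3) by (auto simp: add_eq_0_iff2)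
  \<comment> \<open>Since \<open>m = - M\<close>, the two excesses are the positive and the negative
    part of \<open>r n - M\<close>, and they add up to its absolute value.\<close>
  have "(\<lambda>n. max 0 (r n - M) + max 0 (- r n - m)) \<longlonglongrightarrow> 0 + 0"
    by (rule tendsto_add[OF M(1) m(1)])
  moreover have "max 0 (r n - M) + max 0 (- r n - m) = \<bar>r n - M\<bar>" for n
    by (simp add: mM(1) max_def abs_if)
  ultimately have "(\<lambda>n. \<bar>r n - M\<bar>) \<longlonglongrightarrow> 0" by simp
  then show ?thesis
    by (simp add: mM(2)[symmetric] tendsto_rabs_zero_iff LIM_zero_iff)
qed

section \<open>The generalized orbit of the partition points\<close>

text \<open>The left-continuous version of the \<open>\<beta>\<close>-transformation: it differs from it at the points \<open>k / \<beta>\<close> with \<open>k \<ge> 1\<close>,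
  which it sends to \<open>1\<close>.\<close>

definition left_map :: "real \<Rightarrow> real \<Rightarrow> real" where
  "left_map \<beta> x = (if x = 0 then 0 else \<beta> * x - \<lceil>\<beta> * x\<rceil> + 1)"

lemma left_map_bounds:
  assumes "x \<noteq> 0"
  shows "0 < left_map \<beta> x" "left_map \<beta> x \<le> 1"
  using assms unfolding left_map_def by (auto simp: algebra_simps) linarith+

text \<open>The distance bound ensures that no integer lies strictly between
  \<open>\<beta> * y\<close> and \<open>\<beta> * x\<close>, so the same integer part is removed at
  both points.\<close>

lemma frac_eq_left_map:
  assumes "\<beta> > 0" "y < x" "\<beta> * (x - y) < left_map \<beta> x" "x \<noteq> 0"
  shows "frac (\<beta> * y) = left_map \<beta> x - \<beta> * (x - y)"
proof -
  have "\<lfloor>\<beta> * y\<rfloor> = \<lceil>\<beta> * x\<rceil> - 1"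
  proof (rule floor_unique)
    show "of_int (\<lceil>\<beta> * x\<rceil> - 1) \<le> \<beta> * y"
      using assms by (simp add: left_map_def algebra_simps)
    have "\<beta> * y < \<beta> * x" using assms by simp
    then show "\<beta> * y < of_int (\<lceil>\<beta> * x\<rceil> - 1) + 1" by simp linarith
  qed
  then show ?thesis using assms by (simp add: frac_def left_map_def algebra_simps)
qed

text \<open>Used at 1, where the value of the \<beta>-transformation is defined as a left
  limit.\<close>

lemma frac_tendsto_left_map:
  assumes "\<beta> > 0" "x \<noteq> 0"
  shows "((\<lambda>y. frac (\<beta> * y)) \<longlongrightarrow> left_map \<beta> x) (at_left x)"
proof (rule Lim_transform_eventually)
  have "((\<lambda>y. left_map \<beta> x - \<beta> * (x - y)) \<longlongrightarrow> left_map \<beta> x - \<beta> * (x - x)) (at_left x)"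
    by (intro tendsto_intros)
  then show "((\<lambda>y. left_map \<beta> x - \<beta> * (x - y)) \<longlongrightarrow> left_map \<beta> x) (at_left x)" by simp
  have "x - left_map \<beta> x / \<beta> < x" using left_map_bounds[OF assms(2)] assms by simp
  then show "eventually (\<lambda>y. left_map \<beta> x - \<beta> * (x - y) = frac (\<beta> * y)) (at_left x)"
    unfolding eventually_at_left_field
  proof (intro exI[of _ "x - left_map \<beta> x / \<beta>"] conjI allI impI)
    fix y assume y: "x - left_map \<beta> x / \<beta> < y" "y < x"
    then have "\<beta> * (x - y) < left_map \<beta> x" using assms by (simp add: field_simps)
    then show "left_map \<beta> x - \<beta> * (x - y) = frac (\<beta> * y)"
      using y assms by (simp add: frac_eq_left_map)
  qed
qed

lemma left_map_eq_frac:
  assumes "\<beta> * x \<notin> \<int>"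
  shows "left_map \<beta> x = frac (\<beta> * x)"
proof -
  have "x \<noteq> 0" using assms by auto
  moreover have "\<lceil>\<beta> * x\<rceil> = \<lfloor>\<beta> * x\<rfloor> + 1" using assms by (simp add: ceiling_altdef Ints_def) (metis Ints_def Ints_of_int assms)
  ultimately show ?thesis by (simp add: left_map_def frac_def)
qed

lemma left_map_eqI:
  assumes "x \<noteq> 0" "real j < \<beta> * x" "\<beta> * x \<le> real j + 1"
  shows "left_map \<beta> x = \<beta> * x - real j"
proof -
  have "\<lceil>\<beta> * x\<rceil> = int j + 1" by (rule ceiling_unique) (use assms in auto)
  then show ?thesis using assms by (simp add: left_map_def)
qed

lemma beta_map_eq_frac: "x \<noteq> 1 \<Longrightarrow> beta_map \<beta> x = frac (\<beta> * x)"
  by (simp add: beta_map_def)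

lemma beta_map_1:
  assumes "\<beta> > 0"
  shows "beta_map \<beta> 1 = left_map \<beta> 1"
  using tendsto_Lim[OF _ frac_tendsto_left_map[OF assms, of 1]] by (simp add: beta_map_def)

lemma eventually_periodic_if_repeats:
  assumes "m < n" "(f ^^ n) x = (f ^^ m) x"
  shows "eventually_periodic f x"
proof -
  let ?F = "(\<lambda>i. (f ^^ i) x) ` {..<n}"
  have "(f ^^ i) x \<in> ?F" for i
  proof (induction i)
    case 0
    then show ?case using assms by (intro image_eqI[of _ _ 0]) auto
  next
    case (Suc i)
    then obtain k where k: "k < n" "(f ^^ i) x = (f ^^ k) x" by auto
    then have *: "(f ^^ Suc i) x = (f ^^ Suc k) x" by simp
    show ?case
    proof (cases "Suc k = n")
      case True
      then show ?thesis using assms * by (intro image_eqI[of _ _ m]) auto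
    next
      case False
      then show ?thesis using k * by (intro image_eqI[of _ _ "Suc k"]) auto
    qed
  qed
  then have "range (\<lambda>i. (f ^^ i) x) \<subseteq> ?F" by blast
  then show ?thesis unfolding eventually_periodic_def by (rule finite_subset) simp
qed

section \<open>Aperiodicity and the orbit of 1\<close>

locale beta_shift =
  fixes \<beta> :: real
  assumes beta_gt_1: "\<beta> > 1"
    and aperiodic: "\<not> eventually_periodic (beta_map \<beta>) 1"
begin

abbreviation "\<tau> \<equiv> beta_map \<beta>"
abbreviation "ps \<equiv> beta_partition \<beta>"
abbreviation "T \<equiv> left_map \<beta>"
abbreviation "J \<equiv> I1 \<tau> ps"

lemma beta_pos [simp]: "0 < \<beta>" "0 \<le> \<beta>" "\<beta> \<noteq> 0" "\<not> \<beta> \<le> 0"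
  using beta_gt_1 by auto

definition orb :: "nat \<Rightarrow> real" where "orb n = (T ^^ n) 1"

lemma orb_0 [simp]: "orb 0 = 1"
  and orb_Suc: "orb (Suc n) = T (orb n)"
  by (simp_all add: orb_def)

lemma beta_map_orbit_inj: "(\<tau> ^^ n) 1 = (\<tau> ^^ m) 1 \<Longrightarrow> n = m"
  using eventually_periodic_if_repeats[of n m \<tau> 1] eventually_periodic_if_repeats[of m n \<tau> 1]
    aperiodic by (cases n m rule: linorder_cases) auto

text \<open>An orbit point at a discontinuity would end in a fixed point: if \<beta> is an integer
  then 1 is fixed, and otherwise the next point is 0, which is fixed. Both contradict injectivity of
  the orbit.\<close>

lemma beta_map_orbit_not_Ints: "\<beta> * (\<tau> ^^ n) 1 \<notin> \<int>"
proof
  assume *: "\<beta> * (\<tau> ^^ n) 1 \<in> \<int>"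
  show False
  proof (cases "n = 0")
    case True
    then have "\<beta> \<in> \<int>" using * by simp
    then have "\<tau> 1 = 1" by (auto simp: beta_map_1 left_map_def elim!: Ints_cases)
    then show False using beta_map_orbit_inj[of 0 1] by simp
  next
    case False
    then have "(\<tau> ^^ n) 1 \<noteq> 1" using beta_map_orbit_inj[of n 0] by auto
    then have "(\<tau> ^^ Suc n) 1 = 0" using * by (simp add: beta_map_eq_frac frac_eq_0_iff)
    moreover from this have "(\<tau> ^^ Suc (Suc n)) 1 = 0" by (simp add: beta_map_eq_frac)
    ultimately show False using beta_map_orbit_inj[of "Suc n" "Suc (Suc n)"] by simp
  qed
qed

lemma beta_not_Ints: "\<beta> \<notin> \<int>"
  using beta_map_orbit_not_Ints[of 0] by simp

text \<open>Inside (0,1) the two maps differ only at points k / \<beta>, which the orbit avoids; at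
  1 both take the left limit.\<close>

lemma orb_eq: "orb n = (\<tau> ^^ n) 1"
proof (induction n)
  case (Suc n)
  show ?case
  proof (cases "n = 0")
    case False
    then have "(\<tau> ^^ n) 1 \<noteq> 1" using beta_map_orbit_inj[of n 0] by auto
    then show ?thesis
      using Suc beta_map_orbit_not_Ints[of n] by (simp add: orb_Suc left_map_eq_frac beta_map_eq_frac)
  qed (simp add: orb_Suc beta_map_1)
qed simp

lemma orb_inj: "orb n = orb m \<longleftrightarrow> n = m"
  using beta_map_orbit_inj by (auto simp: orb_eq)

lemma orb_bounds: "0 < orb n" "orb n \<le> 1"
proof -
  have "0 < orb n \<and> orb n \<le> 1"
    by (induction n) (auto simp: orb_Suc left_map_bounds)
  then show "0 < orb n" "orb n \<le> 1" by auto
qed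

lemma beta_map_eq: "x \<in> {0..1} \<Longrightarrow> \<tau> x = frac (\<beta> * x)"
  using beta_not_Ints by (cases "x = 1") (auto simp: beta_map_eq_frac beta_map_1 left_map_eq_frac)

section \<open>Branches and the set-valued extension of the transformation\<close>

definition full_branches :: nat where "full_branches = nat \<lfloor>\<beta>\<rfloor>"

lemma full_branches: "real full_branches < \<beta>" "\<beta> < real full_branches + 1" "1 \<le> full_branches"
proof -
  have *: "1 \<le> \<lfloor>\<beta>\<rfloor>" using beta_gt_1 by linarith
  then have **: "real full_branches = of_int \<lfloor>\<beta>\<rfloor>" by (simp add: full_branches_def)
  have "real_of_int \<lfloor>\<beta>\<rfloor> \<noteq> \<beta>" using beta_not_Ints by (metis Ints_of_int)
  then show "real full_branches < \<beta>" "\<beta> < real full_branches + 1" unfolding ** using floor_correct[of \<beta>] by linarith+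
  show "1 \<le> full_branches" using * by (simp add: full_branches_def le_nat_iff)
qed

lemma ps_eq: "ps = map (\<lambda>j. real j / \<beta>) [0..<Suc full_branches] @ [1]"
proof -
  have "{0..\<lfloor>\<beta>\<rfloor>} = int ` {0..<Suc full_branches}"
    using beta_gt_1 by (subst image_int_atLeastLessThan) (auto simp: full_branches_def)
  then have "insert 1 ((\<lambda>k. of_int k / \<beta>) ` {0..\<lfloor>\<beta>\<rfloor>})
    = set (map (\<lambda>j. real j / \<beta>) [0..<Suc full_branches] @ [1])"
    by (simp add: image_image del: upt_Suc)
  moreover have "real j / \<beta> < 1" if "j < Suc full_branches" for j
    using full_branches that by (simp add: field_simps)
  then have "sorted_wrt (<) (map (\<lambda>j. real j / \<beta>) [0..<Suc full_branches] @ [1])"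
    by (auto simp: sorted_wrt_append sorted_wrt_map divide_strict_right_mono
        simp del: upt_Suc intro!: sorted_wrt_mono_rel[OF _ sorted_wrt_upt])
  ultimately show ?thesis unfolding beta_partition_def
    by (metis sorted_list_of_set_unique strict_sorted_equal finite_set sorted_list_of_set.idem_if_sorted_distinct strict_sorted_iff)
qed

text \<open>The last cell ends at 1 instead of at \<open>(real full_branches + 1) / \<beta>\<close>.
  As \<beta> is below \<open>real full_branches + 1\<close>, the bound x \<le> 1 already implies the
  inequality, so the truncated branch has the same description as the full ones.\<close>

lemma cell_iff:
  "i \<in> {1..<length ps} \<and> x \<in> {ps ! (i - 1)..ps ! i} \<longleftrightarrow>
    1 \<le> i \<and> x \<in> {0..1} \<and> real (i - 1) \<le> \<beta> * x \<and> \<beta> * x \<le> real (i - 1) + 1"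
  (is "?L \<longleftrightarrow> ?R")
proof
  have nth: "ps ! j = (if j \<le> full_branches then real j / \<beta> else 1)" if "j \<le> Suc full_branches" for j
    using that by (auto simp: ps_eq nth_append simp del: upt_Suc)
  have len: "length ps = full_branches + 2" by (simp add: ps_eq)
  {
    assume ?L
    then have i: "1 \<le> i" "i \<le> Suc full_branches" and x: "real (i - 1) / \<beta> \<le> x" "x \<le> ps ! i"
      using nth[of "i - 1"] by (auto simp: len split: if_splits)
    have x0: "0 \<le> x" using x(1) by (rule order_trans[rotated]) simp
    show ?R
    proof (cases "i \<le> full_branches")
      case True
      then have "x \<le> real i / \<beta>" using x nth[of i] by simp
      moreover have "real i / \<beta> \<le> 1" using True full_branches by (simp add: field_simps)
      ultimately have "x \<le> 1" "\<beta> * x \<le> real i" by (linarith, simp add: field_simps)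
      then show ?thesis using x x0 i by (auto simp: field_simps)
    next
      case False
      then have "i = Suc full_branches" "x \<le> 1" using i x nth[of i] by auto
      moreover from this have "\<beta> * x \<le> \<beta>" by simp
      then have "\<beta> * x \<le> real full_branches + 1" using full_branches by linarith
      ultimately show ?thesis using full_branches x0 x by (auto simp: field_simps)
    qed
  next
    assume R: ?R
    then have "\<beta> * x \<le> \<beta> * 1" by (intro mult_left_mono) auto
    then have "real (i - 1) < real full_branches + 1" using R full_branches by linarith
    then have "i \<le> Suc full_branches" using R by linarith
    then show ?L using R nth[of "i - 1"] nth[of i] by (auto simp: len field_simps)
  }
qed

lemma branch_eq:
  assumes "i \<in> {1..<length ps}" "x \<in> {ps ! (i - 1)..ps ! i}"
  shows "branch \<tau> ps i x = \<beta> * x - real (i - 1)"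
proof -
  have i: "1 \<le> i" "i \<le> Suc full_branches" using assms by (auto simp: ps_eq)
  have lt: "ps ! (i - 1) < ps ! i"
    using i full_branches by (auto simp: ps_eq nth_append field_simps simp del: upt_Suc)
  \<comment> \<open>\<open>Lim\<close> is determined only at limit points of the open cell; the
    endpoints of the cell are included here.\<close>
  have ntriv: "at x within {ps ! (i - 1)<..<ps ! i} \<noteq> bot"
  proof -
    have "x islimpt {ps ! (i - 1)<..<ps ! i}"
      using assms(2) lt interior_limit_point[of x "{ps ! (i - 1)<..<ps ! i}"]
      by (cases "x = ps ! (i - 1)"; cases "x = ps ! i")
        (auto simp: islimpt_greaterThanLessThan1 islimpt_greaterThanLessThan2 interior_open)
    then show ?thesis by (simp add: trivial_limit_within)
  qed
  have "((\<lambda>y. \<beta> * y - real (i - 1)) \<longlongrightarrow> \<beta> * x - real (i - 1)) (at x within {ps ! (i - 1)<..<ps ! i})"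
    by (intro tendsto_intros)
  then have "(\<tau> \<longlongrightarrow> \<beta> * x - real (i - 1)) (at x within {ps ! (i - 1)<..<ps ! i})"
  proof (rule Lim_transform_eventually)
    show "eventually (\<lambda>y. \<beta> * y - real (i - 1) = \<tau> y) (at x within {ps ! (i - 1)<..<ps ! i})"
      unfolding eventually_at_topological
    proof (intro exI[of _ UNIV] conjI ballI impI)
      fix y assume y: "y \<in> {ps ! (i - 1)<..<ps ! i}"
      then have "1 \<le> i \<and> y \<in> {0..1} \<and> real (i - 1) \<le> \<beta> * y \<and> \<beta> * y \<le> real (i - 1) + 1"
        using cell_iff[of i y] assms by auto
      moreover have "\<beta> * y \<noteq> real (i - 1) + 1"
      proof
        assume "\<beta> * y = real (i - 1) + 1"
        then have yi: "y = real i / \<beta>" using i by (simp add: field_simps)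
        have "i \<le> full_branches"
        proof (rule ccontr)
          assume "\<not> i \<le> full_branches"
          then have "i = Suc full_branches" using i by simp
          then show False using y yi full_branches by (auto simp: ps_eq nth_append field_simps)
        qed
        then show False using y yi by (auto simp: ps_eq nth_append simp del: upt_Suc)
      qed
      ultimately have "y \<in> {0..1}" "\<lfloor>\<beta> * y\<rfloor> = int (i - 1)"
        by (auto intro!: floor_unique)
      then show "\<beta> * y - real (i - 1) = \<tau> y"
        by (simp add: beta_map_eq frac_def)
    qed auto
  qed
  then show ?thesis unfolding branch_def by (rule tendsto_Lim[OF ntriv])
qed

text \<open>The graph of the set-valued extension. A point k / \<beta> with k \<ge> 1 has the two
  images 0 and 1, while 0 has only the image 0. Along this graph, forward and backward invariance of
  a set merge into a single equivalence.\<close>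

definition hat :: "real \<Rightarrow> real \<Rightarrow> bool" where
  "hat x y \<longleftrightarrow> x \<in> {0..1} \<and> (\<exists>j::nat. real j \<le> \<beta> * x \<and> \<beta> * x \<le> real j + 1 \<and> y = \<beta> * x - real j)"

lemma hat_image_eq: "hat_image \<tau> ps A = {y. \<exists>x\<in>A. hat x y}"
proof (intro equalityI subsetI)
  fix y assume "y \<in> hat_image \<tau> ps A"
  then obtain i x where *: "i \<in> {1..<length ps}" "x \<in> {ps ! (i - 1)..ps ! i}" "x \<in> A"
    "y = branch \<tau> ps i x" by (auto simp: hat_image_def)
  then show "y \<in> {y. \<exists>x\<in>A. hat x y}"
    using cell_iff[of i x] branch_eq[of i x] unfolding hat_def by blast
next
  fix y assume "y \<in> {y. \<exists>x\<in>A. hat x y}"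
  then obtain x j where *: "x \<in> A" "x \<in> {0..1}" "real j \<le> \<beta> * x" "\<beta> * x \<le> real j + 1"
    "y = \<beta> * x - real j" unfolding hat_def by auto
  then have **: "Suc j \<in> {1..<length ps} \<and> x \<in> {ps ! (Suc j - 1)..ps ! Suc j}"
    by (subst cell_iff) auto
  then have "y = branch \<tau> ps (Suc j) x" using branch_eq[of "Suc j" x] * by simp
  then show "y \<in> hat_image \<tau> ps A" unfolding hat_image_def using ** * by blast
qed

lemma hat_vimage_eq: "hat_vimage \<tau> ps A = {x. \<exists>y\<in>A. hat x y}"
proof (intro equalityI subsetI)
  fix x assume "x \<in> hat_vimage \<tau> ps A"
  then obtain i where *: "i \<in> {1..<length ps}" "x \<in> {ps ! (i - 1)..ps ! i}"
    "branch \<tau> ps i x \<in> A" by (auto simp: hat_vimage_def)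
  then show "x \<in> {x. \<exists>y\<in>A. hat x y}"
    using cell_iff[of i x] branch_eq[of i x] unfolding hat_def by fastforce
next
  fix x assume "x \<in> {x. \<exists>y\<in>A. hat x y}"
  then obtain y j where *: "y \<in> A" "x \<in> {0..1}" "real j \<le> \<beta> * x" "\<beta> * x \<le> real j + 1"
    "y = \<beta> * x - real j" unfolding hat_def by auto
  then have **: "Suc j \<in> {1..<length ps} \<and> x \<in> {ps ! (Suc j - 1)..ps ! Suc j}"
    by (subst cell_iff) auto
  then have "y = branch \<tau> ps (Suc j) x" using branch_eq[of "Suc j" x] * by simp
  then show "x \<in> hat_vimage \<tau> ps A" unfolding hat_vimage_def using ** * by blast
qed

lemma set_ps: "set ps = insert 1 ((\<lambda>j. real j / \<beta>) ` {..full_branches})"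
  by (simp add: ps_eq lessThan_Suc_atMost[symmetric] atLeast0LessThan del: upt_Suc)

lemma set_ps_subset: "set ps \<subseteq> {0..1}"
  using full_branches by (auto simp: set_ps field_simps)

lemma hat_in_unit: "hat x y \<Longrightarrow> x \<in> {0..1} \<and> y \<in> {0..1}"
  by (auto simp: hat_def)

section \<open>Invariance and induction along the generalized orbit\<close>

lemma gen_orbit_subset:
  assumes "A \<subseteq> {0..1}" "x \<in> A" "\<And>x y. hat x y \<Longrightarrow> x \<in> A \<longleftrightarrow> y \<in> A"
  shows "gen_orbit \<tau> ps x \<subseteq> A"
  unfolding gen_orbit_def hat_image_eq hat_vimage_eq
  by (rule Inter_lower) (use assms in blast)

lemma gen_orbit_hat:
  assumes "hat x y"
  shows "x \<in> gen_orbit \<tau> ps z \<longleftrightarrow> y \<in> gen_orbit \<tau> ps z"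
  using assms unfolding gen_orbit_def hat_image_eq hat_vimage_eq by blast

lemma J_subset: "J \<subseteq> {0..1}"
proof -
  have "gen_orbit \<tau> ps x \<subseteq> {0..1}" if "x \<in> set ps" for x
    by (rule gen_orbit_subset) (use that set_ps_subset hat_in_unit in blast)+
  then show ?thesis unfolding I1_def by blast
qed

lemma J_hat: "hat x y \<Longrightarrow> x \<in> J \<longleftrightarrow> y \<in> J"
  unfolding I1_def using gen_orbit_hat by blast

lemma ps_in_J: "x \<in> set ps \<Longrightarrow> x \<in> J"
  unfolding I1_def gen_orbit_def by blast

lemma in_J_01 [simp]: "0 \<in> J" "1 \<in> J"
  by (rule ps_in_J, force simp: set_ps)+

lemma hat_left_map:
  assumes "0 < x" "x \<le> 1"
  shows "hat x (T x)"
proof -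
  have "0 < \<lceil>\<beta> * x\<rceil>" using assms by simp
  then have "real (nat (\<lceil>\<beta> * x\<rceil> - 1)) = \<lceil>\<beta> * x\<rceil> - 1" by simp
  then show ?thesis using assms unfolding hat_def left_map_def
    by (intro conjI exI[of _ "nat (\<lceil>\<beta> * x\<rceil> - 1)"]; simp; linarith)
qed

lemma hat_frac:
  assumes "0 \<le> x" "x \<le> 1"
  shows "hat x (frac (\<beta> * x))"
proof -
  have "0 \<le> \<lfloor>\<beta> * x\<rfloor>" using assms by simp
  then have "real (nat \<lfloor>\<beta> * x\<rfloor>) = \<lfloor>\<beta> * x\<rfloor>" by simp
  then show ?thesis using assms unfolding hat_def frac_def
    by (intro conjI exI[of _ "nat \<lfloor>\<beta> * x\<rfloor>"]; simp; linarith)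
qed

lemma J_left_map: "0 < x \<Longrightarrow> x \<le> 1 \<Longrightarrow> T x \<in> J \<longleftrightarrow> x \<in> J"
  using J_hat[OF hat_left_map] by blast

lemma J_frac: "0 \<le> x \<Longrightarrow> x \<le> 1 \<Longrightarrow> frac (\<beta> * x) \<in> J \<longleftrightarrow> x \<in> J"
  using J_hat[OF hat_frac] by blast

lemma orb_in_J: "orb n \<in> J"
  by (induction n) (auto simp: orb_Suc J_left_map orb_bounds)

text \<open>The set \<open>A\<close> consisting of 0 and of the points satisfying \<open>P\<close>
  is invariant under \<open>hat\<close>. An edge ending at a positive point is an application of
  \<open>T\<close>. An edge ending at 0 starts at 0 or at some k / \<beta>, which \<open>T\<close>
  sends to 1, so \<open>P 1\<close> decides it. The step is an equivalence because generalized
  orbits extend backwards as well as forwards.\<close>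

lemma J_induct [consumes 2, case_names one step]:
  assumes "x \<in> J" "0 < x" "P 1" and step: "\<And>x. 0 < x \<Longrightarrow> x \<le> 1 \<Longrightarrow> P x \<longleftrightarrow> P (T x)"
  shows "P x"
proof -
  define A where "A = {x. x = 0 \<or> 0 < x \<and> x \<le> 1 \<and> P x}"
  have hat0: "hat x y \<Longrightarrow> 0 < y \<Longrightarrow> 0 < x \<and> y = T x" for x y
    unfolding hat_def by (cases "x = 0") (auto simp: left_map_eqI)
  have hat1: "hat x 0 \<Longrightarrow> x = 0 \<or> 0 < x \<and> x \<le> 1 \<and> T x = 1" for x
  proof -
    assume "hat x 0"
    then obtain j where j: "x \<in> {0..1}" "\<beta> * x = real j" unfolding hat_def by auto
    then show ?thesis by (auto simp: left_map_def)
  qed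
  have "gen_orbit \<tau> ps z \<subseteq> A" if z: "z \<in> set ps" for z
  proof (rule gen_orbit_subset)
    show "A \<subseteq> {0..1}" by (auto simp: A_def)
    have P1: "P x" if "0 < x" "x \<le> 1" "T x = 1" for x using step[OF that(1,2)] assms that by simp
    show "z \<in> A"
    proof (cases "z = 1")
      case False
      then obtain j where "z = real j / \<beta>" "j \<le> full_branches" using z by (auto simp: set_ps)
      moreover have "z \<le> 1" using z set_ps_subset by auto
      ultimately show ?thesis
        by (cases "j = 0") (auto simp: A_def left_map_def intro!: P1)
    qed (use assms in \<open>simp add: A_def\<close>)
    show "x \<in> A \<longleftrightarrow> y \<in> A" if "hat x y" for x y
    proof (cases "y = 0")
      case True
      then show ?thesis using hat1[of x] that P1 by (auto simp: A_def)
    next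
      case False
      then have "0 < x" "y = T x" using that hat0[of x y] hat_in_unit[OF that] by auto
      then show ?thesis using hat_in_unit[OF that] False step[of x] by (auto simp: A_def)
    qed
  qed
  then have "J \<subseteq> A" unfolding I1_def by blast
  then show ?thesis using assms by (auto simp: A_def)
qed

text \<open>Every positive point of \<open>J\<close> is sent into the orbit of 1 by some iterate of
  \<open>T\<close>, and preimages of countable sets under \<open>T\<close> are countable. The
  resulting density of \<open>I0\<close> is what makes the associated map unique.\<close>

lemma countable_J: "countable J"
proof -
  define C where "C = (\<Union>n. {x. (T ^^ n) x \<in> range orb})"
  have pre: "countable {x. T x \<in> D}" if "countable D" for D
  proof (rule countable_subset)
    show "{x. T x \<in> D} \<subseteq> insert 0 (\<Union>k::int. (\<lambda>d. (d + of_int k) / \<beta>) ` D)"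
    proof
      fix x assume "x \<in> {x. T x \<in> D}"
      then show "x \<in> insert 0 (\<Union>k::int. (\<lambda>d. (d + of_int k) / \<beta>) ` D)"
        by (cases "x = 0") (auto simp: left_map_def intro!: image_eqI[of _ _ "T x"] exI[of _ "\<lceil>\<beta> * x\<rceil> - 1"])
    qed
  qed (use that in auto)
  have "countable {x. (T ^^ n) x \<in> range orb}" for n
  proof (induction n)
    case 0
    have "{x. x \<in> range orb} = range orb" by auto
    then show ?case by simp
  next
    case (Suc n)
    then show ?case using pre[OF Suc] by (simp add: funpow_swap1)
  qed
  then have "countable C" by (simp add: C_def)
  moreover have "J \<subseteq> insert 0 C"
  proof
    fix x assume x: "x \<in> J"
    show "x \<in> insert 0 C"
    proof (cases "x = 0")
      case False
      then have "0 < x" using x J_subset by auto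
      with x have "x \<in> C"
      proof (induction rule: J_induct)
        case one
        have "(T ^^ 0) 1 \<in> range orb" by (simp add: image_iff) (metis orb_0)
        then show ?case unfolding C_def by blast
      next
        case (step x)
        have "(T ^^ n) (T x) \<in> range orb" if "(T ^^ n) x \<in> range orb" for n
        proof -
          from that obtain m where "(T ^^ n) x = orb m" by auto
          then have "(T ^^ n) (T x) = orb (Suc m)" by (simp add: orb_Suc funpow_swap1[symmetric])
          then show ?thesis by simp
        qed
        moreover have "(T ^^ Suc n) x \<in> range orb" if "(T ^^ n) (T x) \<in> range orb" for n
          using that by (simp add: funpow_swap1)
        ultimately show ?case unfolding C_def by blast
      qed
      then show ?thesis by simp
    qed simp
  qed
  ultimately show ?thesis by (meson countable_insert countable_subset)
qed

lemma I0_dense: 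
  assumes "(x::real) < y" "0 \<le> x" "y \<le> 1"
  shows "\<exists>z\<in>I0 \<tau> ps. x < z \<and> z < y"
proof -
  have "\<not> {x<..<y} \<subseteq> J"
    using countable_J uncountable_open_interval[of x y] assms countable_subset by blast
  then show ?thesis using assms unfolding I0_def by fastforce
qed

section \<open>The split interval and its local homeomorphism\<close>

abbreviation "XS \<equiv> X_set \<tau> ps"
abbreviation "XT \<equiv> X_top \<tau> ps"

text \<open>The right copy of \<open>x\<close> if \<open>x\<close> is doubled and the only copy otherwise.
  Right neighbourhoods in \<open>[0,1]\<close> belong to this point, left neighbourhoods to \<open>(x, False)\<close>.\<close>

definition upper :: "real \<Rightarrow> split_point" where
  "upper x = (x, x \<in> J - {0, 1})"

lemma in_X: "(x, b) \<in> XS \<longleftrightarrow> 0 \<le> x \<and> x \<le> 1 \<and> (b \<longrightarrow> x \<in> J \<and> x \<noteq> 0 \<and> x \<noteq> 1)"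
  by (auto simp: X_set_def)

lemma upper_in_X: "upper x \<in> XS \<longleftrightarrow> 0 \<le> x \<and> x \<le> 1"
  by (auto simp: upper_def in_X)

lemma fst_upper [simp]: "fst (upper x) = x"
  by (simp add: upper_def)

lemma upper_eqI: "(x, True) \<in> XS \<Longrightarrow> upper x = (x, True)"
  by (auto simp: upper_def in_X)

section \<open>The order topology described by one-sided neighbourhoods\<close>

definition left_nbhd :: "split_point set \<Rightarrow> real \<Rightarrow> bool" where
  "left_nbhd U x \<longleftrightarrow> (\<exists>d>0. \<forall>y b. x - d < y \<longrightarrow> y < x \<longrightarrow> (y, b) \<in> XS \<longrightarrow> (y, b) \<in> U)"

definition right_nbhd :: "split_point set \<Rightarrow> real \<Rightarrow> bool" where
  "right_nbhd U x \<longleftrightarrow> (\<exists>d>0. \<forall>y b. x < y \<longrightarrow> y < x + d \<longrightarrow> (y, b) \<in> XS \<longrightarrow> (y, b) \<in> U)"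

lemma left_nbhd_Int: 
  assumes "left_nbhd U x" "left_nbhd V x" shows "left_nbhd (U \<inter> V) x"
proof -
  obtain d e where "d > 0" "e > 0"
    "\<And>y b. x - d < y \<Longrightarrow> y < x \<Longrightarrow> (y, b) \<in> XS \<Longrightarrow> (y, b) \<in> U"
    "\<And>y b. x - e < y \<Longrightarrow> y < x \<Longrightarrow> (y, b) \<in> XS \<Longrightarrow> (y, b) \<in> V"
    using assms unfolding left_nbhd_def by blast
  then show ?thesis unfolding left_nbhd_def by (intro exI[of _ "min d e"]) auto
qed

lemma right_nbhd_Int: 
  assumes "right_nbhd U x" "right_nbhd V x" shows "right_nbhd (U \<inter> V) x"
proof -
  obtain d e where "d > 0" "e > 0"
    "\<And>y b. x < y \<Longrightarrow> y < x + d \<Longrightarrow> (y, b) \<in> XS \<Longrightarrow> (y, b) \<in> U"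
    "\<And>y b. x < y \<Longrightarrow> y < x + e \<Longrightarrow> (y, b) \<in> XS \<Longrightarrow> (y, b) \<in> V"
    using assms unfolding right_nbhd_def by blast
  then show ?thesis unfolding right_nbhd_def by (intro exI[of _ "min d e"]) auto
qed

lemma left_nbhd_mono: "left_nbhd U x \<Longrightarrow> U \<subseteq> V \<Longrightarrow> left_nbhd V x"
  unfolding left_nbhd_def by blast

lemma right_nbhd_mono: "right_nbhd U x \<Longrightarrow> U \<subseteq> V \<Longrightarrow> right_nbhd V x"
  unfolding right_nbhd_def by blast

text \<open>A left copy needs only a left neighbourhood and a right copy only a right one; an
  undoubled point is both \<open>(x, False)\<close> and \<open>upper x\<close> and needs both. At 0
  and at 1 the outer condition is vacuous. By \<open>openin_iff_two_sided\<close> these are exactly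
  the open sets.\<close>

definition two_sided :: "split_point set \<Rightarrow> bool" where
  "two_sided U \<longleftrightarrow> U \<subseteq> XS \<and> (\<forall>x. (x, False) \<in> U \<longrightarrow> left_nbhd U x) \<and> (\<forall>x. upper x \<in> U \<longrightarrow> right_nbhd U x)"

lemma openin_below: "p \<in> XS \<Longrightarrow> openin XT {q \<in> XS. X_less q p}"
  unfolding X_top_def by (rule topology_generated_by_Basis) blast

lemma openin_above: "p \<in> XS \<Longrightarrow> openin XT {q \<in> XS. X_less p q}"
  unfolding X_top_def by (rule topology_generated_by_Basis) blast

lemma topspace_XT [simp]: "topspace XT = XS"
  unfolding X_top_def by auto

lemma openin_X: "openin XT XS"
  using openin_topspace[of XT] by simp

lemma two_sided_below:
  assumes "p \<in> XS"
  shows "two_sided {q \<in> XS. X_less q p}"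
  unfolding two_sided_def
proof (intro conjI allI impI)
  fix x assume "(x, False) \<in> {q \<in> XS. X_less q p}"
  then show "left_nbhd {q \<in> XS. X_less q p} x"
    unfolding left_nbhd_def by (intro exI[of _ 1]) (auto simp: X_less_def)
next
  fix x assume "upper x \<in> {q \<in> XS. X_less q p}"
  then have "x < fst p" using assms by (cases p) (auto simp: X_less_def upper_def in_X)
  then show "right_nbhd {q \<in> XS. X_less q p} x"
    unfolding right_nbhd_def by (intro exI[of _ "fst p - x"]) (auto simp: X_less_def)
qed auto

lemma two_sided_above:
  assumes "p \<in> XS"
  shows "two_sided {q \<in> XS. X_less p q}"
  unfolding two_sided_def
proof (intro conjI allI impI)
  fix x assume "(x, False) \<in> {q \<in> XS. X_less p q}"
  then have "fst p < x" by (auto simp: X_less_def)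
  then show "left_nbhd {q \<in> XS. X_less p q} x"
    unfolding left_nbhd_def by (intro exI[of _ "x - fst p"]) (auto simp: X_less_def)
next
  fix x assume "upper x \<in> {q \<in> XS. X_less p q}"
  then show "right_nbhd {q \<in> XS. X_less p q} x"
    unfolding right_nbhd_def by (intro exI[of _ 1]) (auto simp: X_less_def)
qed auto

lemma openin_imp_two_sided:
  assumes "openin XT U"
  shows "two_sided U"
proof -
  have "generate_topology_on (insert XS
       ((\<lambda>p. {q \<in> XS. X_less q p}) ` XS \<union> (\<lambda>p. {q \<in> XS. X_less p q}) ` XS)) U"
    using assms unfolding X_top_def by (rule openin_topology_generated_by)
  then show ?thesis
  proof induction
    case (Int U V)
    then show ?case unfolding two_sided_def
      by (auto intro: left_nbhd_Int right_nbhd_Int)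
  next
    case (UN K)
    then have *: "two_sided U" if "U \<in> K" for U using that by blast
    then show ?case unfolding two_sided_def
      by (fast elim: left_nbhd_mono right_nbhd_mono)
  next
    case (Basis s)
    then consider "s = XS" | p where "p \<in> XS" "s = {q \<in> XS. X_less q p}" | p where "p \<in> XS" "s = {q \<in> XS. X_less p q}"
      by blast
    then show ?case
    proof cases
      case 1
      then show ?thesis unfolding two_sided_def left_nbhd_def right_nbhd_def
        using zero_less_one by blast
    qed (use two_sided_below two_sided_above in auto)
  qed (simp add: two_sided_def)
qed

text \<open>A right copy has its left twin as immediate predecessor, so the ray above the twin
  contains nothing smaller than the point. For a left copy the ray starts inside the left
  neighbourhood, and at 0 the whole space serves. The last clause records that the twin is
  excluded.\<close>

lemma two_sided_lower_nbhd:
  assumes "two_sided U" "(x, b) \<in> U"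
  obtains L where "openin XT L" "(x, b) \<in> L"
    "\<And>y c. (y, c) \<in> L \<Longrightarrow> y < x \<Longrightarrow> (y, c) \<in> U" "\<And>c. (x, c) \<in> L \<Longrightarrow> b \<Longrightarrow> c"
proof (cases b)
  case True
  have "(x, False) \<in> XS" using assms by (auto simp: two_sided_def in_X)
  then have "openin XT {q \<in> XS. X_less (x, False) q}" by (rule openin_above)
  moreover have "(x, b) \<in> XS" using assms by (auto simp: two_sided_def)
  ultimately show ?thesis using True
    by (intro that[of "{q \<in> XS. X_less (x, False) q}"]) (auto simp: X_less_def)
next
  case False
  then have xX: "(x, False) \<in> XS" and "left_nbhd U x" using assms by (auto simp: two_sided_def)
  then obtain d where d: "d > 0" "\<And>y b. x - d < y \<Longrightarrow> y < x \<Longrightarrow> (y, b) \<in> XS \<Longrightarrow> (y, b) \<in> U"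
    unfolding left_nbhd_def by blast
  show ?thesis
  proof (cases "x = 0")
    case True
    then show ?thesis using xX False by (intro that[of XS] openin_X) (auto simp: in_X)
  next
    case False
    then obtain y where y: "max 0 (x - d) < y" "y < x"
      using d dense[of "max 0 (x - d)" x] xX by (auto simp: in_X)
    then have "(y, False) \<in> XS" using xX by (auto simp: in_X)
    then have "openin XT {q \<in> XS. X_less (y, False) q}" by (rule openin_above)
    then show ?thesis using y d xX \<open>\<not> b\<close>
      by (intro that[of "{q \<in> XS. X_less (y, False) q}"]) (auto simp: X_less_def)
  qed
qed

lemma two_sided_upper_nbhd:
  assumes "two_sided U" "(x, b) \<in> U"
  obtains R where "openin XT R" "(x, b) \<in> R"
    "\<And>y c. (y, c) \<in> R \<Longrightarrow> x < y \<Longrightarrow> (y, c) \<in> U" "\<And>c. (x, c) \<in> R \<Longrightarrow> c \<Longrightarrow> b"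
proof (cases "(x, b) = upper x")
  case False
  have xX: "(x, b) \<in> XS" using assms by (auto simp: two_sided_def)
  then have b: "\<not> b" "(x, True) \<in> XS" using False by (auto simp: upper_def in_X)
  then have "openin XT {q \<in> XS. X_less q (x, True)}" by (intro openin_below)
  then show ?thesis using b xX
    by (intro that[of "{q \<in> XS. X_less q (x, True)}"]) (auto simp: X_less_def)
next
  case True
  then have xX: "(x, b) \<in> XS" and "right_nbhd U x" using assms by (auto simp: two_sided_def)
  then obtain d where d: "d > 0" "\<And>y b. x < y \<Longrightarrow> y < x + d \<Longrightarrow> (y, b) \<in> XS \<Longrightarrow> (y, b) \<in> U"
    unfolding right_nbhd_def by blast
  have b: "(x, c) \<in> XS \<Longrightarrow> c \<Longrightarrow> b" for c using True by (auto simp: upper_def in_X)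
  show ?thesis
  proof (cases "x = 1")
    case True
    then show ?thesis using xX b by (intro that[of XS] openin_X) (auto simp: in_X)
  next
    case False
    then obtain y where y: "x < y" "y < min 1 (x + d)"
      using d dense[of x "min 1 (x + d)"] xX by (auto simp: in_X)
    then have "(y, False) \<in> XS" using xX by (auto simp: in_X)
    then have "openin XT {q \<in> XS. X_less q (y, False)}" by (rule openin_below)
    then show ?thesis using y d xX b
      by (intro that[of "{q \<in> XS. X_less q (y, False)}"]) (auto simp: X_less_def)
  qed
qed

lemma openin_iff_two_sided: "openin XT U \<longleftrightarrow> two_sided U"
proof
  assume U: "two_sided U"
  show "openin XT U"
  proof (subst openin_subopen, intro ballI)
    fix p assume "p \<in> U"
    obtain x b where p: "p = (x, b)" by (cases p)
    obtain L where L: "openin XT L" "(x, b) \<in> L"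
      "\<And>y c. (y, c) \<in> L \<Longrightarrow> y < x \<Longrightarrow> (y, c) \<in> U" "\<And>c. (x, c) \<in> L \<Longrightarrow> b \<Longrightarrow> c"
      using two_sided_lower_nbhd[OF U, of x b] \<open>p \<in> U\<close> p by metis
    obtain R where R: "openin XT R" "(x, b) \<in> R"
      "\<And>y c. (y, c) \<in> R \<Longrightarrow> x < y \<Longrightarrow> (y, c) \<in> U" "\<And>c. (x, c) \<in> R \<Longrightarrow> c \<Longrightarrow> b"
      using two_sided_upper_nbhd[OF U, of x b] \<open>p \<in> U\<close> p by metis
    \<comment> \<open>Over \<open>x\<close> itself the last clauses of the two choices leave only
      the copy \<open>b\<close>.\<close>
    have "L \<inter> R \<subseteq> U"
    proof
      fix q assume q: "q \<in> L \<inter> R"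
      obtain y c where qq: "q = (y, c)" by (cases q)
      show "q \<in> U"
      proof (cases y x rule: linorder_cases)
        case equal
        then have "c = b" using L(4)[of c] R(4)[of c] q qq by auto
        then show ?thesis using equal qq \<open>p \<in> U\<close> p by simp
      qed (use L R q qq in auto)
    qed
    then show "\<exists>T. openin XT T \<and> p \<in> T \<and> T \<subseteq> U"
      using L R p by (intro exI[of _ "L \<inter> R"]) auto
  qed
qed (rule openin_imp_two_sided)

section \<open>Separation and density, which make a continuous extension unique\<close>

lemma X_less_linear:
  assumes "p \<noteq> q"
  shows "X_less p q \<or> X_less q p"
  using assms by (cases p, cases q) (auto simp: X_less_def)

text \<open>When no point lies strictly between \<open>p\<close> and \<open>q\<close>, the ray below
  \<open>q\<close> and the ray above \<open>p\<close> are already disjoint. This is how the two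
  copies of a doubled point are separated.\<close>

lemma Hausdorff_XT: "Hausdorff_space XT"
proof -
  have *: "\<exists>U V. openin XT U \<and> openin XT V \<and> p \<in> U \<and> q \<in> V \<and> disjnt U V"
    if "p \<in> XS" "q \<in> XS" "X_less p q" for p q
  proof (cases "\<exists>r\<in>XS. X_less p r \<and> X_less r q")
    case True
    then obtain r where r: "r \<in> XS" "X_less p r" "X_less r q" by blast
    have "disjnt {s \<in> XS. X_less s r} {s \<in> XS. X_less r s}"
      by (auto simp: disjnt_def X_less_def)
    then show ?thesis using r that openin_below openin_above by blast
  next
    case False
    then have "disjnt {s \<in> XS. X_less s q} {s \<in> XS. X_less p s}"
      by (auto simp: disjnt_def)
    then show ?thesis using that openin_below openin_above by blast
  qed
  show ?thesis unfolding Hausdorff_space_def topspace_XT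
  proof (intro allI impI)
    fix p q assume pq: "p \<in> XS \<and> q \<in> XS \<and> p \<noteq> q"
    then show "\<exists>U V. openin XT U \<and> openin XT V \<and> p \<in> U \<and> q \<in> V \<and> disjnt U V"
      using *[of p q] *[of q p] X_less_linear[of p q] disjnt_sym by metis
  qed
qed

text \<open>Each neighbourhood of a point contains everything over an interval on one side: the
  right side for right copies and for 0, the left side otherwise. That interval meets
  \<open>I0\<close>.\<close>

lemma closure_I0: "XT closure_of {p \<in> XS. fst p \<in> I0 \<tau> ps} = XS"
proof
  show "XT closure_of {p \<in> XS. fst p \<in> I0 \<tau> ps} \<subseteq> XS"
    using closure_of_subset_topspace[of XT] by simp
  show "XS \<subseteq> XT closure_of {p \<in> XS. fst p \<in> I0 \<tau> ps}"
  proof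
    fix p assume p: "p \<in> XS"
    have "\<exists>q\<in>{p \<in> XS. fst p \<in> I0 \<tau> ps}. q \<in> U" if U: "openin XT U" "p \<in> U" for U
    proof -
      have ts: "two_sided U" using U openin_iff_two_sided by blast
      obtain x b where px: "p = (x, b)" by (cases p)
      have goal: ?thesis if "z \<in> I0 \<tau> ps" "(z, False) \<in> XS \<Longrightarrow> (z, False) \<in> U" for z
        using that by (intro bexI[of _ "(z, False)"]) (auto simp: in_X I0_def)
      show ?thesis
      proof (cases "b \<or> x = 0")
        case True
        then have "p = upper x" using p px by (auto simp: upper_def in_X)
        then have "right_nbhd U x" using ts U by (auto simp: two_sided_def)
        then obtain d where d: "d > 0" "\<And>y b. x < y \<Longrightarrow> y < x + d \<Longrightarrow> (y, b) \<in> XS \<Longrightarrow> (y, b) \<in> U"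
          unfolding right_nbhd_def by blast
        have "x < min 1 (x + d)" "0 \<le> x" using True p px d by (auto simp: in_X)
        then obtain z where "z \<in> I0 \<tau> ps" "x < z" "z < min 1 (x + d)"
          using I0_dense[of x "min 1 (x + d)"] by auto
        then show ?thesis using goal[of z] d(2)[of z False] by simp
      next
        case False
        then have "left_nbhd U x" using ts U px by (auto simp: two_sided_def)
        then obtain d where d: "d > 0" "\<And>y b. x - d < y \<Longrightarrow> y < x \<Longrightarrow> (y, b) \<in> XS \<Longrightarrow> (y, b) \<in> U"
          unfolding left_nbhd_def by blast
        have "max 0 (x - d) < x" "x \<le> 1" using False p px d by (auto simp: in_X)
        then obtain z where "z \<in> I0 \<tau> ps" "max 0 (x - d) < z" "z < x"
          using I0_dense[of "max 0 (x - d)" x] by auto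
        then show ?thesis using goal[of z] d(2)[of z False] by simp
      qed
    qed
    then show "p \<in> XT closure_of {p \<in> XS. fst p \<in> I0 \<tau> ps}"
      using p by (auto simp: in_closure_of)
  qed
qed

text \<open>Left copies follow the left-continuous version of \<tau>, right copies the
  right-continuous one. The latter may land at 0, which is not doubled, hence \<open>upper\<close>
  in place of the flag \<open>True\<close>.\<close>

definition sigma_map :: "split_point \<Rightarrow> split_point" where
  "sigma_map = (\<lambda>p\<in>XS. if snd p then upper (frac (\<beta> * fst p)) else (T (fst p), False))"

lemma T_unit: "0 \<le> x \<Longrightarrow> x \<le> 1 \<Longrightarrow> 0 \<le> T x \<and> T x \<le> 1"
  using left_map_bounds[of x \<beta>] by (cases "x = 0") (auto simp: left_map_def)

lemma frac_unit: "0 \<le> frac x" "frac x \<le> 1" "frac x < 1"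
  using frac_lt_1[of x] by (auto intro: less_imp_le)

lemma sigma_map_lower: "(x, False) \<in> XS \<Longrightarrow> sigma_map (x, False) = (T x, False)"
  by (simp add: sigma_map_def)

lemma not_in_J_not_Ints:
  assumes "0 \<le> x" "x \<le> 1" "x \<notin> J"
  shows "\<beta> * x \<notin> \<int>"
proof
  assume "\<beta> * x \<in> \<int>"
  then have "frac (\<beta> * x) = 0" by (simp add: frac_eq_0_iff)
  then show False using J_frac[of x] assms in_J_01 by metis
qed

lemma sigma_map_upper:
  assumes "0 \<le> x" "x < 1"
  shows "sigma_map (upper x) = upper (frac (\<beta> * x))"
proof (cases "x \<in> J")
  case True
  then show ?thesis
    using assms by (cases "x = 0") (auto simp: sigma_map_def upper_def in_X left_map_def)
next
  case False
  then have "upper x = (x, False)" "upper (frac (\<beta> * x)) = (frac (\<beta> * x), False)"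
    using assms J_frac[of x] by (auto simp: upper_def)
  then show ?thesis using assms False not_in_J_not_Ints[of x]
    by (simp add: sigma_map_lower in_X left_map_eq_frac)
qed

lemma sigma_map_in_X: "p \<in> XS \<Longrightarrow> sigma_map p \<in> XS"
  by (cases p) (auto simp: sigma_map_def in_X upper_in_X T_unit frac_unit less_imp_le)

lemma fst_sigma_map:
  assumes "(y, c) \<in> XS" "0 < frac (\<beta> * y)"
  shows "fst (sigma_map (y, c)) = frac (\<beta> * y)"
proof -
  have "\<beta> * y \<notin> \<int>" using assms(2) frac_eq_0_iff[of "\<beta> * y"] by auto
  then show ?thesis using assms by (auto simp: sigma_map_def left_map_eq_frac)
qed

text \<open>On either side of a point the map is affine with slope \<beta> until its branch ends.
  The radii \<open>min d (T x) / \<beta>\<close> on the left and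
  \<open>min d (1 - frac (\<beta> * x)) / \<beta>\<close> on the right keep the argument on the
  branch and the image within \<open>d\<close>.\<close>

lemma continuous_sigma_map: "continuous_map XT XT sigma_map"
  unfolding continuous_map_def topspace_XT
proof (intro conjI allI impI)
  fix U assume "openin XT U"
  then have U: "two_sided U" by (simp add: openin_iff_two_sided)
  let ?V = "{p \<in> XS. sigma_map p \<in> U}"
  have "two_sided ?V" unfolding two_sided_def
  proof (intro conjI allI impI)
    fix x assume x: "(x, False) \<in> ?V"
    show "left_nbhd ?V x"
    proof (cases "x = 0")
      case True
      then show ?thesis unfolding left_nbhd_def by (intro exI[of _ 1]) (auto simp: in_X)
    next
      case False
      have "(T x, False) \<in> U" using x sigma_map_lower[of x] by auto
      then have "left_nbhd U (T x)" using U by (simp add: two_sided_def)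
      then obtain d where d: "d > 0" "\<And>y b. T x - d < y \<Longrightarrow> y < T x \<Longrightarrow> (y, b) \<in> XS \<Longrightarrow> (y, b) \<in> U"
        unfolding left_nbhd_def by blast
      have T0: "0 < T x" using left_map_bounds[OF False] by simp
      show ?thesis unfolding left_nbhd_def
      proof (intro exI[of _ "min d (T x) / \<beta>"] conjI allI impI)
        show "0 < min d (T x) / \<beta>" using d T0 by simp
        fix y b assume y: "x - min d (T x) / \<beta> < y" "y < x" "(y, b) \<in> XS"
        then have "x - y < min d (T x) / \<beta>" by linarith
        then have "\<beta> * (x - y) < min d (T x)"
          by (simp only: pos_less_divide_eq beta_pos mult.commute)
        then have by': "\<beta> * (x - y) < d" "\<beta> * (x - y) < T x" by linarith+
        then have fr: "frac (\<beta> * y) = T x - \<beta> * (x - y)"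
          using y False by (intro frac_eq_left_map) auto
        have "0 < frac (\<beta> * y)" using by' by (simp add: fr)
        then have "fst (sigma_map (y, b)) = T x - \<beta> * (x - y)" using fst_sigma_map[OF y(3)] fr by metis
        moreover have "0 < \<beta> * (x - y)" using y by simp
        ultimately have "T x - d < fst (sigma_map (y, b))" "fst (sigma_map (y, b)) < T x" using by' by linarith+
        then show "(y, b) \<in> ?V"
          using d(2)[of "fst (sigma_map (y, b))" "snd (sigma_map (y, b))"] sigma_map_in_X[OF y(3)] y(3)
          unfolding prod.collapse by simp
      qed
    qed
  next
    fix x assume x: "upper x \<in> ?V"
    show "right_nbhd ?V x"
    proof (cases "x = 1")
      case True
      then show ?thesis unfolding right_nbhd_def by (intro exI[of _ 1]) (auto simp: in_X)
    next
      case False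
      let ?z = "frac (\<beta> * x)"
      have "0 \<le> x" "x < 1" using x False by (auto simp: upper_in_X)
      then have "upper ?z \<in> U" using x by (simp add: sigma_map_upper)
      then have "right_nbhd U ?z" using U by (simp add: two_sided_def)
      then obtain d where d: "d > 0" "\<And>y b. ?z < y \<Longrightarrow> y < ?z + d \<Longrightarrow> (y, b) \<in> XS \<Longrightarrow> (y, b) \<in> U"
        unfolding right_nbhd_def by blast
      have z1: "?z < 1" by (rule frac_lt_1)
      show ?thesis unfolding right_nbhd_def
      proof (intro exI[of _ "min d (1 - ?z) / \<beta>"] conjI allI impI)
        show "0 < min d (1 - ?z) / \<beta>" using d z1 by simp
        fix y b assume y: "x < y" "y < x + min d (1 - ?z) / \<beta>" "(y, b) \<in> XS"
        then have "y - x < min d (1 - ?z) / \<beta>" by linarith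
        then have "\<beta> * (y - x) < min d (1 - ?z)"
          by (simp only: pos_less_divide_eq beta_pos mult.commute)
        then have by': "\<beta> * (y - x) < d" "\<beta> * (y - x) < 1 - ?z" by linarith+
        have pos: "0 < \<beta> * (y - x)" using y by simp
        have "\<lfloor>\<beta> * y\<rfloor> = \<lfloor>\<beta> * x\<rfloor>"
          using by'(2) pos of_int_floor_le[of "\<beta> * x"] unfolding frac_def right_diff_distrib
          by (intro floor_unique) linarith+
        then have fr: "frac (\<beta> * y) = ?z + \<beta> * (y - x)"
          by (simp add: frac_def algebra_simps)
        have "0 < frac (\<beta> * y)" using pos frac_ge_0[of "\<beta> * x"] unfolding fr by linarith
        then have "fst (sigma_map (y, b)) = ?z + \<beta> * (y - x)" using fst_sigma_map[OF y(3)] fr by metis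
        then have "?z < fst (sigma_map (y, b))" "fst (sigma_map (y, b)) < ?z + d" using by' pos by linarith+
        then show "(y, b) \<in> ?V"
          using d(2)[of "fst (sigma_map (y, b))" "snd (sigma_map (y, b))"] sigma_map_in_X[OF y(3)] y(3)
          unfolding prod.collapse by simp
      qed
    qed
  qed auto
  then show "openin XT ?V" by (simp add: openin_iff_two_sided)
qed (use sigma_map_in_X in auto)

text \<open>Only the first coordinate is prescribed, and only over \<open>I0\<close>; but \<tau>
  maps \<open>I0\<close> outside \<open>J\<close>, so the image is an undoubled point and its flag
  is forced. Two continuous maps into a Hausdorff space that agree on a dense set coincide.\<close>

lemma assoc_map_eq: "assoc_map \<tau> ps = sigma_map"
  unfolding assoc_map_def
proof (rule the_equality)
  have 1: "sigma_map p = (\<tau> (fst p), False)" if p: "p \<in> XS" "fst p \<in> I0 \<tau> ps" for p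
  proof -
    obtain x where "p = (x, False)" "0 \<le> x" "x \<le> 1" "x \<notin> J" using p
      by (cases p) (auto simp: in_X I0_def)
    then show ?thesis using p not_in_J_not_Ints[of x]
      by (simp add: sigma_map_lower left_map_eq_frac beta_map_eq)
  qed
  then show *: "sigma_map \<in> extensional XS \<and> continuous_map XT XT sigma_map \<and>
      (\<forall>p\<in>XS. fst p \<in> I0 \<tau> ps \<longrightarrow> fst (sigma_map p) = \<tau> (fst p))"
    using continuous_sigma_map by (auto simp: sigma_map_def)
  fix \<sigma> assume s: "\<sigma> \<in> extensional XS \<and> continuous_map XT XT \<sigma> \<and>
      (\<forall>p\<in>XS. fst p \<in> I0 \<tau> ps \<longrightarrow> fst (\<sigma> p) = \<tau> (fst p))"
  have 2: "\<sigma> p = sigma_map p" if p: "p \<in> {p \<in> XS. fst p \<in> I0 \<tau> ps}" for p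
  proof -
    have "\<tau> (fst p) \<notin> J" using p J_frac[of "fst p"] by (auto simp: I0_def beta_map_eq)
    moreover have "\<sigma> p \<in> XS" using s p by (auto simp: continuous_map_def)
    ultimately have "snd (\<sigma> p) = False" using s p by (cases "\<sigma> p") (auto simp: in_X)
    then show ?thesis using 1 s p by (simp add: prod_eq_iff)
  qed
  have "\<sigma> p = sigma_map p" if "p \<in> XS" for p
    using forall_in_closure_of_eq[of p XT "{p \<in> XS. fst p \<in> I0 \<tau> ps}" XT \<sigma> sigma_map]
      that s continuous_sigma_map Hausdorff_XT 2 by (simp add: closure_I0)
  then show "\<sigma> = sigma_map" using s * by (intro extensionalityI[of _ XS]) auto
qed

lemma CXZ_iff:
  "f \<in> CXZ \<tau> ps \<longleftrightarrow> f \<in> extensional XS \<and>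
    (\<forall>x\<in>{0..1}. left_nbhd {p \<in> XS. f p = f (x, False)} x \<and> right_nbhd {p \<in> XS. f p = f (upper x)} x)"
proof
  assume f: "f \<in> CXZ \<tau> ps"
  then have "\<forall>V. openin XT {p \<in> XS. f p \<in> V}"
    by (simp add: CXZ_def continuous_map_def)
  then have "openin XT {p \<in> XS. f p \<in> {v}}" for v by blast
  then have "two_sided {p \<in> XS. f p \<in> {v}}" for v by (simp add: openin_iff_two_sided)
  then have *: "two_sided {p \<in> XS. f p = v}" for v by simp
  show "f \<in> extensional XS \<and> (\<forall>x\<in>{0..1}. left_nbhd {p \<in> XS. f p = f (x, False)} x \<and> right_nbhd {p \<in> XS. f p = f (upper x)} x)"
    using f *[unfolded two_sided_def] by (auto simp: CXZ_def in_X upper_in_X)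
next
  assume f: "f \<in> extensional XS \<and>
    (\<forall>x\<in>{0..1}. left_nbhd {p \<in> XS. f p = f (x, False)} x \<and> right_nbhd {p \<in> XS. f p = f (upper x)} x)"
  have "two_sided {p \<in> XS. f p \<in> U}" for U
    unfolding two_sided_def
  proof (intro conjI allI impI)
    fix x assume x: "(x, False) \<in> {p \<in> XS. f p \<in> U}"
    then have "left_nbhd {p \<in> XS. f p = f (x, False)} x" using f by (auto simp: in_X)
    then show "left_nbhd {p \<in> XS. f p \<in> U} x" by (rule left_nbhd_mono) (use x in auto)
  next
    fix x assume x: "upper x \<in> {p \<in> XS. f p \<in> U}"
    then have "right_nbhd {p \<in> XS. f p = f (upper x)} x" using f by (auto simp: upper_in_X)
    then show "right_nbhd {p \<in> XS. f p \<in> U} x" by (rule right_nbhd_mono) (use x in auto)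
  qed auto
  then show "f \<in> CXZ \<tau> ps" using f
    by (simp add: CXZ_def continuous_map_def openin_iff_two_sided)
qed

section \<open>Integer-valued continuous functions and the transfer operator\<close>

abbreviation "CX \<equiv> CXZ \<tau> ps"
abbreviation "L \<equiv> transfer_op \<tau> ps"

definition below :: "real \<Rightarrow> split_point \<Rightarrow> bool" where
  "below c p \<longleftrightarrow> fst p < c \<or> fst p = c \<and> \<not> snd p"

definition ind :: "real \<Rightarrow> split_point \<Rightarrow> int" where
  "ind c = (\<lambda>p\<in>XS. if below c p then 1 else 0)"

lemma ind_apply: "p \<in> XS \<Longrightarrow> ind c p = (if below c p then 1 else 0)"
  by (simp add: ind_def)

lemma CX_extensional: "f \<in> CX \<Longrightarrow> f \<in> extensional XS"
  by (simp add: CXZ_def)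

lemma CX_left: "f \<in> CX \<Longrightarrow> x \<in> {0..1} \<Longrightarrow> left_nbhd {p \<in> XS. f p = f (x, False)} x"
  and CX_right: "f \<in> CX \<Longrightarrow> x \<in> {0..1} \<Longrightarrow> right_nbhd {p \<in> XS. f p = f (upper x)} x"
  by (auto simp: CXZ_iff)

lemma CX_const: "(\<lambda>x\<in>XS. k) \<in> CX"
  unfolding CXZ_iff left_nbhd_def right_nbhd_def
  by (auto simp: in_X upper_in_X intro!: exI[of _ 1])

lemma CX_add:
  assumes "f \<in> CX" "g \<in> CX"
  shows "(\<lambda>x\<in>XS. f x + g x) \<in> CX"
  unfolding CXZ_iff
proof (intro conjI ballI)
  fix x :: real assume x: "x \<in> {0..1}"
  show "left_nbhd {p \<in> XS. (\<lambda>x\<in>XS. f x + g x) p = (\<lambda>x\<in>XS. f x + g x) (x, False)} x"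
    by (rule left_nbhd_mono[OF left_nbhd_Int[OF CX_left[OF assms(1) x] CX_left[OF assms(2) x]]])
      (use x in \<open>auto simp: in_X\<close>)
  show "right_nbhd {p \<in> XS. (\<lambda>x\<in>XS. f x + g x) p = (\<lambda>x\<in>XS. f x + g x) (upper x)} x"
    by (rule right_nbhd_mono[OF right_nbhd_Int[OF CX_right[OF assms(1) x] CX_right[OF assms(2) x]]])
      (use x in \<open>auto simp: upper_in_X\<close>)
qed simp

lemma CX_scale:
  assumes "f \<in> CX"
  shows "(\<lambda>x\<in>XS. k * f x) \<in> CX"
  unfolding CXZ_iff
proof (intro conjI ballI)
  fix x :: real assume x: "x \<in> {0..1}"
  show "left_nbhd {p \<in> XS. (\<lambda>x\<in>XS. k * f x) p = (\<lambda>x\<in>XS. k * f x) (x, False)} x"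
    by (rule left_nbhd_mono[OF CX_left[OF assms(1) x]]) (use x in \<open>auto simp: in_X\<close>)
  show "right_nbhd {p \<in> XS. (\<lambda>x\<in>XS. k * f x) p = (\<lambda>x\<in>XS. k * f x) (upper x)} x"
    by (rule right_nbhd_mono[OF CX_right[OF assms(1) x]]) (use x in \<open>auto simp: upper_in_X\<close>)
qed simp

lemma CX_sum:
  assumes "\<And>i. i \<in> A \<Longrightarrow> F i \<in> CX"
  shows "(\<lambda>x\<in>XS. \<Sum>i\<in>A. F i x) \<in> CX"
  using assms
proof (induction A rule: infinite_finite_induct)
  case (insert a A)
  then have "(\<lambda>x\<in>XS. F a x + (\<lambda>x\<in>XS. \<Sum>i\<in>A. F i x) x) \<in> CX" by (intro CX_add) auto
  also have "(\<lambda>x\<in>XS. F a x + (\<lambda>x\<in>XS. \<Sum>i\<in>A. F i x) x) = (\<lambda>x\<in>XS. \<Sum>i\<in>insert a A. F i x)"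
    using insert by (auto simp: fun_eq_iff restrict_def)
  finally show ?case .
qed (use CX_const[of 0] in \<open>simp_all\<close>)

text \<open>The initial segment ending at the left copy of \<open>c\<close> is clopen because
  \<open>c\<close> is doubled, or, for c = 1, because it is all of X.\<close>

lemma CX_ind:
  assumes "c \<in> J" "0 < c"
  shows "ind c \<in> CX"
  unfolding CXZ_iff
proof (intro conjI ballI)
  have c1: "c \<le> 1" using assms J_subset by auto
  fix x :: real assume x: "x \<in> {0..1}"
  show "left_nbhd {p \<in> XS. ind c p = ind c (x, False)} x"
    unfolding left_nbhd_def using x
    by (intro exI[of _ "if x \<le> c then 1 else x - c"])
      (auto simp: ind_def below_def in_X split: if_splits)
  show "right_nbhd {p \<in> XS. ind c p = ind c (upper x)} x"
    unfolding right_nbhd_def using x assms c1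
    by (intro exI[of _ "if c \<le> x then 1 else c - x"])
      (auto simp: ind_def below_def in_X upper_def split: if_splits)
qed (simp add: ind_def)

lemma ind_1: "ind 1 = (\<lambda>x\<in>XS. 1)"
  by (rule ext) (auto simp: ind_def below_def in_X)

section \<open>Jumps, and indicators of initial segments as a spanning family\<close>

definition jump :: "(split_point \<Rightarrow> int) \<Rightarrow> real \<Rightarrow> int" where
  "jump f c = f (c, False) - f (upper c)"

lemma jump_ind:
  assumes "c \<in> J - {0, 1}" "0 \<le> x" "x \<le> 1"
  shows "jump (ind c) x = (if x = c then 1 else 0)"
  using assms by (auto simp: jump_def ind_def below_def upper_def in_X)

lemma jump_nonzero: "jump f c \<noteq> 0 \<Longrightarrow> c \<in> J - {0, 1}"
  by (auto simp: jump_def upper_def split: if_splits)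

lemma jump_eq_0_near:
  assumes "f \<in> CX" "x \<in> {0..1}"
  shows "eventually (\<lambda>y. y \<in> {0..1} \<longrightarrow> jump f y = 0) (at x)"
proof -
  obtain d where d: "d > 0" "\<And>y b. x - d < y \<Longrightarrow> y < x \<Longrightarrow> (y, b) \<in> XS \<Longrightarrow> f (y, b) = f (x, False)"
    using CX_left[OF assms] unfolding left_nbhd_def by blast
  obtain e where e: "e > 0" "\<And>y b. x < y \<Longrightarrow> y < x + e \<Longrightarrow> (y, b) \<in> XS \<Longrightarrow> f (y, b) = f (upper x)"
    using CX_right[OF assms] unfolding right_nbhd_def by blast
  have "jump f y = 0" if y: "y \<noteq> x" "dist y x < min d e" "y \<in> {0..1}" for y
  proof -
    have "(y, False) \<in> XS" "upper y \<in> XS" using y by (auto simp: in_X upper_in_X)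
    then show ?thesis using y d(2)[of y] e(2)[of y] 
      by (cases "y < x") (auto simp: jump_def upper_def dist_real_def)
  qed
  then show ?thesis unfolding eventually_at
    using d e by (intro exI[of _ "min d e"]) auto
qed

text \<open>By Bolzano-Weierstrass infinitely many jumps would accumulate at some point of [0,1],
  contradicting \<open>jump_eq_0_near\<close> there.\<close>

lemma finite_jumps:
  assumes "f \<in> CX"
  shows "finite {c \<in> {0..1}. jump f c \<noteq> 0}"
proof (rule ccontr)
  let ?D = "{c \<in> {0..1}. jump f c \<noteq> 0}"
  assume "infinite ?D"
  moreover have "compact {0..1::real}" by simp
  ultimately obtain x where x: "x \<in> {0..1}" "x islimpt ?D"
    unfolding compact_eq_Bolzano_Weierstrass by (metis (no_types, lifting) mem_Collect_eq subsetI)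
  have "frequently (\<lambda>y. y \<in> ?D) (at x)" using x(2) by (simp add: islimpt_conv_frequently_at)
  then have "frequently (\<lambda>y. y \<in> ?D \<and> (y \<in> {0..1} \<longrightarrow> jump f y = 0)) (at x)"
    by (rule frequently_eventually_frequently[OF _ jump_eq_0_near[OF assms x(1)]])
  then show False by (auto dest: frequently_ex)
qed

lemma CX_no_jumps:
  assumes "f \<in> CX" "\<And>c. c \<in> {0..1} \<Longrightarrow> jump f c = 0" "p \<in> XS"
  shows "f p = f (1, False)"
proof -
  obtain x b where p: "p = (x, b)" by (cases p)
  have x: "x \<in> {0..1}" using assms p by (auto simp: in_X)
  have "f (x, False) = f (1, False)"
  proof (rule connected_local_const[where A = "{0..1::real}" and f = "\<lambda>x. f (x, False)"])
    show "\<forall>a\<in>{0..1}. eventually (\<lambda>b. f (a, False) = f (b, False)) (at a within {0..1})"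
    proof
      fix a :: real assume a: "a \<in> {0..1}"
      obtain d where d: "d > 0" "\<And>y b. a - d < y \<Longrightarrow> y < a \<Longrightarrow> (y, b) \<in> XS \<Longrightarrow> f (y, b) = f (a, False)"
        using CX_left[OF assms(1) a] unfolding left_nbhd_def by blast
      obtain e where e: "e > 0" "\<And>y b. a < y \<Longrightarrow> y < a + e \<Longrightarrow> (y, b) \<in> XS \<Longrightarrow> f (y, b) = f (upper a)"
        using CX_right[OF assms(1) a] unfolding right_nbhd_def by blast
      have "f (upper a) = f (a, False)" using assms(2)[OF a] by (simp add: jump_def)
      then have "f (a, False) = f (y, False)" if "y \<in> {0..1}" "y \<noteq> a" "dist y a < min d e" for y
        using that d(2)[of y False] e(2)[of y False]
        by (cases "y < a") (auto simp: in_X dist_real_def)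
      then show "eventually (\<lambda>b. f (a, False) = f (b, False)) (at a within {0..1})"
        unfolding eventually_at using d e by (intro exI[of _ "min d e"]) auto
    qed
  qed (use x in auto)
  moreover have "f p = f (x, False)"
  proof (cases b)
    case True
    then have "p = upper x" using assms p upper_eqI by auto
    then show ?thesis using assms(2)[OF x] by (simp add: jump_def)
  qed (use p in simp)
  ultimately show ?thesis by simp
qed

text \<open>Subtracting the jumps, which cannot accumulate, leaves a function that is locally constant on
  the connected set \<open>[0,1]\<close>.\<close>

lemma CX_decompose:
  assumes "f \<in> CX"
  obtains D k where "finite D" "D \<subseteq> J - {0}" "f = (\<lambda>x\<in>XS. \<Sum>c\<in>D. k c * ind c x)"
proof -
  let ?D = "{c \<in> {0..1}. jump f c \<noteq> 0}"
  have DJ: "?D \<subseteq> J - {0, 1}" using jump_nonzero by auto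
  define s where "s = (\<lambda>x\<in>XS. \<Sum>c\<in>?D. (\<lambda>x\<in>XS. jump f c * ind c x) x)"
  have s: "s \<in> CX" unfolding s_def
    by (intro CX_sum CX_scale CX_ind) (use DJ in \<open>auto simp: less_eq_real_def\<close>)
  define g where "g = (\<lambda>x\<in>XS. f x + (\<lambda>x\<in>XS. - 1 * s x) x)"
  have g: "g \<in> CX" unfolding g_def by (intro CX_add CX_scale assms s)
  have sx: "s x = (\<Sum>c\<in>?D. jump f c * ind c x)" if "x \<in> XS" for x
    using that by (simp add: s_def)
  have "jump g y = 0" if y: "y \<in> {0..1}" for y
  proof -
    have in_XS: "(y, False) \<in> XS" "upper y \<in> XS" using y by (auto simp: in_X upper_in_X)
    then have "jump g y = jump f y - (\<Sum>c\<in>?D. jump f c * jump (ind c) y)"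
      by (simp add: jump_def g_def sx sum_subtractf right_diff_distrib)
    also have "(\<Sum>c\<in>?D. jump f c * jump (ind c) y) = (\<Sum>c\<in>?D. if c = y then jump f c else 0)"
    proof (rule sum.cong)
      fix c assume "c \<in> ?D"
      then have "jump (ind c) y = (if y = c then 1 else 0)" using DJ y by (intro jump_ind) auto
      then show "jump f c * jump (ind c) y = (if c = y then jump f c else 0)" by simp
    qed simp
    also have "\<dots> = jump f y" using finite_jumps[OF assms] y by (simp add: sum.delta)
    finally show ?thesis by simp
  qed
  then have const: "g p = g (1, False)" if "p \<in> XS" for p using CX_no_jumps g that by blast
  have n1: "1 \<notin> ?D" using DJ by blast
  show ?thesis
  proof (rule that)
    show "finite (insert 1 ?D)" using finite_jumps[OF assms] by simp
    show "insert 1 ?D \<subseteq> J - {0}" using DJ by auto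
    \<comment> \<open>The remaining constant \<open>g (1, False)\<close> becomes the coefficient of
      \<open>ind 1\<close>, which is the function 1. As 1 carries no jump, the case distinction in
      the coefficient causes no clash.\<close>
    show "f = (\<lambda>x\<in>XS. \<Sum>c\<in>insert 1 ?D. (if c = 1 then g (1, False) else jump f c) * ind c x)"
    proof (rule extensionalityI[of _ XS])
      fix x assume x: "x \<in> XS"
      have "(\<Sum>c\<in>insert 1 ?D. (if c = 1 then g (1, False) else jump f c) * ind c x)
        = g (1, False) + (\<Sum>c\<in>?D. (if c = 1 then g (1, False) else jump f c) * ind c x)"
        using finite_jumps[OF assms] n1 x by (subst sum.insert) (auto simp: ind_1)
      also have "(\<Sum>c\<in>?D. (if c = 1 then g (1, False) else jump f c) * ind c x) = s x"
        unfolding sx[OF x] by (rule sum.cong) (use n1 in auto)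
      also have "g (1, False) + s x = f x" using const[OF x] x by (simp add: g_def)
      finally show "f x = (\<lambda>x\<in>XS. \<Sum>c\<in>insert 1 ?D. (if c = 1 then g (1, False) else jump f c) * ind c x) x"
        using x by simp
    qed (use assms CX_extensional in auto)
  qed
qed

lemma CX_induct [consumes 1, case_names zero step]:
  assumes "f \<in> CX" "P (\<lambda>x\<in>XS. 0)"
    and "\<And>f k c. f \<in> CX \<Longrightarrow> P f \<Longrightarrow> c \<in> J \<Longrightarrow> 0 < c \<Longrightarrow> P (\<lambda>x\<in>XS. k * ind c x + f x)"
  shows "P f"
proof -
  obtain D k where D: "finite D" "D \<subseteq> J - {0}" "f = (\<lambda>x\<in>XS. \<Sum>c\<in>D. k c * ind c x)"
    using CX_decompose assms(1) .
  have *: "P (\<lambda>x\<in>XS. \<Sum>c\<in>D. k c * ind c x) \<and> (\<lambda>x\<in>XS. \<Sum>c\<in>D. k c * ind c x) \<in> CX"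
    using D(1,2)
  proof (induction D)
    case empty
    then show ?case unfolding sum.empty using assms(2) CX_const[of 0] by blast
  next
    case (insert c D)
    then have c: "c \<in> J" "0 < c" using J_subset by (auto simp: less_eq_real_def)
    have eq: "(\<lambda>x\<in>XS. \<Sum>c\<in>insert c D. k c * ind c x)
      = (\<lambda>x\<in>XS. k c * ind c x + (\<lambda>x\<in>XS. \<Sum>c\<in>D. k c * ind c x) x)"
      using insert(1,2) by (auto simp: fun_eq_iff restrict_def)
    have "(\<lambda>x\<in>XS. (\<lambda>x\<in>XS. k c * ind c x) x + (\<lambda>x\<in>XS. \<Sum>c\<in>D. k c * ind c x) x) \<in> CX"
      using insert c by (intro CX_add CX_scale CX_ind) auto
    also have "(\<lambda>x\<in>XS. (\<lambda>x\<in>XS. k c * ind c x) x + (\<lambda>x\<in>XS. \<Sum>c\<in>D. k c * ind c x) x) =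
      (\<lambda>x\<in>XS. k c * ind c x + (\<lambda>x\<in>XS. \<Sum>c\<in>D. k c * ind c x) x)"
      by (auto simp: fun_eq_iff restrict_def)
    finally show ?case unfolding eq
      using insert c assms(3)[of "\<lambda>x\<in>XS. \<Sum>c\<in>D. k c * ind c x" c "k c"] by blast
  qed
  then show ?thesis by (simp add: D(3))
qed

text \<open>Over \<open>0\<close> the preimage on the \<open>j\<close>-th branch is the right copy of \<open>j / \<beta>\<close>, except for \<open>j = 0\<close>.\<close>

definition inv_branch :: "nat \<Rightarrow> split_point \<Rightarrow> split_point" where
  "inv_branch j p = ((fst p + real j) / \<beta>, snd p \<or> fst p = 0 \<and> 1 \<le> j)"

lemma inv_branch_inj: "inj (\<lambda>j. inv_branch j p)"
  by (rule injI) (auto simp: inv_branch_def)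

text \<open>Here \<open>k\<close> is the digit of \<open>c\<close>: the branches
  \<open>j < k\<close> lie wholly below \<open>c\<close>, and on branch \<open>k\<close>, where the
  map preserves the order, lying below \<open>c\<close> turns into lying below the image
  \<open>\<beta> * c - real k\<close>.\<close>

lemma sigma_map_preimages_subset:
  assumes c: "real k < \<beta> * c" "\<beta> * c \<le> real k + 1"
    and y: "y \<in> XS" "sigma_map y = p" "below c y"
  shows "\<exists>j. y = inv_branch j p \<and> (j < k \<or> j = k \<and> below (\<beta> * c - real k) p)"
proof -
  obtain x b where yx: "y = (x, b)" by (cases y)
  have x01: "0 \<le> x" "x \<le> 1" using y yx by (auto simp: in_X)
  show ?thesis
  proof (cases b)
    case True
    define j where "j = nat \<lfloor>\<beta> * x\<rfloor>"
    have x: "x \<in> J" "0 < x" "x < 1" "x < c" using y yx True by (auto simp: in_X below_def)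
    have j: "real j = of_int \<lfloor>\<beta> * x\<rfloor>" using x by (simp add: j_def)
    have fr: "frac (\<beta> * x) = \<beta> * x - real j" by (simp add: j frac_def)
    have p: "p = upper (frac (\<beta> * x))" using y yx True by (auto simp: sigma_map_def)
    have "frac (\<beta> * x) \<in> J" "frac (\<beta> * x) < 1" using J_frac[of x] x frac_lt_1 by auto
    then have p': "p = (frac (\<beta> * x), frac (\<beta> * x) \<noteq> 0)" by (auto simp: p upper_def)
    have lt: "\<beta> * x < \<beta> * c" using x by simp
    \<comment> \<open>A right copy may be sent to the undoubled point 0, losing its flag. Then
      \<open>j\<close> is at least 1 because \<open>x\<close> is positive, the case in which
      \<open>inv_branch\<close> restores the flag.\<close>
    have "0 < \<beta> * x" using x by simp
    then have "\<not> (frac (\<beta> * x) = 0 \<and> j = 0)" using fr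
      by (metis diff_zero of_nat_0 less_irrefl)
    then have "y = inv_branch j p" using True by (auto simp: yx p' inv_branch_def fr)
    moreover have "real j < real k + 1" using lt c j of_int_floor_le[of "\<beta> * x"] by linarith
    then have "j \<le> k" by linarith
    moreover have "below (\<beta> * c - real j) p" using lt by (simp add: p' below_def fr)
    ultimately show ?thesis by (intro exI[of _ j]) (auto simp: le_less)
  next
    case False
    then have x: "x \<le> c" using y yx by (auto simp: below_def)
    have p: "p = (T x, False)" using y yx False sigma_map_lower by auto
    have le: "\<beta> * x \<le> \<beta> * c" using x by simp
    show ?thesis
    proof (cases "x = 0")
      case True
      then have "y = inv_branch 0 p" using False yx by (simp add: p inv_branch_def left_map_def)
      moreover have "below (\<beta> * c - real k) p" using c True by (simp add: p below_def left_map_def)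
      ultimately show ?thesis by (cases "k = 0") auto
    next
      case False
      define j where "j = nat (\<lceil>\<beta> * x\<rceil> - 1)"
      have "0 < \<lceil>\<beta> * x\<rceil>" using x01 False by simp
      then have j: "real j = of_int (\<lceil>\<beta> * x\<rceil> - 1)" by (simp add: j_def)
      then have Tx: "T x = \<beta> * x - real j" using False by (simp add: left_map_def)
      have "T x \<noteq> 0" using left_map_bounds[OF False, of \<beta>] by simp
      then have "y = inv_branch j p" using \<open>\<not> b\<close> by (simp add: yx p inv_branch_def Tx)
      moreover have "real j < real k + 1" using le c j ceiling_correct[of "\<beta> * x"] by linarith
      then have "j \<le> k" by linarith
      moreover have "below (\<beta> * c - real j) p" using le by (simp add: p below_def Tx) linarith
      ultimately show ?thesis by (intro exI[of _ j]) (auto simp: le_less)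
    qed
  qed
qed

lemma inv_branch_preimage:
  assumes c: "real k < \<beta> * c" "\<beta> * c \<le> real k + 1" "c \<le> 1"
    and p: "p \<in> XS" and j: "j < k \<or> j = k \<and> below (\<beta> * c - real k) p"
  shows "inv_branch j p \<in> XS \<and> sigma_map (inv_branch j p) = p \<and> below c (inv_branch j p)"
proof -
  obtain z b where pz: "p = (z, b)" by (cases p)
  have z: "0 \<le> z" "z \<le> 1" "b \<Longrightarrow> z \<in> J" "b \<Longrightarrow> 0 < z" "b \<Longrightarrow> z < 1"
    using p by (auto simp: pz in_X)
  define x where "x = (z + real j) / \<beta>"
  have bx: "\<beta> * x = z + real j" by (simp add: x_def)
  have x0: "0 \<le> x" using z by (simp add: x_def)
  have jk: "j < k \<Longrightarrow> real j + 1 \<le> real k" by simp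
  define b' where "b' \<longleftrightarrow> b \<or> z = 0 \<and> 1 \<le> j"
  have y: "inv_branch j p = (x, b')" by (simp add: inv_branch_def pz x_def b'_def)
  show ?thesis
  proof (cases b')
    case False
    then have b: "\<not> b" "z = 0 \<Longrightarrow> j = 0" by (auto simp: b'_def)
    have "\<beta> * x \<le> \<beta> * c" using j jk c z unfolding bx by (auto simp: below_def pz)
    then have xc: "x \<le> c" by simp
    then have xX: "(x, False) \<in> XS" using x0 c by (simp add: in_X)
    have "T x = z"
    proof (cases "z = 0")
      case True
      then show ?thesis using b by (simp add: x_def left_map_def)
    next
      case False
      then have "x \<noteq> 0" using z by (simp add: x_def)
      then show ?thesis using False z left_map_eqI[of x j \<beta>] by (simp add: bx)
    qed
    then show ?thesis using False xX xc b unfolding y by (auto simp: sigma_map_lower below_def pz)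
  next
    case True
    then have z1: "z < 1" "z \<in> J" using z by (auto simp: b'_def)
    \<comment> \<open>Strictness matters: the preimage is a right copy, and the right copy of
      \<open>c\<close> itself is not below \<open>c\<close>.\<close>
    have "\<beta> * x < \<beta> * c"
    proof (cases "j < k")
      case True
      then show ?thesis using jk z1 c unfolding bx by linarith
    next
      case False
      then have "j = k" "below (\<beta> * c - real k) p" using j by auto
      then have "z < \<beta> * c - real k" using \<open>b'\<close> c z by (auto simp: below_def pz b'_def)
      then show ?thesis unfolding bx using \<open>j = k\<close> by linarith
    qed
    then have xc: "x < c" by simp
    have "0 < z + real j" using True z by (auto simp: b'_def)
    then have xpos: "0 < x" by (simp add: x_def)
    have fr: "frac (\<beta> * x) = z"
    proof -
      have "\<lfloor>\<beta> * x\<rfloor> = int j" by (rule floor_unique) (use z z1 in \<open>auto simp: bx\<close>)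
      then show ?thesis by (simp add: frac_def bx)
    qed
    have "x \<in> J" using J_frac[of x] fr z1 x0 xc c by simp
    then have xX: "(x, True) \<in> XS" using xpos xc c by (simp add: in_X)
    then have "sigma_map (x, True) = upper z" by (simp add: sigma_map_def fr)
    also have "\<dots> = p" using z z1 True by (auto simp: pz upper_def b'_def)
    finally show ?thesis using True xX xc unfolding y by (auto simp: below_def)
  qed
qed

lemma sigma_map_preimages:
  assumes c: "real k < \<beta> * c" "\<beta> * c \<le> real k + 1" "c \<le> 1" and p: "p \<in> XS"
  shows "{y \<in> XS. sigma_map y = p \<and> below c y} =
    (\<lambda>j. inv_branch j p) ` (if below (\<beta> * c - real k) p then {..k} else {..<k})"
  (is "?L = ?R")
proof
  show "?L \<subseteq> ?R"
  proof
    fix y assume "y \<in> ?L"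
    then obtain j where "y = inv_branch j p" "j < k \<or> j = k \<and> below (\<beta> * c - real k) p"
      using sigma_map_preimages_subset[OF c(1,2)] by blast
    then show "y \<in> ?R" by (intro image_eqI[of _ _ j]) auto
  qed
  show "?R \<subseteq> ?L"
  proof
    fix y assume "y \<in> ?R"
    then obtain j where "y = inv_branch j p" "j < k \<or> j = k \<and> below (\<beta> * c - real k) p"
      by (auto split: if_splits simp: le_less)
    then show "y \<in> ?L" using inv_branch_preimage[OF c p] by blast
  qed
qed

lemma finite_sigma_map_fibre: "p \<in> XS \<Longrightarrow> finite {y \<in> XS. sigma_map y = p}"
proof -
  assume p: "p \<in> XS"
  \<comment> \<open>Every point of X is below 1, so the case c = 1 with k =
    \<open>full_branches\<close> describes whole fibres.\<close>
  have "{y \<in> XS. sigma_map y = p} = {y \<in> XS. sigma_map y = p \<and> below 1 y}"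
    by (auto simp: below_def in_X)
  also have "finite \<dots>" using sigma_map_preimages[of full_branches 1 p] full_branches p by simp
  finally show ?thesis .
qed

section \<open>The transfer operator on indicators\<close>

lemma L_apply: "p \<in> XS \<Longrightarrow> L f p = (\<Sum>y\<in>{y \<in> XS. sigma_map y = p}. f y)"
  by (simp add: transfer_op_def assoc_map_eq)

lemma L_extensional: "L f \<in> extensional XS"
  by (simp add: transfer_op_def)

lemma L_cong: "(\<And>x. x \<in> XS \<Longrightarrow> f x = g x) \<Longrightarrow> L f = L g"
  by (rule extensionalityI[OF L_extensional L_extensional]) (simp add: L_apply)

lemma L_restrict: "L (restrict f XS) = L f"
  by (rule L_cong) simp

lemma L_add: "L (\<lambda>x\<in>XS. f x + g x) = (\<lambda>x\<in>XS. L f x + L g x)"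
  unfolding L_restrict
  by (rule extensionalityI[OF L_extensional]) (auto simp: L_apply sum.distrib)

lemma L_scale: "L (\<lambda>x\<in>XS. k * f x) = (\<lambda>x\<in>XS. k * L f x)"
  unfolding L_restrict
  by (rule extensionalityI[OF L_extensional]) (auto simp: L_apply sum_distrib_left)

lemma L_sum: "L (\<lambda>x\<in>XS. \<Sum>i\<in>A. F i x) = (\<lambda>x\<in>XS. \<Sum>i\<in>A. L (F i) x)"
  unfolding L_restrict
proof (rule extensionalityI[OF L_extensional])
  fix x assume "x \<in> XS"
  then show "L (\<lambda>x. \<Sum>i\<in>A. F i x) x = (\<lambda>x\<in>XS. \<Sum>i\<in>A. L (F i) x) x"
    by (simp add: L_apply) (rule sum.swap)
qed simp

text \<open>The value at \<open>p\<close> counts the preimages of \<open>p\<close> below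
  \<open>c\<close>: one on each of the \<open>k\<close> branches wholly below \<open>c\<close>, and
  one more on branch \<open>k\<close> exactly when \<open>p\<close> is below the image of
  \<open>c\<close>.\<close>

lemma L_ind_nat:
  assumes c: "real k < \<beta> * c" "\<beta> * c \<le> real k + 1" "c \<le> 1"
  shows "L (ind c) = (\<lambda>x\<in>XS. int k + ind (\<beta> * c - real k) x)"
proof (rule extensionalityI[OF L_extensional])
  fix p assume p: "p \<in> XS"
  have "L (ind c) p = (\<Sum>y\<in>{y \<in> XS. sigma_map y = p}. if below c y then 1 else 0)"
    unfolding L_apply[OF p] by (rule sum.cong) (auto simp: ind_def)
  also have "\<dots> = (\<Sum>y\<in>{y \<in> {y \<in> XS. sigma_map y = p}. below c y}. 1)"
    by (rule sum.inter_filter[symmetric]) (rule finite_sigma_map_fibre[OF p])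
  also have "{y \<in> {y \<in> XS. sigma_map y = p}. below c y} = {y \<in> XS. sigma_map y = p \<and> below c y}" by auto
  also have "(\<Sum>y\<in>{y \<in> XS. sigma_map y = p \<and> below c y}. (1::int)) =
    int (card (if below (\<beta> * c - real k) p then {..k} else {..<k}))"
    unfolding sigma_map_preimages[OF c p]
    by (simp add: card_image inj_on_subset[OF inv_branch_inj])
  finally show "L (ind c) p = (\<lambda>x\<in>XS. int k + ind (\<beta> * c - real k) x) p"
    using p by (simp add: ind_apply)
qed simp

text \<open>The ceiling selects the branch to the left of \<open>c\<close>: when
  \<open>\<beta> * c\<close> is an integer the digit is one less, and \<open>T c\<close> is 1 and
  not 0.\<close>

definition digit :: "real \<Rightarrow> nat" where
  "digit c = nat (\<lceil>\<beta> * c\<rceil> - 1)"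

lemma digit:
  assumes "0 < c"
  shows "real (digit c) < \<beta> * c" "\<beta> * c \<le> real (digit c) + 1" "T c = \<beta> * c - real (digit c)"
proof -
  have "0 < \<lceil>\<beta> * c\<rceil>" using assms by simp
  then have "real (digit c) = of_int (\<lceil>\<beta> * c\<rceil> - 1)" by (simp add: digit_def)
  then show "real (digit c) < \<beta> * c" "\<beta> * c \<le> real (digit c) + 1" "T c = \<beta> * c - real (digit c)"
    using assms by (auto simp: left_map_def) linarith+
qed

lemma L_ind:
  assumes "0 < c" "c \<le> 1"
  shows "L (ind c) = (\<lambda>x\<in>XS. int (digit c) + ind (T c) x)"
  using L_ind_nat[OF digit(1,2)[OF assms(1)] assms(2)] digit(3)[OF assms(1)] by simp

text \<open>The point \<open>c / \<beta>\<close> has digit 0, so no constant is added. This supplies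
  explicit preimages under \<L>, hence the negative powers of \<L> applied to 1.\<close>

lemma L_ind_small:
  assumes "0 < c" "c \<le> 1"
  shows "L (ind (c / \<beta>)) = ind c"
proof -
  have "c / \<beta> \<le> 1" using assms beta_gt_1 by (simp add: field_simps)
  then have "L (ind (c / \<beta>)) = (\<lambda>x\<in>XS. int 0 + ind (\<beta> * (c / \<beta>) - real 0) x)"
    using assms by (intro L_ind_nat) auto
  also have "\<dots> = ind c" by (rule ext) (simp add: ind_def)
  finally show ?thesis .
qed

text \<open>It suffices to treat the spanning indicators, where \<L> is explicit; \<open>T c\<close>
  is again a positive point of \<open>J\<close>, so its indicator is continuous.\<close>

lemma CX_L: "f \<in> CX \<Longrightarrow> L f \<in> CX"
proof (induction rule: CX_induct)
  case zero
  have "L (\<lambda>x\<in>XS. 0) = (\<lambda>x\<in>XS. 0)"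
    by (rule extensionalityI[OF L_extensional]) (auto simp: L_apply)
  then show ?case using CX_const[of 0] by metis
next
  case (step f k c)
  have c1: "c \<le> 1" using step J_subset by auto
  have T: "T c \<in> J" "0 < T c" using step c1 left_map_bounds[of c \<beta>] J_left_map by auto
  have "L (\<lambda>x\<in>XS. k * ind c x + f x) = L (\<lambda>x\<in>XS. (\<lambda>x\<in>XS. k * ind c x) x + f x)"
    by (rule L_cong) simp
  also have "\<dots> = (\<lambda>x\<in>XS. (\<lambda>x\<in>XS. k * (\<lambda>x\<in>XS. (\<lambda>x\<in>XS. int (digit c)) x + ind (T c) x) x) x + L f x)"
    unfolding L_add L_scale L_ind[OF \<open>0 < c\<close> c1] by (auto simp: fun_eq_iff restrict_def)
  also have "\<dots> \<in> CX"
    using step T by (intro CX_add CX_scale CX_const CX_ind)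
  finally show ?case .
qed

section \<open>The shift-invariant family generated by the order unit\<close>

lemma L_zero: "L (\<lambda>x\<in>XS. 0) = (\<lambda>x\<in>XS. 0)"
  using L_scale[of 0 "\<lambda>x. 0"] by simp

lemma CX_funpow: "f \<in> CX \<Longrightarrow> (L ^^ n) f \<in> CX"
  by (induction n) (auto intro: CX_L)

lemma funpow_L_add: "(L ^^ n) (\<lambda>x\<in>XS. f x + g x) = (\<lambda>x\<in>XS. (L ^^ n) f x + (L ^^ n) g x)"
proof (induction n)
  case (Suc n)
  have "(L ^^ Suc n) (\<lambda>x\<in>XS. f x + g x) = L (\<lambda>x\<in>XS. (L ^^ n) f x + (L ^^ n) g x)"
    by (simp only: funpow.simps o_apply Suc)
  then show ?case by (simp only: L_add funpow.simps o_apply)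
qed simp

lemma funpow_L_scale: "(L ^^ n) (\<lambda>x\<in>XS. k * f x) = (\<lambda>x\<in>XS. k * (L ^^ n) f x)"
proof (induction n)
  case (Suc n)
  have "(L ^^ Suc n) (\<lambda>x\<in>XS. k * f x) = L (\<lambda>x\<in>XS. k * (L ^^ n) f x)"
    by (simp only: funpow.simps o_apply Suc)
  then show ?case by (simp only: L_scale funpow.simps o_apply)
qed simp

lemma funpow_L_zero: "(L ^^ n) (\<lambda>x\<in>XS. 0) = (\<lambda>x\<in>XS. 0)"
  by (induction n) (simp_all only: funpow.simps o_apply L_zero id_apply)

section \<open>Eventual equality under the transfer operator\<close>

definition Leq :: "(split_point \<Rightarrow> int) \<Rightarrow> (split_point \<Rightarrow> int) \<Rightarrow> bool" where
  "Leq f g \<longleftrightarrow> (\<exists>n. (L ^^ n) f = (L ^^ n) g)"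

lemma funpow_L_mono:
  assumes "(L ^^ n) f = (L ^^ n) g" "n \<le> m"
  shows "(L ^^ m) f = (L ^^ m) g"
proof -
  obtain k where "m = k + n" using assms(2) by (metis add.commute le_Suc_ex)
  then show ?thesis using assms(1) by (simp add: funpow_add)
qed

lemma Leq_common:
  assumes "Leq f g" "Leq f' g'"
  obtains n where "(L ^^ n) f = (L ^^ n) g" "(L ^^ n) f' = (L ^^ n) g'"
proof -
  obtain n m where "(L ^^ n) f = (L ^^ n) g" "(L ^^ m) f' = (L ^^ m) g'"
    using assms unfolding Leq_def by blast
  then show ?thesis using that[of "max n m"] funpow_L_mono by (metis max.cobounded1 max.cobounded2)
qed

lemma Leq_refl [simp]: "Leq f f"
  by (simp add: Leq_def)

lemma Leq_sym: "Leq f g \<Longrightarrow> Leq g f"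
  by (metis Leq_def)

lemma Leq_trans: "Leq f g \<Longrightarrow> Leq g h \<Longrightarrow> Leq f h"
  by (erule (1) Leq_common) (auto simp: Leq_def intro: exI)

lemma Leq_add:
  assumes "Leq f f'" "Leq g g'"
  shows "Leq (\<lambda>x\<in>XS. f x + g x) (\<lambda>x\<in>XS. f' x + g' x)"
proof -
  obtain n where "(L ^^ n) f = (L ^^ n) f'" "(L ^^ n) g = (L ^^ n) g'"
    using assms by (rule Leq_common)
  then have "(L ^^ n) (\<lambda>x\<in>XS. f x + g x) = (L ^^ n) (\<lambda>x\<in>XS. f' x + g' x)"
    by (simp only: funpow_L_add)
  then show ?thesis unfolding Leq_def by blast
qed

lemma Leq_scale:
  assumes "Leq f f'"
  shows "Leq (\<lambda>x\<in>XS. k * f x) (\<lambda>x\<in>XS. k * f' x)"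
proof -
  obtain n where "(L ^^ n) f = (L ^^ n) f'" using assms unfolding Leq_def by blast
  then have "(L ^^ n) (\<lambda>x\<in>XS. k * f x) = (L ^^ n) (\<lambda>x\<in>XS. k * f' x)"
    by (simp only: funpow_L_scale)
  then show ?thesis unfolding Leq_def by blast
qed

text \<open>One direction makes \<L> well defined on classes, the other makes it injective there: an
  additional application of \<L> is absorbed by the exponent.\<close>

lemma Leq_L: "Leq (L f) (L g) \<longleftrightarrow> Leq f g"
proof
  assume "Leq (L f) (L g)"
  then obtain n where "(L ^^ n) (L f) = (L ^^ n) (L g)" by (auto simp: Leq_def)
  then have "(L ^^ Suc n) f = (L ^^ Suc n) g" by (simp only: funpow_Suc_right o_apply)
  then show "Leq f g" unfolding Leq_def by blast
next
  assume "Leq f g"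
  then obtain n where "(L ^^ n) f = (L ^^ n) g" by (auto simp: Leq_def)
  then have "(L ^^ Suc n) f = (L ^^ Suc n) g" by simp
  then have "(L ^^ n) (L f) = (L ^^ n) (L g)" by (simp only: funpow_Suc_right o_apply)
  then show "Leq (L f) (L g)" unfolding Leq_def by blast
qed

text \<open>For negative \<open>k\<close> this is a backward orbit of the constant function \<open>1\<close> under the transfer operator,
  because \<open>L (ind (c / \<beta>)) = ind c\<close>; see \<open>L_unit_power\<close>.\<close>

definition unit_power :: "int \<Rightarrow> split_point \<Rightarrow> int" where
  "unit_power k = (if 0 \<le> k then (L ^^ nat k) (\<lambda>x\<in>XS. 1) else ind (1 / \<beta> ^ nat (- k)))"

text \<open>These points form a backward orbit of 1 under \<open>T\<close>, with all digits
  0.\<close>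

lemma inverse_power_in_J: "1 / \<beta> ^ n \<in> J \<and> 0 < 1 / \<beta> ^ n \<and> 1 / \<beta> ^ n \<le> 1"
proof (induction n)
  case (Suc n)
  let ?c = "1 / \<beta> ^ Suc n"
  have eq: "\<beta> * ?c = 1 / \<beta> ^ n" by simp
  have pos: "0 < ?c" by simp
  have le: "?c \<le> 1 / \<beta> ^ n" using beta_gt_1 by (simp add: field_simps)
  have "T ?c = \<beta> * ?c - real 0"
    using Suc pos by (intro left_map_eqI) (auto simp: eq)
  then have "T ?c \<in> J" using Suc by (simp add: eq)
  then show ?case using J_left_map[of ?c] pos le Suc by linarith
qed simp

lemma unit_power_0: "unit_power 0 = (\<lambda>x\<in>XS. 1)"
  by (simp add: unit_power_def)

lemma unit_power_CX: "unit_power k \<in> CX"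
  unfolding unit_power_def using CX_funpow CX_const[of 1] CX_ind inverse_power_in_J by auto

lemma L_unit_power: "L (unit_power k) = unit_power (k + 1)"
proof (cases "0 \<le> k")
  case True
  then have "nat (k + 1) = Suc (nat k)" by simp
  then show ?thesis using True by (simp add: unit_power_def)
next
  case False
  define n where "n = nat (- k - 1)"
  have k: "nat (- k) = Suc n" using False by (simp add: n_def)
  have "L (unit_power k) = L (ind (1 / \<beta> ^ n / \<beta>))" using False by (simp add: unit_power_def k mult.commute)
  also have "\<dots> = ind (1 / \<beta> ^ n)" using inverse_power_in_J by (intro L_ind_small) auto
  also have "\<dots> = unit_power (k + 1)"
  proof (cases "n = 0")
    case True
    then have "k + 1 = 0" using False by (simp add: n_def)
    then show ?thesis using True by (simp add: unit_power_0 ind_1)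
  next
    case n0: False
    then have "\<not> 0 \<le> k + 1" "nat (- (k + 1)) = n" by (auto simp: n_def)
    then show ?thesis by (simp add: unit_power_def)
  qed
  finally show ?thesis .
qed

section \<open>Laurent polynomials in the transfer operator applied to 1\<close>

definition laurent_fun :: "laurent \<Rightarrow> split_point \<Rightarrow> int" where
  "laurent_fun p = (\<lambda>x\<in>XS. \<Sum>k\<in>Poly_Mapping.keys p. Poly_Mapping.lookup p k * unit_power k x)"

lemma laurent_fun_superset:
  assumes "finite K" "Poly_Mapping.keys p \<subseteq> K" "x \<in> XS"
  shows "laurent_fun p x = (\<Sum>k\<in>K. Poly_Mapping.lookup p k * unit_power k x)"
  using assms by (auto simp: laurent_fun_def not_in_keys_iff_lookup_eq_zero intro!: sum.mono_neutral_left)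

lemma laurent_fun_extensional: "laurent_fun p \<in> extensional XS"
  by (simp add: laurent_fun_def)

lemma laurent_fun_add: "laurent_fun (p + q) = (\<lambda>x\<in>XS. laurent_fun p x + laurent_fun q x)"
proof (rule extensionalityI[OF laurent_fun_extensional])
  let ?K = "Poly_Mapping.keys p \<union> Poly_Mapping.keys q"
  fix x assume "x \<in> XS"
  then show "laurent_fun (p + q) x = (\<lambda>x\<in>XS. laurent_fun p x + laurent_fun q x) x"
    using laurent_fun_superset[of ?K p x] laurent_fun_superset[of ?K q x] laurent_fun_superset[of ?K "p + q" x]
      Poly_Mapping.keys_add[of p q]
    by (simp add: lookup_add sum.distrib algebra_simps)
qed simp

lemma laurent_fun_single: "laurent_fun (Poly_Mapping.single k n) = (\<lambda>x\<in>XS. n * unit_power k x)"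
  by (rule extensionalityI[OF laurent_fun_extensional])
    (auto simp: laurent_fun_superset[of "{k}"] split: if_splits)

lemma laurent_fun_0: "laurent_fun 0 = (\<lambda>x\<in>XS. 0)"
  by (simp add: laurent_fun_def)

lemma laurent_fun_uminus: "laurent_fun (- p) = (\<lambda>x\<in>XS. - 1 * laurent_fun p x)"
  by (rule extensionalityI[OF laurent_fun_extensional])
    (auto simp: laurent_fun_superset[OF finite_keys[of p]] sum_negf)

lemma laurent_fun_frag_cmul: "laurent_fun (frag_cmul k p) = (\<lambda>x\<in>XS. k * laurent_fun p x)"
  by (rule extensionalityI[OF laurent_fun_extensional])
    (auto simp: laurent_fun_superset[OF finite_keys[of p]] laurent_fun_superset[OF finite_keys keys_cmul]
      sum_distrib_left mult.assoc)

lemma laurent_fun_1: "laurent_fun (Poly_Mapping.single 0 1) = (\<lambda>x\<in>XS. 1)"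
  unfolding laurent_fun_single unit_power_0 by auto

lemma laurent_fun_CX: "laurent_fun p \<in> CX"
proof -
  have "(\<lambda>x\<in>XS. \<Sum>k\<in>Poly_Mapping.keys p. (\<lambda>x\<in>XS. Poly_Mapping.lookup p k * unit_power k x) x) \<in> CX"
    by (intro CX_sum CX_scale unit_power_CX)
  also have "(\<lambda>x\<in>XS. \<Sum>k\<in>Poly_Mapping.keys p. (\<lambda>x\<in>XS. Poly_Mapping.lookup p k * unit_power k x) x) = laurent_fun p"
    by (auto simp: laurent_fun_def fun_eq_iff restrict_def)
  finally show ?thesis .
qed

lemma L_laurent_fun: "L (laurent_fun p) = laurent_fun (laurent_t * p)"
proof -
  have "Poly_Mapping.keys p \<subseteq> UNIV" by simp
  then show ?thesis
  proof (induction rule: frag_induction)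
    case zero
    then show ?case by (simp only: mult_zero_right laurent_fun_0 L_zero)
  next
    case (one k)
    have "L (laurent_fun (Poly_Mapping.single k 1)) = (\<lambda>x\<in>XS. 1 * unit_power (k + 1) x)"
      by (simp only: laurent_fun_single L_scale L_unit_power)
    then show ?case by (simp only: laurent_t_def mult_single laurent_fun_single add.commute mult_1)
  next
    case (diff a b)
    have "L (laurent_fun (a + - b)) = (\<lambda>x\<in>XS. laurent_fun (laurent_t * a) x + laurent_fun (laurent_t * - b) x)"
      unfolding laurent_fun_add L_add laurent_fun_uminus L_scale diff mult_minus_right ..
    then show ?case by (simp only: diff_conv_add_uminus distrib_left laurent_fun_add)
  qed
qed

abbreviation tpow :: "int \<Rightarrow> laurent" where
  "tpow n \<equiv> Poly_Mapping.single n 1"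

lemma tpow_add: "tpow m * (tpow n * p) = tpow (m + n) * p"
  by (simp add: mult.assoc[symmetric] mult_single)

lemma funpow_L_laurent_fun: "(L ^^ n) (laurent_fun p) = laurent_fun (tpow (int n) * p)"
proof (induction n)
  case (Suc n)
  have "(L ^^ Suc n) (laurent_fun p) = laurent_fun (laurent_t * (tpow (int n) * p))"
    by (simp only: funpow.simps o_apply Suc L_laurent_fun)
  then show ?case by (simp only: laurent_t_def tpow_add) (simp add: add.commute)
qed simp

text \<open>\<L> moves the indicator at \<open>orb k\<close> to \<open>orb (Suc k)\<close> and adds
  the digit of \<open>orb k\<close> times the function 1, which is again the indicator at
  \<open>orb 0\<close>. So in \<L>^n 1 the coefficient at \<open>orb k\<close> depends only on n -
  k, and each new coefficient at \<open>orb 0\<close> is a digit-weighted sum of the earlier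
  ones.\<close>

fun renewal_count :: "nat \<Rightarrow> int" where
  "renewal_count 0 = 1"
| "renewal_count (Suc n) = (\<Sum>k\<in>{..n}. int (digit (orb k)) * renewal_count (n - k))"

lemma unit_power_expand: "unit_power (int n) = (\<lambda>x\<in>XS. \<Sum>k\<le>n. renewal_count (n - k) * ind (orb k) x)"
proof (induction n)
  case 0
  then show ?case by (auto simp: unit_power_0 ind_1)
next
  case (Suc n)
  have 1: "unit_power (int (Suc n)) = L (unit_power (int n))" by (simp add: L_unit_power add.commute)
  have 2: "unit_power (int n) = (\<lambda>x\<in>XS. \<Sum>k\<le>n. (\<lambda>x\<in>XS. renewal_count (n - k) * ind (orb k) x) x)"
    unfolding Suc by (auto simp: fun_eq_iff restrict_def)
  have 3: "L (unit_power (int n)) = (\<lambda>x\<in>XS. \<Sum>k\<le>n. (\<lambda>x\<in>XS. renewal_count (n - k) * L (ind (orb k)) x) x)"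
    unfolding 2 L_sum L_scale ..
  show ?case unfolding 1 3
  proof (rule restrict_ext)
    fix x assume x: "x \<in> XS"
    have "(\<Sum>k\<le>n. (\<lambda>x\<in>XS. renewal_count (n - k) * L (ind (orb k)) x) x) =
      (\<Sum>k\<le>n. renewal_count (n - k) * (int (digit (orb k)) + ind (orb (Suc k)) x))"
      using x by (intro sum.cong) (auto simp: L_ind orb_bounds orb_Suc)
    also have "\<dots> = renewal_count (Suc n) * ind (orb 0) x + (\<Sum>k\<le>n. renewal_count (Suc n - Suc k) * ind (orb (Suc k)) x)"
      using x by (simp add: distrib_left sum.distrib ind_1 mult.commute)
    also have "\<dots> = (\<Sum>k\<le>Suc n. renewal_count (Suc n - k) * ind (orb k) x)"
      by (subst sum.atMost_Suc_shift) simp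
    finally show "(\<Sum>k\<le>n. (\<lambda>x\<in>XS. renewal_count (n - k) * L (ind (orb k)) x) x) =
      (\<Sum>k\<le>Suc n. renewal_count (Suc n - k) * ind (orb k) x)" .
  qed
qed

text \<open>The orbit points are distinct, so only the indicator at \<open>orb m\<close> jumps
  there. The index 0 is excluded because the indicator at 1 is constant. For m = n the value is
  \<open>renewal_count 0\<close>, that is 1.\<close>

lemma jump_unit_power:
  assumes "1 \<le> m"
  shows "jump (unit_power (int n)) (orb m) = (if m \<le> n then renewal_count (n - m) else 0)"
proof -
  have m: "orb m \<noteq> 1" using orb_inj[of m 0] assms by simp
  have "(orb m, False) \<in> XS" "upper (orb m) \<in> XS"
    using orb_bounds[of m] by (auto simp: in_X upper_in_X)
  then have "jump (unit_power (int n)) (orb m) = (\<Sum>k\<le>n. renewal_count (n - k) * jump (ind (orb k)) (orb m))"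
    unfolding unit_power_expand by (simp add: jump_def sum_subtractf right_diff_distrib)
  also have "\<dots> = (\<Sum>k\<le>n. if k = m then renewal_count (n - k) else 0)"
  proof (rule sum.cong)
    fix k
    have "jump (ind (orb k)) (orb m) = (if k = m then 1 else 0)"
    proof (cases "k = 0")
      case True
      then show ?thesis using assms \<open>(orb m, False) \<in> XS\<close> \<open>upper (orb m) \<in> XS\<close>
        by (simp add: ind_1 jump_def)
    next
      case False
      then have "orb k \<in> J - {0, 1}" using orb_bounds[of k] orb_inj[of k 0] orb_in_J by auto
      then show ?thesis using jump_ind[of "orb k" "orb m"] orb_bounds[of m] by (auto simp: orb_inj)
    qed
    then show "renewal_count (n - k) * jump (ind (orb k)) (orb m) = (if k = m then renewal_count (n - k) else 0)" by simp
  qed simp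
  finally show ?thesis by (simp add: sum.delta)
qed

text \<open>For the top exponent \<open>d\<close>, lower powers have no jump at the orbit point of
  index \<open>d\<close>, so the jump there is the leading coefficient. If \<open>d\<close> is 0
  there is no jump to look at, and the value of the constant function is used.\<close>

lemma laurent_fun_nonneg_inj:
  assumes "laurent_fun q = (\<lambda>x\<in>XS. 0)" "Poly_Mapping.keys q \<subseteq> {0..}"
  shows "q = 0"
proof (rule ccontr)
  let ?K = "Poly_Mapping.keys q"
  assume "q \<noteq> 0"
  then have K: "finite ?K" "?K \<noteq> {}" by auto
  define d where "d = Max ?K"
  have d: "d \<in> ?K" "\<And>k. k \<in> ?K \<Longrightarrow> k \<le> d"
    unfolding d_def using K by (auto intro: Max_in)
  then have "0 \<le> d" using assms(2) by blast
  note d = d this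
  have qd: "Poly_Mapping.lookup q d \<noteq> 0" using d by (simp add: in_keys_iff)
  have q0: "laurent_fun q x = 0" if "x \<in> XS" for x using assms(1) that by simp
  show False
  proof (cases "d = 0")
    case True
    then have "k = 0" if "k \<in> ?K" for k using d(2)[OF that] assms(2) that by auto
    then have "?K = {0}" using d(1) True by blast
    moreover have "(1, False) \<in> XS" by (simp add: in_X)
    ultimately have "laurent_fun q (1, False) = Poly_Mapping.lookup q 0" by (simp add: laurent_fun_def unit_power_0)
    then show False using qd True q0[of "(1, False)"] by (simp add: in_X)
  next
    case False
    define m where "m = nat d"
    have m: "d = int m" "1 \<le> m" using False d(3) by (auto simp: m_def)
    have in_XS: "(orb m, False) \<in> XS" "upper (orb m) \<in> XS"
      using orb_bounds[of m] by (auto simp: in_X upper_in_X)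
    then have "0 = jump (laurent_fun q) (orb m)" using q0 by (simp add: jump_def)
    also have "\<dots> = (\<Sum>k\<in>?K. Poly_Mapping.lookup q k * jump (unit_power k) (orb m))"
      using in_XS by (simp add: jump_def laurent_fun_def sum_subtractf right_diff_distrib)
    also have "\<dots> = (\<Sum>k\<in>?K. if k = d then Poly_Mapping.lookup q k else 0)"
    proof (rule sum.cong)
      fix k assume "k \<in> ?K"
      then have k: "0 \<le> k" "k \<le> d" using assms(2) d by auto
      then show "Poly_Mapping.lookup q k * jump (unit_power k) (orb m) = (if k = d then Poly_Mapping.lookup q k else 0)"
        using jump_unit_power[OF m(2), of "nat k"] m(1) by auto
    qed simp
    also have "\<dots> = Poly_Mapping.lookup q d" using K d(1) by (simp add: sum.delta)
    finally show False using qd by simp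
  qed
qed

text \<open>Multiplication by a high power of t amounts to applying \<L> often enough. It reaches
  equality of functions and clears negative exponents at once, and it can be undone because t is a
  unit.\<close>

lemma laurent_fun_Leq_0:
  assumes "Leq (laurent_fun p) (\<lambda>x\<in>XS. 0)"
  shows "p = 0"
proof -
  obtain n where n: "(L ^^ n) (laurent_fun p) = (L ^^ n) (\<lambda>x\<in>XS. 0)" using assms by (auto simp: Leq_def)
  define M where "M = nat (- Min (Poly_Mapping.keys p))"
  have M: "- int M \<le> k" if "k \<in> Poly_Mapping.keys p" for k
  proof -
    have "Min (Poly_Mapping.keys p) \<le> k" using that by simp
    then show ?thesis unfolding M_def by linarith
  qed
  let ?N = "max n M"
  have "laurent_fun (tpow (int ?N) * p) = (\<lambda>x\<in>XS. 0)"
    using funpow_L_mono[OF n, of ?N] by (simp only: max.cobounded1 funpow_L_laurent_fun funpow_L_zero)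
  moreover have "Poly_Mapping.keys (tpow (int ?N) * p) \<subseteq> {0..}"
  proof
    fix k assume "k \<in> Poly_Mapping.keys (tpow (int ?N) * p)"
    then obtain j where "k = int ?N + j" "j \<in> Poly_Mapping.keys p"
      using keys_mult[of "tpow (int ?N)" p] by auto
    then show "k \<in> {0..}" using M[of j] by auto
  qed
  ultimately have "tpow (int ?N) * p = 0" by (rule laurent_fun_nonneg_inj)
  then have "tpow (- int ?N) * (tpow (int ?N) * p) = 0" by simp
  then show ?thesis by (simp only: tpow_add) simp
qed

lemma laurent_fun_Leq_inj:
  assumes "Leq (laurent_fun p) (laurent_fun q)"
  shows "p = q"
proof -
  have "Leq (\<lambda>x\<in>XS. laurent_fun p x + laurent_fun (- q) x) (\<lambda>x\<in>XS. laurent_fun q x + laurent_fun (- q) x)"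
    by (rule Leq_add[OF assms Leq_refl])
  then have "Leq (laurent_fun (p + - q)) (laurent_fun (q + - q))" by (simp only: laurent_fun_add)
  then have "p + - q = 0" by (intro laurent_fun_Leq_0) (simp add: laurent_fun_0)
  then show ?thesis by simp
qed

text \<open>On classes the formula for \<L> on indicators reads t [ind x] = d + [ind (T x)]. As t is
  invertible, either class can be solved for in terms of the other, so membership in the span passes
  both ways along \<open>T\<close>.\<close>

lemma ind_span:
  assumes "c \<in> J" "0 < c"
  shows "\<exists>p. Leq (ind c) (laurent_fun p)"
proof -
  have "c \<in> J \<longrightarrow> (\<exists>p. Leq (ind c) (laurent_fun p))"
    using assms
  proof (induction rule: J_induct)
    case one
    have "ind 1 = laurent_fun (tpow 0)" by (simp only: laurent_fun_1 ind_1)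
    then have "Leq (ind 1) (laurent_fun (tpow 0))" by (simp only: Leq_refl)
    then show ?case by blast
  next
    case (step x)
    let ?d = "int (digit x)"
    have Lx: "L (ind x) = (\<lambda>y\<in>XS. laurent_fun (Poly_Mapping.single 0 ?d) y + ind (T x) y)"
      unfolding laurent_fun_single unit_power_0 L_ind[OF step] by (auto simp: fun_eq_iff restrict_def)
    have "(\<exists>p. Leq (ind x) (laurent_fun p)) \<longleftrightarrow> (\<exists>p. Leq (ind (T x)) (laurent_fun p))"
    proof safe
      fix p assume "Leq (ind x) (laurent_fun p)"
      then have "Leq (L (ind x)) (laurent_fun (laurent_t * p))" by (simp only: Leq_L L_laurent_fun[symmetric])
      then have "Leq (\<lambda>y\<in>XS. laurent_fun (Poly_Mapping.single 0 (- ?d)) y + L (ind x) y)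
        (\<lambda>y\<in>XS. laurent_fun (Poly_Mapping.single 0 (- ?d)) y + laurent_fun (laurent_t * p) y)"
        by (intro Leq_add Leq_refl)
      moreover have "(\<lambda>y\<in>XS. laurent_fun (Poly_Mapping.single 0 (- ?d)) y + L (ind x) y) = ind (T x)"
        unfolding Lx laurent_fun_single unit_power_0 by (rule ext) (simp add: ind_def)
      ultimately show "\<exists>p. Leq (ind (T x)) (laurent_fun p)"
        unfolding laurent_fun_add[symmetric] by auto
    next
      fix p assume "Leq (ind (T x)) (laurent_fun p)"
      then have "Leq (L (ind x)) (laurent_fun (Poly_Mapping.single 0 ?d + p))"
        unfolding Lx laurent_fun_add by (intro Leq_add Leq_refl)
      \<comment> \<open>A factor t is extracted so that the right-hand side is an image under \<L>,
        which \<open>Leq_L\<close> can cancel.\<close>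
      also have "Poly_Mapping.single 0 ?d + p = laurent_t * (tpow (- 1) * (Poly_Mapping.single 0 ?d + p))"
        unfolding laurent_t_def tpow_add by simp
      finally have "Leq (ind x) (laurent_fun (tpow (- 1) * (Poly_Mapping.single 0 ?d + p)))"
        by (simp only: L_laurent_fun[symmetric] Leq_L)
      then show "\<exists>p. Leq (ind x) (laurent_fun p)" by blast
    qed
    then show ?case using J_left_map step by simp
  qed
  then show ?thesis using assms by blast
qed

lemma CX_span: "f \<in> CX \<Longrightarrow> \<exists>p. Leq f (laurent_fun p)"
proof (induction rule: CX_induct)
  case zero
  have "Leq (\<lambda>x\<in>XS. 0) (laurent_fun 0)" unfolding laurent_fun_0 by (rule Leq_refl)
  then show ?case ..
next
  case (step f k c)
  obtain p q where p: "Leq f (laurent_fun p)" and q: "Leq (ind c) (laurent_fun q)" using step ind_span by blast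
  have "Leq (\<lambda>x\<in>XS. (\<lambda>x\<in>XS. k * ind c x) x + f x) (\<lambda>x\<in>XS. (\<lambda>x\<in>XS. k * laurent_fun q x) x + laurent_fun p x)"
    by (intro Leq_add Leq_scale p q)
  moreover have "(\<lambda>x\<in>XS. (\<lambda>x\<in>XS. k * ind c x) x + f x) = (\<lambda>x\<in>XS. k * ind c x + f x)"
    by (auto simp: fun_eq_iff restrict_def)
  ultimately have "Leq (\<lambda>x\<in>XS. k * ind c x + f x) (laurent_fun (frag_cmul k q + p))"
    by (simp only: laurent_fun_add laurent_fun_frag_cmul)
  then show ?case ..
qed

section \<open>Lebesgue measure and asymptotics of the transfer operator\<close>

declare renewal_count.simps(2) [simp del]

text \<open>Evaluating at left copies loses nothing, since only countably many points are doubled: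
  this is the integral for Lebesgue measure lifted to X.\<close>

definition leb_mean :: "(split_point \<Rightarrow> int) \<Rightarrow> real" where
  "leb_mean f = integral {0..1} (\<lambda>x. real_of_int (f (x, False)))"

lemma has_integral_ind:
  assumes "0 \<le> c" "c \<le> 1"
  shows "((\<lambda>x. real_of_int (ind c (x, False))) has_integral c) {0..1}"
proof -
  have "((\<lambda>x. 1::real) has_integral c) {0..c}"
    using has_integral_const_real[of "1::real" 0 c] assms by simp
  then have "((\<lambda>x. if x \<in> {0..c} then 1 else 0::real) has_integral c) {0..1}"
    using assms by (subst has_integral_restrict) auto
  then show ?thesis
    by (rule has_integral_eq[rotated]) (auto simp: ind_apply in_X below_def)
qed

lemma CX_integrable: "f \<in> CX \<Longrightarrow> (\<lambda>x. real_of_int (f (x, False))) integrable_on {0..1}"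
proof (induction rule: CX_induct)
  case zero
  have "(\<lambda>x::real. 0::real) integrable_on {0..1}" by (rule integrable_0)
  then show ?case by (rule integrable_eq) (simp add: in_X)
next
  case (step f k c)
  have "c \<le> 1" using step J_subset by auto
  then have "(\<lambda>x. real_of_int (ind c (x, False))) integrable_on {0..1}"
    using has_integral_ind[of c] step by (auto simp: integrable_on_def)
  then have "(\<lambda>x. real_of_int k * real_of_int (ind c (x, False)) + real_of_int (f (x, False))) integrable_on {0..1}"
    using step by (intro integrable_add integrable_on_mult_right)
  then show ?case by (rule integrable_eq) (simp add: in_X)
qed

lemma leb_mean_add:
  assumes "f \<in> CX" "g \<in> CX"
  shows "leb_mean (\<lambda>x\<in>XS. f x + g x) = leb_mean f + leb_mean g"
proof -
  have "leb_mean (\<lambda>x\<in>XS. f x + g x) = integral {0..1} (\<lambda>x. real_of_int (f (x, False)) + real_of_int (g (x, False)))"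
    unfolding leb_mean_def by (rule integral_cong) (simp add: in_X)
  then show ?thesis using assms by (simp add: leb_mean_def integral_add CX_integrable)
qed

lemma leb_mean_scale: "leb_mean (\<lambda>x\<in>XS. k * f x) = of_int k * leb_mean f"
proof -
  have "leb_mean (\<lambda>x\<in>XS. k * f x) = integral {0..1} (\<lambda>x. real_of_int k * real_of_int (f (x, False)))"
    unfolding leb_mean_def by (rule integral_cong) (simp add: in_X)
  then show ?thesis by (simp add: leb_mean_def)
qed

lemma leb_mean_zero: "leb_mean (\<lambda>x\<in>XS. 0) = 0"
  using leb_mean_scale[of 0 "\<lambda>x. 0"] by simp

lemma leb_mean_ind: "0 \<le> c \<Longrightarrow> c \<le> 1 \<Longrightarrow> leb_mean (ind c) = c"
  unfolding leb_mean_def by (rule integral_unique[OF has_integral_ind])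

lemma leb_mean_const: "leb_mean (\<lambda>x\<in>XS. k) = of_int k"
proof -
  have "(\<lambda>x\<in>XS. k) = (\<lambda>x\<in>XS. k * ind 1 x)" by (auto simp: ind_1)
  then show ?thesis using leb_mean_ind[of 1] leb_mean_scale[of k "ind 1"] by simp
qed

lemma leb_mean_sum:
  assumes "finite A" "\<And>i. i \<in> A \<Longrightarrow> F i \<in> CX"
  shows "leb_mean (\<lambda>x\<in>XS. \<Sum>i\<in>A. F i x) = (\<Sum>i\<in>A. leb_mean (F i))"
  using assms
proof (induction A rule: finite_induct)
  case empty
  show ?case unfolding sum.empty by (rule leb_mean_zero)
next
  case (insert a A)
  have "(\<lambda>x\<in>XS. \<Sum>i\<in>insert a A. F i x) = (\<lambda>x\<in>XS. F a x + (\<lambda>x\<in>XS. \<Sum>i\<in>A. F i x) x)"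
    using insert by (auto simp: fun_eq_iff restrict_def)
  moreover have "(\<lambda>x\<in>XS. \<Sum>i\<in>A. F i x) \<in> CX" using insert by (intro CX_sum) auto
  ultimately have "leb_mean (\<lambda>x\<in>XS. \<Sum>i\<in>insert a A. F i x) = leb_mean (F a) + leb_mean (\<lambda>x\<in>XS. \<Sum>i\<in>A. F i x)"
    using leb_mean_add[OF insert.prems[of a], of "\<lambda>x\<in>XS. \<Sum>i\<in>A. F i x"] by (simp only: insertI1)
  moreover have "leb_mean (\<lambda>x\<in>XS. \<Sum>i\<in>A. F i x) = (\<Sum>i\<in>A. leb_mean (F i))"
    by (rule insert.IH) (use insert.prems in auto)
  ultimately show ?case by (simp only: sum.insert[OF insert.hyps])
qed

text \<open>On an indicator this is the identity d + T c = \<beta> c between \<open>c\<close>, its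
  digit and its image; the rest is linearity.\<close>

lemma leb_mean_L: "f \<in> CX \<Longrightarrow> leb_mean (L f) = \<beta> * leb_mean f"
proof (induction rule: CX_induct)
  case zero
  show ?case unfolding L_zero leb_mean_zero by simp
next
  case (step f k c)
  have c: "0 < c" "c \<le> 1" using step J_subset by auto
  have T: "T c \<in> J" "0 < T c" "T c \<le> 1" using step c left_map_bounds[of c \<beta>] J_left_map by auto
  have 1: "(\<lambda>x\<in>XS. k * ind c x + f x) = (\<lambda>x\<in>XS. (\<lambda>x\<in>XS. k * ind c x) x + f x)"
    by (auto simp: fun_eq_iff restrict_def)
  have kc: "(\<lambda>x\<in>XS. k * ind c x) \<in> CX" using step by (intro CX_scale CX_ind) auto
  have "L (ind c) = (\<lambda>x\<in>XS. (\<lambda>x\<in>XS. int (digit c)) x + ind (T c) x)"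
    unfolding L_ind[OF c] by (auto simp: fun_eq_iff restrict_def)
  then have "leb_mean (L (ind c)) = real (digit c) + T c"
    using leb_mean_add[OF CX_const CX_ind[OF T(1,2)], of "int (digit c)"] leb_mean_const[of "int (digit c)"]
      leb_mean_ind[of "T c"] T by simp
  also have "\<dots> = \<beta> * c" using digit(3)[OF c(1)] by simp
  finally have Lc: "leb_mean (L (ind c)) = \<beta> * c" .
  have "leb_mean (L (\<lambda>x\<in>XS. k * ind c x + f x)) = of_int k * leb_mean (L (ind c)) + leb_mean (L f)"
    unfolding 1 L_add L_scale
    using leb_mean_add[OF CX_scale[OF CX_L[OF CX_ind[OF step(2,3)]], of k] CX_L[OF step(1)]]
    by (simp only: leb_mean_scale)
  also have "\<dots> = \<beta> * (of_int k * leb_mean (ind c) + leb_mean f)"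
    using step(4) c by (simp add: Lc leb_mean_ind algebra_simps)
  also have "of_int k * leb_mean (ind c) + leb_mean f = leb_mean (\<lambda>x\<in>XS. k * ind c x + f x)"
    unfolding 1 using leb_mean_add[OF kc step(1)] leb_mean_scale by simp
  finally show ?case .
qed

lemma leb_mean_funpow_L: "f \<in> CX \<Longrightarrow> leb_mean ((L ^^ n) f) = \<beta> ^ n * leb_mean f"
  by (induction n) (auto simp: leb_mean_L CX_funpow)

lemma leb_mean_Leq:
  assumes "Leq f g" "f \<in> CX" "g \<in> CX"
  shows "leb_mean f = leb_mean g"
proof -
  obtain n where "(L ^^ n) f = (L ^^ n) g" using assms by (auto simp: Leq_def)
  then have "\<beta> ^ n * leb_mean f = \<beta> ^ n * leb_mean g"
    by (simp only: leb_mean_funpow_L[OF assms(2), symmetric] leb_mean_funpow_L[OF assms(3), symmetric])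
  then show ?thesis by simp
qed

lemma leb_mean_nonneg:
  assumes "f \<in> CX" "\<And>x. x \<in> XS \<Longrightarrow> 0 \<le> f x"
  shows "0 \<le> leb_mean f"
  unfolding leb_mean_def
  by (rule integral_nonneg[OF CX_integrable[OF assms(1)]]) (use assms(2) in \<open>auto simp: in_X\<close>)

text \<open>By continuity a nonzero value persists over an interval on one side of the point, and a
  positive integer is at least 1.\<close>

lemma leb_mean_pos:
  assumes f: "f \<in> CX" "\<And>x. x \<in> XS \<Longrightarrow> 0 \<le> f x" and p: "p \<in> XS" "f p \<noteq> 0"
  shows "0 < leb_mean f"
proof -
  obtain u w where uw: "0 \<le> u" "u < w" "w \<le> 1" "\<And>y. u < y \<Longrightarrow> y < w \<Longrightarrow> f (y, False) = f p"
  proof -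
    obtain x b where px: "p = (x, b)" by (cases p)
    have x: "x \<in> {0..1}" using p px by (auto simp: in_X)
    show ?thesis
    proof (cases "b \<or> x = 0")
      case True
      then have "p = upper x" using p px by (auto simp: upper_def in_X)
      then have "right_nbhd {q \<in> XS. f q = f p} x" using CX_right[OF f(1) x] by simp
      then obtain d where d: "d > 0" "\<And>y b. x < y \<Longrightarrow> y < x + d \<Longrightarrow> (y, b) \<in> XS \<Longrightarrow> f (y, b) = f p"
        unfolding right_nbhd_def by blast
      have "x < 1" using True p px by (auto simp: in_X)
      then show ?thesis using d(1) x by (intro that[of x "min 1 (x + d)"]) (auto intro!: d(2) simp: in_X)
    next
      case False
      then have "left_nbhd {q \<in> XS. f q = f p} x" using CX_left[OF f(1) x] px by simp
      then obtain d where d: "d > 0" "\<And>y b. x - d < y \<Longrightarrow> y < x \<Longrightarrow> (y, b) \<in> XS \<Longrightarrow> f (y, b) = f p"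
        unfolding left_nbhd_def by blast
      have "0 < x" using False x by auto
      then show ?thesis using d(1) x by (intro that[of "max 0 (x - d)" x]) (auto intro!: d(2) simp: in_X)
    qed
  qed
  \<comment> \<open>The value is known only strictly between \<open>u\<close> and \<open>w\<close>;
    the points at one and two thirds bound a closed interval inside.\<close>
  define u' w' where "u' = (2 * u + w) / 3" and "w' = (u + 2 * w) / 3"
  have uw': "u < u'" "u' < w'" "w' < w" using uw by (auto simp: u'_def w'_def)
  have "((\<lambda>x. 1::real) has_integral (w' - u')) {u'..w'}"
    using has_integral_const_real[of "1::real" u' w'] uw' by simp
  then have int: "((\<lambda>x. if x \<in> {u'..w'} then 1 else 0::real) has_integral (w' - u')) {0..1}"
    using uw uw' by (subst has_integral_restrict) auto
  have "w' - u' \<le> leb_mean f"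
    unfolding leb_mean_def
  proof (rule has_integral_le[OF int integrable_integral[OF CX_integrable[OF f(1)]]])
    fix x :: real assume "x \<in> {0..1}"
    then have "0 \<le> f (x, False)" using f(2) by (simp add: in_X)
    moreover have "1 \<le> f (x, False)" if "x \<in> {u'..w'}"
    proof -
      have "f (x, False) = f p" using that uw' by (intro uw) auto
      then show ?thesis using p f(2)[of p] by auto
    qed
    ultimately show "(if x \<in> {u'..w'} then 1 else 0) \<le> real_of_int (f (x, False))" by auto
  qed
  then show ?thesis using uw' by linarith
qed

lemma leb_mean_unit_power: "leb_mean (unit_power k) = \<beta> powi k"
proof (cases "0 \<le> k")
  case True
  then show ?thesis
    using leb_mean_funpow_L[OF CX_const, of "nat k" 1] leb_mean_const[of 1] by (simp add: unit_power_def power_int_def)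
next
  case False
  then show ?thesis using inverse_power_in_J[of "nat (- k)"] leb_mean_ind[of "1 / \<beta> ^ nat (- k)"]
    by (simp add: unit_power_def power_int_def inverse_eq_divide power_one_over)
qed

lemma leb_mean_laurent_fun: "leb_mean (laurent_fun p) = laurent_eval p \<beta>"
proof -
  have "laurent_fun p = (\<lambda>x\<in>XS. \<Sum>k\<in>Poly_Mapping.keys p. (\<lambda>x\<in>XS. Poly_Mapping.lookup p k * unit_power k x) x)"
    by (auto simp: laurent_fun_def fun_eq_iff restrict_def)
  then have "leb_mean (laurent_fun p) = leb_mean (\<lambda>x\<in>XS. \<Sum>k\<in>Poly_Mapping.keys p. (\<lambda>x\<in>XS. Poly_Mapping.lookup p k * unit_power k x) x)"
    by (rule arg_cong)
  also have "\<dots> = (\<Sum>k\<in>Poly_Mapping.keys p. leb_mean (\<lambda>x\<in>XS. Poly_Mapping.lookup p k * unit_power k x))"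
    by (intro leb_mean_sum CX_scale unit_power_CX) simp
  finally show ?thesis by (simp add: leb_mean_scale leb_mean_unit_power laurent_eval_def)
qed

section \<open>The renewal equation attached to the \<beta>-expansion of 1\<close>

definition renewal_ratio :: "nat \<Rightarrow> real" where "renewal_ratio n = of_int (renewal_count n) / \<beta> ^ n"
text \<open>The terms of the \<beta>-expansion of 1. The exponent is \<open>Suc k\<close> because
  the recursion for index \<open>Suc n\<close> refers back to \<open>n - k\<close>, a lag of k +
  1.\<close>

definition digit_weight :: "nat \<Rightarrow> real" where "digit_weight k = real (digit (orb k)) / \<beta> ^ Suc k"
definition geom_weight :: "nat \<Rightarrow> real" where "geom_weight k = 1 / \<beta> ^ k"

lemma geom_weight_pos: "0 < geom_weight k"
  by (simp add: geom_weight_def)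

lemma geom_weight_summable: "summable geom_weight"
proof -
  have "summable (\<lambda>k. (1 / \<beta>) ^ k)" using beta_gt_1 by (intro summable_geometric) simp
  moreover have "geom_weight = (\<lambda>k. (1 / \<beta>) ^ k)" by (simp add: fun_eq_iff geom_weight_def power_divide)
  ultimately show ?thesis by simp
qed

lemma renewal_count_nonneg: "0 \<le> renewal_count n"
proof (induction n rule: less_induct)
  case (less n)
  show ?case
  proof (cases n)
    case 0
    then show ?thesis by (simp only: renewal_count.simps)
  next
    case (Suc m)
    show ?thesis unfolding Suc renewal_count.simps
      by (intro sum_nonneg mult_nonneg_nonneg of_nat_0_le_iff less) (simp add: Suc)
  qed
qed

lemma renewal_ratio_rec: "renewal_ratio (Suc n) = (\<Sum>k\<le>n. digit_weight k * renewal_ratio (n - k))"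
proof -
  have "renewal_ratio (Suc n) = (\<Sum>k\<le>n. real (digit (orb k)) * of_int (renewal_count (n - k)) / \<beta> ^ Suc n)"
    by (simp add: renewal_ratio_def renewal_count.simps(2) sum_divide_distrib)
  also have "\<dots> = (\<Sum>k\<le>n. digit_weight k * renewal_ratio (n - k))"
  proof (rule sum.cong)
    fix k assume "k \<in> {..n}"
    then have "\<beta> ^ Suc n = \<beta> ^ Suc k * \<beta> ^ (n - k)" by (simp add: power_add[symmetric])
    then show "real (digit (orb k)) * of_int (renewal_count (n - k)) / \<beta> ^ Suc n = digit_weight k * renewal_ratio (n - k)"
      by (simp add: digit_weight_def renewal_ratio_def)
  qed simp
  finally show ?thesis .
qed

lemma power_split: "k \<le> n \<Longrightarrow> of_int (renewal_count (n - k)) / \<beta> ^ n = renewal_ratio (n - k) * geom_weight k"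
  by (simp add: renewal_ratio_def geom_weight_def power_add[symmetric])

text \<open>Lebesgue measure of \<L>^n 1 is \<beta>^n, and integrating the expansion term by term
  gives the left-hand side after division. This conserved sum fixes the limit; its term k = 0 also
  bounds the ratios by 1.\<close>

lemma renewal_ratio_sum: "(\<Sum>k\<le>n. renewal_ratio (n - k) * (orb k * geom_weight k)) = 1"
proof -
  have "unit_power (int n) = (\<lambda>x\<in>XS. \<Sum>k\<le>n. (\<lambda>x\<in>XS. renewal_count (n - k) * ind (orb k) x) x)"
    unfolding unit_power_expand by (auto simp: fun_eq_iff restrict_def)
  then have "leb_mean (unit_power (int n)) = (\<Sum>k\<le>n. leb_mean (\<lambda>x\<in>XS. renewal_count (n - k) * ind (orb k) x))"
    by (simp only:) (intro leb_mean_sum CX_scale CX_ind orb_in_J orb_bounds finite_atMost)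
  also have "\<dots> = (\<Sum>k\<le>n. of_int (renewal_count (n - k)) * orb k)"
    by (simp add: leb_mean_scale leb_mean_ind orb_bounds less_imp_le)
  finally have "\<beta> ^ n = (\<Sum>k\<le>n. of_int (renewal_count (n - k)) * orb k)"
    by (simp add: leb_mean_unit_power)
  then have "1 = (\<Sum>k\<le>n. of_int (renewal_count (n - k)) * orb k) / \<beta> ^ n"
    by (metis divide_self beta_pos(3) power_not_zero)
  also have "\<dots> = (\<Sum>k\<le>n. of_int (renewal_count (n - k)) / \<beta> ^ n * orb k)"
    by (simp add: sum_divide_distrib)
  also have "\<dots> = (\<Sum>k\<le>n. renewal_ratio (n - k) * (orb k * geom_weight k))"
    by (rule sum.cong) (auto simp: power_split)
  finally show ?thesis by simp
qed

lemma renewal_ratio_nonneg: "0 \<le> renewal_ratio n"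
  by (simp add: renewal_ratio_def renewal_count_nonneg)

lemma renewal_ratio_le_1: "renewal_ratio n \<le> 1"
proof -
  have "renewal_ratio n = renewal_ratio (n - 0) * (orb 0 * geom_weight 0)" by (simp add: geom_weight_def)
  also have "\<dots> \<le> (\<Sum>k\<le>n. renewal_ratio (n - k) * (orb k * geom_weight k))"
    by (rule member_le_sum) (auto intro!: mult_nonneg_nonneg renewal_ratio_nonneg less_imp_le[OF geom_weight_pos] less_imp_le[OF orb_bounds(1)])
  finally show ?thesis by (simp add: renewal_ratio_sum)
qed

text \<open>Telescoping of the relation between consecutive orbit points; the remainder is the part
  of 1 not yet expanded.\<close>

lemma digit_sum: "(\<Sum>k<n. digit_weight k) = 1 - orb n * geom_weight n"
proof (induction n)
  case (Suc n)
  have "orb (Suc n) = \<beta> * orb n - real (digit (orb n))"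
    unfolding orb_Suc by (rule digit(3)[OF orb_bounds(1)])
  then have "digit_weight n = orb n * geom_weight n - orb (Suc n) * geom_weight (Suc n)"
    by (simp add: digit_weight_def geom_weight_def field_simps)
  then show ?case using Suc by simp
qed (simp add: geom_weight_def)

lemma geom_weight_tendsto: "geom_weight \<longlonglongrightarrow> 0"
  using geom_weight_summable by (rule summable_LIMSEQ_zero)

lemma orb_geom_weight_le: "\<bar>orb k * geom_weight k\<bar> \<le> geom_weight k"
  using orb_bounds[of k] geom_weight_pos[of k] by (simp add: abs_mult mult_left_le_one_le)

lemma digit_weight_sums: "digit_weight sums 1"
proof -
  have "(\<lambda>n. orb n * geom_weight n) \<longlonglongrightarrow> 0"
    by (rule Lim_null_comparison[OF _ geom_weight_tendsto]) (use orb_geom_weight_le in \<open>auto intro!: always_eventually\<close>)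
  then have "(\<lambda>n. 1 - orb n * geom_weight n) \<longlonglongrightarrow> 1 - 0" by (intro tendsto_intros)
  then show ?thesis by (simp add: sums_def digit_sum)
qed

text \<open>By \<open>digit_sum\<close> and \<open>digit_weight_sums\<close>,
  \<open>orb k * geom_weight k\<close> is the sum of the weights from index \<open>k\<close> on. The
  series is therefore the mean lag, and this is the reciprocal mean of the classical renewal
  theorem.\<close>

definition renewal_limit :: real where "renewal_limit = 1 / suminf (\<lambda>k. orb k * geom_weight k)"

lemma orb_geom_weight_summable: "summable (\<lambda>k. \<bar>orb k * geom_weight k\<bar>)"
  by (rule summable_comparison_test'[OF geom_weight_summable, of 0]) (use orb_geom_weight_le in auto)

lemma renewal_limit_pos: "0 < renewal_limit"
proof -
  have "0 < suminf (\<lambda>k. orb k * geom_weight k)"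
    using orb_geom_weight_summable by (intro suminf_pos) (auto simp: summable_rabs_cancel orb_bounds geom_weight_pos)
  then show ?thesis by (simp add: renewal_limit_def)
qed

lemma renewal_ratio_tendsto: "renewal_ratio \<longlonglongrightarrow> renewal_limit"
  unfolding renewal_limit_def
proof (rule renewal_tendsto[OF _ _ digit_weight_sums _ renewal_ratio_rec orb_geom_weight_summable renewal_ratio_sum])
  \<comment> \<open>The first digit of 1 is at least \<beta> - 1, hence positive.\<close>
  have "real (digit (orb 0)) > 0" using digit(2)[of 1] beta_gt_1 by (simp add: algebra_simps)
  then show "0 < digit_weight 0" by (simp add: digit_weight_def)
  show "\<bar>renewal_ratio n\<bar> \<le> 1" for n using renewal_ratio_nonneg[of n] renewal_ratio_le_1[of n] by simp
  show "suminf (\<lambda>k. orb k * geom_weight k) \<noteq> 0" using renewal_limit_pos by (auto simp: renewal_limit_def)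
qed (simp add: digit_weight_def)

text \<open>Up to normalization this is Parry's invariant density of the \<beta>-transformation,
  lifted to X.\<close>

definition inv_density :: "split_point \<Rightarrow> real" where
  "inv_density x = suminf (\<lambda>k. geom_weight k * of_int (ind (orb k) x))"

text \<open>The first sum accounts for the ratios not having reached their limit, the second term
  for cutting the density series after index n. Neither depends on the point of X.\<close>

definition renewal_error :: "nat \<Rightarrow> real" where
  "renewal_error n = (\<Sum>k\<le>n. \<bar>renewal_ratio (n - k) - renewal_limit\<bar> * geom_weight k) + renewal_limit * suminf (\<lambda>k. geom_weight (k + Suc n))"

lemma ind_01: "x \<in> XS \<Longrightarrow> ind c x = 0 \<or> ind c x = 1"
  by (simp add: ind_apply)

lemma inv_density_summable:
  assumes "x \<in> XS"
  shows "summable (\<lambda>k. geom_weight k * real_of_int (ind (orb k) x))"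
proof (rule summable_comparison_test'[OF geom_weight_summable, of 0])
  fix k show "norm (geom_weight k * real_of_int (ind (orb k) x)) \<le> geom_weight k"
    using ind_01[OF assms, of "orb k"] geom_weight_pos[of k] by auto
qed

lemma inv_density_ge_1:
  assumes "x \<in> XS"
  shows "1 \<le> inv_density x"
proof -
  have "(\<Sum>k<1. geom_weight k * real_of_int (ind (orb k) x)) \<le> inv_density x"
    unfolding inv_density_def
  proof (rule sum_le_suminf[OF inv_density_summable[OF assms]])
    fix k show "0 \<le> geom_weight k * real_of_int (ind (orb k) x)"
      using ind_01[OF assms, of "orb k"] geom_weight_pos[of k] by auto
  qed simp
  then show ?thesis using assms by (simp add: ind_1 geom_weight_def)
qed

lemma renewal_error_tendsto: "renewal_error \<longlonglongrightarrow> 0"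
proof -
  have "(\<lambda>n. \<Sum>k\<le>n. \<bar>renewal_ratio (n - k) - renewal_limit\<bar> * geom_weight k) \<longlonglongrightarrow> 0 * suminf geom_weight"
  proof (rule convolution_tendsto[where \<phi> = "\<lambda>n. n" and B = "1 + renewal_limit" and s = "\<lambda>n. \<bar>renewal_ratio n - renewal_limit\<bar>"])
    have "(\<lambda>n. \<bar>renewal_ratio n - renewal_limit\<bar>) \<longlonglongrightarrow> 0"
      using renewal_ratio_tendsto by (simp add: LIM_zero_iff tendsto_rabs_zero_iff)
    then show "(\<lambda>i. \<bar>renewal_ratio (i - j) - renewal_limit\<bar>) \<longlonglongrightarrow> 0" for j
      by (rule filterlim_compose[OF _ filterlim_minus_const_nat]) (rule filterlim_ident)
    show "\<bar>\<bar>renewal_ratio n - renewal_limit\<bar>\<bar> \<le> 1 + renewal_limit" for n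
      using renewal_ratio_nonneg[of n] renewal_ratio_le_1[of n] renewal_limit_pos by auto
    show "summable (\<lambda>k. \<bar>geom_weight k\<bar>)" using geom_weight_summable by (simp add: abs_of_pos geom_weight_pos)
  qed (rule filterlim_ident)
  moreover have "(\<lambda>n. renewal_limit * suminf (\<lambda>k. geom_weight (k + Suc n))) \<longlonglongrightarrow> renewal_limit * 0"
  proof (intro tendsto_intros)
    have "(\<lambda>n. suminf (\<lambda>k. geom_weight (k + n))) \<longlonglongrightarrow> 0" by (rule suminf_exist_split2[OF geom_weight_summable])
    then show "(\<lambda>n. suminf (\<lambda>k. geom_weight (k + Suc n))) \<longlonglongrightarrow> 0" by (rule LIMSEQ_Suc)
  qed
  ultimately have "(\<lambda>n. (\<Sum>k\<le>n. \<bar>renewal_ratio (n - k) - renewal_limit\<bar> * geom_weight k) + renewal_limit * suminf (\<lambda>k. geom_weight (k + Suc n)))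
    \<longlonglongrightarrow> 0 * suminf geom_weight + renewal_limit * 0" by (rule tendsto_add)
  then show ?thesis by (simp add: renewal_error_def[abs_def])
qed

text \<open>The density series is split after index n and compared termwise with the finite
  expansion. All indicator values lie between 0 and 1, so the bound is uniform in
  \<open>x\<close>.\<close>

lemma unit_power_approx:
  assumes x: "x \<in> XS"
  shows "\<bar>of_int (unit_power (int n) x) / \<beta> ^ n - renewal_limit * inv_density x\<bar> \<le> renewal_error n"
proof -
  let ?e = "\<lambda>k. real_of_int (ind (orb k) x)"
  have e: "0 \<le> ?e k" "?e k \<le> 1" for k using ind_01[OF x, of "orb k"] by linarith+
  have "unit_power (int n) x = (\<Sum>k\<le>n. renewal_count (n - k) * ind (orb k) x)"
    using x by (simp only: unit_power_expand restrict_apply if_True)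
  then have "of_int (unit_power (int n) x) / \<beta> ^ n = (\<Sum>k\<le>n. of_int (renewal_count (n - k)) * ?e k) / \<beta> ^ n"
    by (simp only: of_int_sum of_int_mult)
  also have "\<dots> = (\<Sum>k\<le>n. of_int (renewal_count (n - k)) / \<beta> ^ n * ?e k)"
    by (simp only: sum_divide_distrib times_divide_eq_left)
  also have "\<dots> = (\<Sum>k\<le>n. renewal_ratio (n - k) * geom_weight k * ?e k)"
    by (intro sum.cong refl) (simp only: power_split atMost_iff)
  finally have 1: "of_int (unit_power (int n) x) / \<beta> ^ n = (\<Sum>k\<le>n. renewal_ratio (n - k) * geom_weight k * ?e k)" .
  have 2: "inv_density x = suminf (\<lambda>k. geom_weight (k + Suc n) * ?e (k + Suc n)) + (\<Sum>k\<le>n. geom_weight k * ?e k)"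
    unfolding inv_density_def lessThan_Suc_atMost[symmetric]
    by (rule suminf_split_initial_segment[OF inv_density_summable[OF x]])
  have sb: "summable (\<lambda>k. geom_weight (k + Suc n))" using geom_weight_summable by (rule summable_ignore_initial_segment)
  have tail: "\<bar>suminf (\<lambda>k. geom_weight (k + Suc n) * ?e (k + Suc n))\<bar> \<le> suminf (\<lambda>k. geom_weight (k + Suc n))"
  proof -
    have se: "summable (\<lambda>k. geom_weight (k + Suc n) * ?e (k + Suc n))"
      using inv_density_summable[OF x] by (rule summable_ignore_initial_segment)
    have "0 \<le> suminf (\<lambda>k. geom_weight (k + Suc n) * ?e (k + Suc n))"
      by (rule suminf_nonneg[OF se]) (rule mult_nonneg_nonneg[OF less_imp_le[OF geom_weight_pos] e(1)])
    moreover have "suminf (\<lambda>k. geom_weight (k + Suc n) * ?e (k + Suc n)) \<le> suminf (\<lambda>k. geom_weight (k + Suc n))"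
      by (rule suminf_le[OF mult_left_le[OF e(2) less_imp_le[OF geom_weight_pos]] se sb])
    ultimately show ?thesis by simp
  qed
  have "(\<Sum>k\<le>n. (renewal_ratio (n - k) - renewal_limit) * geom_weight k * ?e k) =
    (\<Sum>k\<le>n. renewal_ratio (n - k) * geom_weight k * ?e k) - renewal_limit * (\<Sum>k\<le>n. geom_weight k * ?e k)"
    by (simp only: sum_subtractf left_diff_distrib sum_distrib_left mult.assoc)
  then have "of_int (unit_power (int n) x) / \<beta> ^ n - renewal_limit * inv_density x =
    (\<Sum>k\<le>n. (renewal_ratio (n - k) - renewal_limit) * geom_weight k * ?e k) - renewal_limit * suminf (\<lambda>k. geom_weight (k + Suc n) * ?e (k + Suc n))"
    unfolding 1 2 distrib_left by linarith
  then have "\<bar>of_int (unit_power (int n) x) / \<beta> ^ n - renewal_limit * inv_density x\<bar> \<le>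
    \<bar>\<Sum>k\<le>n. (renewal_ratio (n - k) - renewal_limit) * geom_weight k * ?e k\<bar>
      + \<bar>renewal_limit * suminf (\<lambda>k. geom_weight (k + Suc n) * ?e (k + Suc n))\<bar>"
    by linarith
  also have "\<dots> \<le> (\<Sum>k\<le>n. \<bar>(renewal_ratio (n - k) - renewal_limit) * geom_weight k * ?e k\<bar>)
      + \<bar>renewal_limit * suminf (\<lambda>k. geom_weight (k + Suc n) * ?e (k + Suc n))\<bar>"
    by (rule add_right_mono) (rule sum_abs)
  also have "\<dots> \<le> renewal_error n"
    unfolding renewal_error_def
  proof (rule add_mono, rule sum_mono)
    fix k
    have "\<bar>renewal_ratio (n - k) - renewal_limit\<bar> * geom_weight k * ?e k \<le> \<bar>renewal_ratio (n - k) - renewal_limit\<bar> * geom_weight k"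
      by (rule mult_left_le[OF e(2) mult_nonneg_nonneg[OF abs_ge_zero less_imp_le[OF geom_weight_pos]]])
    then show "\<bar>(renewal_ratio (n - k) - renewal_limit) * geom_weight k * ?e k\<bar> \<le> \<bar>renewal_ratio (n - k) - renewal_limit\<bar> * geom_weight k"
      by (simp only: abs_mult abs_of_pos[OF geom_weight_pos] abs_of_nonneg[OF e(1)])
    show "\<bar>renewal_limit * suminf (\<lambda>k. geom_weight (k + Suc n) * ?e (k + Suc n))\<bar> \<le> renewal_limit * suminf (\<lambda>k. geom_weight (k + Suc n))"
      unfolding abs_mult abs_of_pos[OF renewal_limit_pos]
      by (rule mult_left_mono[OF tail less_imp_le[OF renewal_limit_pos]])
  qed
  finally show ?thesis .
qed

section \<open>Eventual positivity\<close>

lemma lookup_tpow: "Poly_Mapping.lookup (tpow n * p) (n + k) = Poly_Mapping.lookup p k"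
proof -
  have "Poly_Mapping.keys p \<subseteq> UNIV" by simp
  then show ?thesis
  proof (induction rule: frag_induction)
    case (diff a b)
    then show ?case by (simp only: right_diff_distrib lookup_minus)
  qed (simp_all add: mult_single lookup_single)
qed

lemma laurent_fun_eventually_pos:
  assumes "0 < laurent_eval p \<beta>"
  shows "\<exists>n. \<forall>x\<in>XS. 0 \<le> (L ^^ n) (laurent_fun p) x"
proof -
  let ?K = "Poly_Mapping.keys p"
  let ?c = "\<lambda>k. real_of_int (Poly_Mapping.lookup p k) * \<beta> powi k"
  \<comment> \<open>Total deviation from p(\<beta>) times the limiting density: after division by
    \<beta>^n the term with exponent k contributes its error at time n + k, weighted by its
    coefficient times \<beta>^k.\<close>
  define E where "E n = (\<Sum>k\<in>?K. \<bar>?c k\<bar> * renewal_error (nat (int n + k)))" for n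
  have shift: "filterlim (\<lambda>n. nat (int n + k)) at_top sequentially" for k
    unfolding filterlim_at_top
  proof
    fix Z
    have "eventually (\<lambda>n. Z + nat (- k) \<le> n) sequentially" by (rule eventually_ge_at_top)
    then show "eventually (\<lambda>n. Z \<le> nat (int n + k)) sequentially" by eventually_elim linarith
  qed
  have "E \<longlonglongrightarrow> (\<Sum>k\<in>?K. \<bar>?c k\<bar> * 0)"
    unfolding E_def by (intro tendsto_intros filterlim_compose[OF renewal_error_tendsto shift])
  then have "E \<longlonglongrightarrow> 0" by simp
  moreover have "0 < laurent_eval p \<beta> * renewal_limit" using assms renewal_limit_pos by simp
  ultimately have "eventually (\<lambda>n. E n < laurent_eval p \<beta> * renewal_limit) sequentially"
    by (rule order_tendstoD(2))
  \<comment> \<open>With all exponents n + k positive, every \<open>unit_power (int n + k)\<close>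
    is a genuine iterate of \<L> on 1, to which the approximation applies.\<close>
  moreover have "eventually (\<lambda>n. \<forall>k\<in>?K. 1 \<le> nat (int n + k)) sequentially"
    using shift by (intro eventually_ball_finite) (auto simp: filterlim_at_top)
  ultimately have "eventually (\<lambda>n. E n < laurent_eval p \<beta> * renewal_limit \<and> (\<forall>k\<in>?K. 1 \<le> nat (int n + k))) sequentially"
    by (rule eventually_conj)
  then obtain n where n: "E n < laurent_eval p \<beta> * renewal_limit" "\<And>k. k \<in> ?K \<Longrightarrow> 1 \<le> nat (int n + k)"
    by (auto dest: eventually_happens)
  show ?thesis
  proof (intro exI[of _ n] ballI)
    fix x assume x: "x \<in> XS"
    have keys: "Poly_Mapping.keys (tpow (int n) * p) \<subseteq> (\<lambda>k. int n + k) ` ?K"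
      using keys_mult[of "tpow (int n)" p] by auto
    have look: "Poly_Mapping.lookup (tpow (int n) * p) (int n + k) = Poly_Mapping.lookup p k" for k
      by (simp add: lookup_tpow)
    have "(L ^^ n) (laurent_fun p) x = (\<Sum>k\<in>(\<lambda>k. int n + k) ` ?K. Poly_Mapping.lookup (tpow (int n) * p) k * unit_power k x)"
      unfolding funpow_L_laurent_fun by (rule laurent_fun_superset) (use keys x in auto)
    also have "\<dots> = (\<Sum>k\<in>?K. Poly_Mapping.lookup p k * unit_power (int n + k) x)"
      by (subst sum.reindex) (auto simp: look inj_on_def)
    finally have "of_int ((L ^^ n) (laurent_fun p) x) / \<beta> ^ n =
      (\<Sum>k\<in>?K. of_int (Poly_Mapping.lookup p k) * (of_int (unit_power (int n + k) x) / \<beta> ^ n))"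
      by (simp add: sum_divide_distrib)
    also have "\<dots> = (\<Sum>k\<in>?K. ?c k * (of_int (unit_power (int (nat (int n + k))) x) / \<beta> ^ nat (int n + k)))"
    proof (rule sum.cong)
      fix k assume k: "k \<in> ?K"
      define m where "m = nat (int n + k)"
      have m: "int n + k = int m" using n(2)[OF k] by (simp add: m_def)
      then have "k = int m - int n" by simp
      \<comment> \<open>The factor \<beta>^k converts the normalization by \<beta>^n into the one by
        \<beta>^(n + k), turning the coefficients of p into the terms of p(\<beta>).\<close>
      then have "\<beta> powi k = \<beta> ^ m / \<beta> ^ n" by (simp add: power_int_diff)
      then have "of_int (unit_power (int m) x) / \<beta> ^ n = \<beta> powi k * (of_int (unit_power (int m) x) / \<beta> ^ m)"
        by simp
      then show "of_int (Poly_Mapping.lookup p k) * (of_int (unit_power (int n + k) x) / \<beta> ^ n) =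
        ?c k * (of_int (unit_power (int (nat (int n + k))) x) / \<beta> ^ nat (int n + k))"
        unfolding m by simp
    qed simp
    also have "\<dots> \<ge> (\<Sum>k\<in>?K. ?c k * (renewal_limit * inv_density x) - \<bar>?c k\<bar> * renewal_error (nat (int n + k)))"
    proof (rule sum_mono)
      fix k
      let ?u = "of_int (unit_power (int (nat (int n + k))) x) / \<beta> ^ nat (int n + k)"
      have "\<bar>?c k * (?u - renewal_limit * inv_density x)\<bar> \<le> \<bar>?c k\<bar> * renewal_error (nat (int n + k))"
        unfolding abs_mult[of "?c k"] by (intro mult_left_mono unit_power_approx x) simp
      then have "- (\<bar>?c k\<bar> * renewal_error (nat (int n + k))) \<le> ?c k * (?u - renewal_limit * inv_density x)"
        by (simp only: abs_le_iff) linarith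
      then show "?c k * (renewal_limit * inv_density x) - \<bar>?c k\<bar> * renewal_error (nat (int n + k)) \<le> ?c k * ?u"
        unfolding right_diff_distrib[of "?c k"] by linarith
    qed
    finally have "laurent_eval p \<beta> * (renewal_limit * inv_density x) - E n \<le> of_int ((L ^^ n) (laurent_fun p) x) / \<beta> ^ n"
      by (simp add: sum_subtractf laurent_eval_def E_def sum_distrib_right)
    moreover have "laurent_eval p \<beta> * renewal_limit * 1 \<le> laurent_eval p \<beta> * renewal_limit * inv_density x"
      by (intro mult_left_mono inv_density_ge_1 x) (use assms renewal_limit_pos in auto)
    ultimately have "0 \<le> real_of_int ((L ^^ n) (laurent_fun p) x) / \<beta> ^ n" using n(1) by (simp add: mult.assoc)
    moreover have "0 < \<beta> ^ n" by simp
    ultimately have "0 \<le> real_of_int ((L ^^ n) (laurent_fun p) x)"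
      by (metis divide_neg_pos not_le)
    then show "0 \<le> (L ^^ n) (laurent_fun p) x" by simp
  qed
qed

text \<open>The iterate \<L>^n f is nonnegative with integral 0 and so vanishes identically by
  \<open>leb_mean_pos\<close>.\<close>

lemma leb_mean_zero_imp:
  assumes f: "f \<in> CX" "\<And>x. x \<in> XS \<Longrightarrow> 0 \<le> (L ^^ n) f x" "leb_mean f = 0"
  shows "Leq f (\<lambda>x\<in>XS. 0)"
proof -
  have "leb_mean ((L ^^ n) f) = 0" by (simp only: leb_mean_funpow_L[OF f(1)] f(3) mult_zero_right)
  then have "(L ^^ n) f x = 0" if "x \<in> XS" for x
    using leb_mean_pos[OF CX_funpow[OF f(1)] f(2) that] by (metis less_irrefl)
  then have "(L ^^ n) f = (\<lambda>x\<in>XS. 0)"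
    by (intro extensionalityI[OF CX_extensional[OF CX_funpow[OF f(1)]]]) simp_all
  then have "(L ^^ n) f = (L ^^ n) (\<lambda>x\<in>XS. 0)" by (simp only: funpow_L_zero)
  then show ?thesis unfolding Leq_def by blast
qed

end

section \<open>The dimension group\<close>

lemma additive_frag_cmul:
  fixes g :: "('a \<Rightarrow>\<^sub>0 int) \<Rightarrow> real"
  assumes add: "\<And>p q. g (p + q) = g p + g q"
  shows "g (frag_cmul k p) = of_int k * g p"
proof -
  have g0: "g 0 = 0" using add[of 0 0] by simp
  have nat: "g (frag_cmul (int n) p) = real n * g p" for n
  proof (induction n)
    case (Suc n)
    have "frag_cmul (int (Suc n)) p = p + frag_cmul (int n) p"
      by (simp only: of_nat_Suc frag_cmul_distrib frag_cmul_one)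
    then show ?case using Suc by (simp add: add algebra_simps)
  qed (simp add: g0)
  have minus: "g (- q) = - g q" for q using add[of q "- q"] g0 by simp
  show ?thesis
  proof (cases k rule: int_cases2)
    case (nonpos n)
    then have "frag_cmul k p = - frag_cmul (int n) p" by simp
    then have "g (frag_cmul k p) = - (real n * g p)" by (simp only: minus nat)
    then show ?thesis using nonpos by simp
  qed (simp add: nat)
qed

context beta_shift
begin

section \<open>Classes and their Laurent representatives\<close>

abbreviation "G \<equiv> DG \<tau> ps"

definition DG_class :: "(split_point \<Rightarrow> int) \<Rightarrow> (split_point \<Rightarrow> int) set" where
  "DG_class f = DG_rel \<tau> ps `` {f}"

lemma in_DG_rel: "(f, g) \<in> DG_rel \<tau> ps \<longleftrightarrow> f \<in> CX \<and> g \<in> CX \<and> Leq f g"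
  by (simp add: DG_rel_def Leq_def)

lemma in_DG_class: "f \<in> CX \<Longrightarrow> g \<in> DG_class f \<longleftrightarrow> g \<in> CX \<and> Leq f g"
  by (simp add: DG_class_def in_DG_rel)

lemma DG_class_eq_iff:
  assumes "f \<in> CX" "g \<in> CX"
  shows "DG_class f = DG_class g \<longleftrightarrow> Leq f g"
proof
  assume "DG_class f = DG_class g"
  then have "g \<in> DG_class f" using assms by (simp add: in_DG_class)
  then show "Leq f g" using assms by (simp add: in_DG_class)
next
  assume "Leq f g"
  then have "h \<in> DG_class f \<longleftrightarrow> h \<in> DG_class g" for h
    unfolding in_DG_class[OF assms(1)] in_DG_class[OF assms(2)]
    using Leq_trans[of f g h] Leq_trans[of g f h] Leq_sym[of f g] by blast
  then show "DG_class f = DG_class g" by blast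
qed

text \<open>This map is injective by freeness and onto by \<open>carrier_G\<close>, so group
  structure, \<L>_* and order are all computed on Laurent polynomials.\<close>

definition laurent_class :: "laurent \<Rightarrow> (split_point \<Rightarrow> int) set" where
  "laurent_class p = DG_class (laurent_fun p)"

lemma in_laurent_class: "f \<in> laurent_class p \<longleftrightarrow> f \<in> CX \<and> Leq (laurent_fun p) f"
  unfolding laurent_class_def by (rule in_DG_class[OF laurent_fun_CX])

lemma laurent_fun_in_laurent_class: "laurent_fun p \<in> laurent_class p"
  by (simp add: in_laurent_class laurent_fun_CX)

lemma laurent_class_inj: "inj laurent_class"
  by (rule injI, rule laurent_fun_Leq_inj) (simp add: laurent_class_def DG_class_eq_iff laurent_fun_CX)

lemma laurent_class_eq_iff: "laurent_class p = laurent_class q \<longleftrightarrow> p = q"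
  using laurent_class_inj by (simp add: inj_eq)

lemma DG_class_eq_laurent_class: "f \<in> CX \<Longrightarrow> Leq f (laurent_fun p) \<Longrightarrow> DG_class f = laurent_class p"
  unfolding laurent_class_def by (simp add: DG_class_eq_iff laurent_fun_CX)

lemma carrier_G: "carrier G = range laurent_class"
proof
  show "carrier G \<subseteq> range laurent_class"
  proof
    fix A assume "A \<in> carrier G"
    then obtain f where f: "f \<in> CX" "A = DG_class f" by (auto simp: DG_def quotient_def DG_class_def)
    then obtain p where "Leq f (laurent_fun p)" using CX_span by blast
    then have "A = laurent_class p" using f DG_class_eq_laurent_class by simp
    then show "A \<in> range laurent_class" by blast
  qed
  show "range laurent_class \<subseteq> carrier G"
    using laurent_fun_CX by (auto simp: DG_def quotient_def laurent_class_def DG_class_def)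
qed

lemma laurent_class_in_G: "laurent_class p \<in> carrier G"
  by (simp add: carrier_G)

text \<open>The operation saturates the set of all pointwise sums of representatives. By
  \<open>Leq_add\<close> these sums are all equivalent to one of them, so the saturation is a single
  class.\<close>

lemma mult_laurent_class: "laurent_class p \<otimes>\<^bsub>G\<^esub> laurent_class q = laurent_class (p + q)"
proof -
  let ?S = "{\<lambda>x\<in>XS. f x + g x |f g. f \<in> laurent_class p \<and> g \<in> laurent_class q}"
  have 1: "(laurent_fun (p + q), h) \<in> DG_rel \<tau> ps" if h: "h \<in> ?S" for h
  proof -
    obtain f g where fg: "h = (\<lambda>x\<in>XS. f x + g x)" "f \<in> laurent_class p" "g \<in> laurent_class q"
      using h by blast
    then have "f \<in> CX" "g \<in> CX" "Leq (laurent_fun p) f" "Leq (laurent_fun q) g" by (simp_all add: in_laurent_class)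
    then show ?thesis unfolding in_DG_rel fg(1)
      by (intro conjI laurent_fun_CX CX_add) (simp_all only: laurent_fun_add Leq_add)
  qed
  have 2: "laurent_fun (p + q) \<in> ?S"
    unfolding laurent_fun_add using laurent_fun_in_laurent_class[of p] laurent_fun_in_laurent_class[of q] by blast
  have "DG_rel \<tau> ps `` ?S = laurent_class (p + q)"
  proof (intro equalityI subsetI)
    fix h assume "h \<in> DG_rel \<tau> ps `` ?S"
    then obtain g where "(laurent_fun (p + q), g) \<in> DG_rel \<tau> ps" "(g, h) \<in> DG_rel \<tau> ps" using 1 by blast
    then have "h \<in> CX" "Leq (laurent_fun (p + q)) h"
      unfolding in_DG_rel using Leq_trans[of "laurent_fun (p + q)" g h] by blast+
    then show "h \<in> laurent_class (p + q)" by (simp add: in_laurent_class)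
  next
    fix h assume "h \<in> laurent_class (p + q)"
    then have "(laurent_fun (p + q), h) \<in> DG_rel \<tau> ps" by (simp add: in_laurent_class in_DG_rel laurent_fun_CX)
    then show "h \<in> DG_rel \<tau> ps `` ?S" using 2 by (rule ImageI)
  qed
  then show ?thesis by (simp add: DG_def)
qed

lemma one_G: "\<one>\<^bsub>G\<^esub> = laurent_class 0"
  by (simp add: DG_def laurent_class_def DG_class_def laurent_fun_0)

lemma comm_group_G: "comm_group G"
proof (rule comm_groupI)
  fix x assume "x \<in> carrier G"
  then obtain p where "x = laurent_class p" by (auto simp: carrier_G)
  then show "\<exists>y\<in>carrier G. y \<otimes>\<^bsub>G\<^esub> x = \<one>\<^bsub>G\<^esub>"
    by (intro bexI[of _ "laurent_class (- p)"]) (simp_all add: mult_laurent_class one_G laurent_class_in_G)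
qed (auto simp: carrier_G one_G mult_laurent_class laurent_class_eq_iff ac_simps)

lemma inv_laurent_class: "inv\<^bsub>G\<^esub> laurent_class p = laurent_class (- p)"
proof -
  interpret comm_group G by (rule comm_group_G)
  show ?thesis by (rule inv_equality) (simp_all add: mult_laurent_class one_G laurent_class_in_G)
qed

lemma int_pow_laurent_class: "laurent_class p [^]\<^bsub>G\<^esub> (k::int) = laurent_class (frag_cmul k p)"
proof -
  interpret comm_group G by (rule comm_group_G)
  have nat: "laurent_class p [^]\<^bsub>G\<^esub> n = laurent_class (frag_cmul (int n) p)" for n :: nat
  proof (induction n)
    case (Suc n)
    have "frag_cmul (int (Suc n)) p = frag_cmul (int n) p + p"
      by (simp only: of_nat_Suc frag_cmul_distrib frag_cmul_one add.commute)
    then show ?case using Suc by (simp add: mult_laurent_class)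
  qed (simp add: one_G)
  show ?thesis
  proof (cases k rule: int_cases2)
    case (nonneg n)
    then show ?thesis by (simp only: int_pow_int nat)
  next
    case (nonpos n)
    then show ?thesis by (simp only: int_pow_neg[OF laurent_class_in_G] int_pow_int nat inv_laurent_class minus_frag_cmul)
  qed
qed

lemma finprod_laurent_class: "finite K \<Longrightarrow> finprod G (\<lambda>k. laurent_class (g k)) K = laurent_class (\<Sum>k\<in>K. g k)"
proof (induction K rule: finite_induct)
  interpret comm_group G by (rule comm_group_G)
  case empty
  then show ?case by (simp add: one_G)
next
  interpret comm_group G by (rule comm_group_G)
  case (insert k K)
  then show ?case by (simp add: laurent_class_in_G mult_laurent_class)
qed

lemma L_star_laurent_class: "L_star \<tau> ps (laurent_class p) = laurent_class (laurent_t * p)"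
proof -
  have 1: "L f \<in> CX \<and> Leq (laurent_fun (laurent_t * p)) (L f)" if "f \<in> laurent_class p" for f
    using that by (simp add: in_laurent_class CX_L Leq_L L_laurent_fun[symmetric])
  have "L (laurent_fun p) = laurent_fun (laurent_t * p)" by (rule L_laurent_fun)
  then have 2: "laurent_fun (laurent_t * p) \<in> L ` laurent_class p" using laurent_fun_in_laurent_class[of p] by (metis image_eqI)
  show ?thesis unfolding L_star_def
  proof (intro equalityI subsetI)
    fix h assume "h \<in> DG_rel \<tau> ps `` (L ` laurent_class p)"
    then obtain f where "f \<in> laurent_class p" "(L f, h) \<in> DG_rel \<tau> ps" by blast
    then show "h \<in> laurent_class (laurent_t * p)"
      using 1[of f] Leq_trans[of "laurent_fun (laurent_t * p)" "L f" h] by (simp add: in_laurent_class in_DG_rel)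
  next
    fix h assume "h \<in> laurent_class (laurent_t * p)"
    then have "(laurent_fun (laurent_t * p), h) \<in> DG_rel \<tau> ps" by (simp add: in_laurent_class in_DG_rel laurent_fun_CX)
    then show "h \<in> DG_rel \<tau> ps `` (L ` laurent_class p)" using 2 by blast
  qed
qed

lemma DG_unit_eq: "DG_unit \<tau> ps = laurent_class (tpow 0)"
  unfolding DG_unit_def laurent_class_def DG_class_def laurent_fun_1 ..

lemma L_star_pow_unit: "L_star_pow \<tau> ps k (DG_unit \<tau> ps) = laurent_class (tpow k)"
proof -
  have pos: "(L_star \<tau> ps ^^ n) (laurent_class p) = laurent_class (tpow (int n) * p)" for n p
  proof (induction n)
    case (Suc n)
    have "(L_star \<tau> ps ^^ Suc n) (laurent_class p) = laurent_class (laurent_t * (tpow (int n) * p))"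
      by (simp only: funpow.simps o_apply Suc L_star_laurent_class)
    then show ?case by (simp only: laurent_t_def tpow_add of_nat_Suc add.commute)
  qed simp
  \<comment> \<open>Negative powers are defined through \<open>inv_into\<close>, which is determined
    by its defining equation only once \<L>_* is injective; this holds because t is a unit.\<close>
  have inj: "inj_on (L_star \<tau> ps) (carrier G)"
  proof (rule inj_onI)
    fix x y assume "x \<in> carrier G" "y \<in> carrier G" and eq: "L_star \<tau> ps x = L_star \<tau> ps y"
    then obtain p q where pq: "x = laurent_class p" "y = laurent_class q" by (auto simp: carrier_G)
    then have "laurent_t * p = laurent_t * q" using eq by (simp add: L_star_laurent_class laurent_class_eq_iff)
    then have "tpow (- 1) * (tpow 1 * p) = tpow (- 1) * (tpow 1 * q)" by (simp add: laurent_t_def)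
    then have "p = q" by (simp only: tpow_add) simp
    then show "x = y" by (simp add: pq)
  qed
  have inv1: "inv_into (carrier G) (L_star \<tau> ps) (laurent_class p) = laurent_class (tpow (- 1) * p)" for p
  proof (rule inv_into_f_eq[OF inj laurent_class_in_G])
    show "L_star \<tau> ps (laurent_class (tpow (- 1) * p)) = laurent_class p"
      by (simp only: L_star_laurent_class laurent_t_def tpow_add) simp
  qed
  have neg: "(inv_into (carrier G) (L_star \<tau> ps) ^^ n) (laurent_class p) = laurent_class (tpow (- int n) * p)" for n p
  proof (induction n)
    case (Suc n)
    have "(inv_into (carrier G) (L_star \<tau> ps) ^^ Suc n) (laurent_class p) = laurent_class (tpow (- 1) * (tpow (- int n) * p))"
      by (simp only: funpow.simps o_apply Suc inv1)
    moreover have "- 1 + - int n = - int (Suc n)" by simp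
    ultimately show ?case by (simp only: tpow_add)
  qed simp
  show ?thesis
  proof (cases "0 \<le> k")
    case True
    then have "L_star_pow \<tau> ps k (DG_unit \<tau> ps) = laurent_class (tpow k * tpow 0)"
      by (simp only: L_star_pow_def if_True DG_unit_eq pos nat_0_le)
    then show ?thesis by simp
  next
    case False
    then have "- int (nat (- k)) = k" by simp
    then have "L_star_pow \<tau> ps k (DG_unit \<tau> ps) = laurent_class (tpow k * tpow 0)"
      using False by (simp only: L_star_pow_def if_False DG_unit_eq neg)
    then show ?thesis by simp
  qed
qed

lemma laurent_act_eq: "laurent_act \<tau> ps p = laurent_class p"
proof -
  have "laurent_act \<tau> ps p = finprod G (\<lambda>k. laurent_class (frag_cmul (Poly_Mapping.lookup p k) (tpow k))) (Poly_Mapping.keys p)"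
    unfolding laurent_act_def L_star_pow_unit int_pow_laurent_class ..
  also have "\<dots> = laurent_class (\<Sum>k\<in>Poly_Mapping.keys p. frag_cmul (Poly_Mapping.lookup p k) (tpow k))"
    by (rule finprod_laurent_class) simp
  also have "(\<Sum>k\<in>Poly_Mapping.keys p. frag_cmul (Poly_Mapping.lookup p k) (tpow k)) = p"
    using frag_expansion[of p] by (simp add: frag_extend_def)
  finally show ?thesis .
qed

lemma laurent_act_iso: "laurent_act \<tau> ps \<in> iso laurent_group G"
proof -
  have "laurent_act \<tau> ps = laurent_class" by (rule ext) (rule laurent_act_eq)
  then show ?thesis
    using laurent_class_inj by (auto simp: iso_def hom_def laurent_group_def mult_laurent_class laurent_class_in_G
        bij_betw_def carrier_G)
qed

section \<open>Evaluation at \<beta>, the order and the state\<close>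

lemma laurent_eval_add: "laurent_eval (p + q) \<beta> = laurent_eval p \<beta> + laurent_eval q \<beta>"
  unfolding leb_mean_laurent_fun[symmetric] laurent_fun_add by (rule leb_mean_add[OF laurent_fun_CX laurent_fun_CX])

lemma laurent_eval_1: "laurent_eval (tpow 0) \<beta> = 1"
  by (simp add: laurent_eval_def)

lemma laurent_eval_diff: "laurent_eval (p - q) \<beta> = laurent_eval p \<beta> - laurent_eval q \<beta>"
  using laurent_eval_add[of "p - q" q] by simp

text \<open>From left to right, Lebesgue measure makes the value nonnegative, and value 0 forces the
  zero class, hence p = 0 by freeness. From right to left, positivity of p(\<beta>) makes some
  iterate nonnegative.\<close>

lemma DG_nonneg_laurent_class: "DG_nonneg \<tau> ps (laurent_class p) \<longleftrightarrow> 0 < laurent_eval p \<beta> \<or> p = 0"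
proof
  assume "DG_nonneg \<tau> ps (laurent_class p)"
  then obtain f n where fp: "f \<in> laurent_class p" and "\<forall>x\<in>XS. 0 \<le> (L ^^ n) f x"
    unfolding DG_nonneg_def by (elim bexE exE)
  then have pos: "0 \<le> (L ^^ n) f x" if "x \<in> XS" for x using that by (elim bspec)
  have f: "f \<in> CX" "Leq (laurent_fun p) f" using fp by (simp_all add: in_laurent_class)
  have e: "leb_mean f = laurent_eval p \<beta>" using leb_mean_Leq[OF f(2) laurent_fun_CX f(1)] by (simp only: leb_mean_laurent_fun)
  have "0 \<le> \<beta> ^ n * leb_mean f"
    unfolding leb_mean_funpow_L[OF f(1), symmetric] by (rule leb_mean_nonneg[OF CX_funpow[OF f(1)] pos])
  then have ge: "0 \<le> leb_mean f" by (metis beta_pos(1) zero_less_power mult_pos_neg not_le)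
  show "0 < laurent_eval p \<beta> \<or> p = 0"
  proof (cases "leb_mean f = 0")
    case True
    have "Leq f (\<lambda>x\<in>XS. 0)" by (rule leb_mean_zero_imp[OF f(1) pos True])
    then have "p = 0" by (rule laurent_fun_Leq_0[OF Leq_trans[OF f(2)]])
    then show ?thesis ..
  next
    case False
    then show ?thesis using ge e by linarith
  qed
next
  assume "0 < laurent_eval p \<beta> \<or> p = 0"
  then have "\<exists>n. \<forall>x\<in>XS. 0 \<le> (L ^^ n) (laurent_fun p) x"
  proof
    assume "p = 0"
    then have "\<forall>x\<in>XS. 0 \<le> (L ^^ 0) (laurent_fun p) x" by (simp only: funpow_0 laurent_fun_0 restrict_apply if_True order_refl simp_thms ball_simps) simp
    then show ?thesis ..
  qed (rule laurent_fun_eventually_pos)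
  then show "DG_nonneg \<tau> ps (laurent_class p)" unfolding DG_nonneg_def by (rule bexI[OF _ laurent_fun_in_laurent_class])
qed

definition eval_state :: "(split_point \<Rightarrow> int) set \<Rightarrow> real" where
  "eval_state = (\<lambda>A\<in>carrier G. laurent_eval (inv_into UNIV laurent_class A) \<beta>)"

lemma eval_state_laurent_class: "eval_state (laurent_class p) = laurent_eval p \<beta>"
  by (simp add: eval_state_def laurent_class_in_G laurent_class_inj)

lemma is_state_eval_state: "is_state \<tau> ps eval_state"
  unfolding is_state_def
proof (intro conjI ballI impI)
  show "eval_state \<in> extensional (carrier G)" by (simp add: eval_state_def)
  show "eval_state \<in> hom G real_add_group"
    by (rule homI) (auto simp: carrier_G real_add_group_def mult_laurent_class eval_state_laurent_class laurent_eval_add)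
  show "eval_state (DG_unit \<tau> ps) = 1"
    by (simp only: DG_unit_eq eval_state_laurent_class laurent_eval_1)
  fix A assume "A \<in> carrier G" "DG_nonneg \<tau> ps A"
  then obtain p where "A = laurent_class p" "0 < laurent_eval p \<beta> \<or> p = 0"
    by (auto simp: carrier_G DG_nonneg_laurent_class)
  moreover have "laurent_eval 0 \<beta> = 0" by (simp add: laurent_eval_def)
  ultimately show "0 \<le> eval_state A" by (auto simp: eval_state_laurent_class)
qed

text \<open>If a state were smaller than evaluation at some \<open>p\<close>, a rational number strictly in between
  would give an integer combination of \<open>p\<close> and \<open>1\<close> that is positive for the order
  but negative for the state.\<close>

lemma state_ge_eval:
  assumes "is_state \<tau> ps \<omega>"
  shows "laurent_eval p \<beta> \<le> \<omega> (laurent_class p)"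
proof (rule ccontr)
  define \<phi> where "\<phi> q = \<omega> (laurent_class q)" for q
  have add: "\<phi> (q + r) = \<phi> q + \<phi> r" for q r
    using assms laurent_class_in_G[of q] laurent_class_in_G[of r]
    by (simp add: is_state_def hom_def \<phi>_def mult_laurent_class[symmetric] real_add_group_def)
  have pos: "0 \<le> \<phi> q" if "0 < laurent_eval q \<beta>" for q
    using assms laurent_class_in_G[of q] that by (simp add: is_state_def \<phi>_def DG_nonneg_laurent_class)
  have one: "\<phi> (tpow 0) = 1"
    using assms by (simp only: is_state_def DG_unit_eq \<phi>_def)
  let ?e = "laurent_eval p \<beta>"
  assume "\<not> ?e \<le> \<omega> (laurent_class p)"
  then have lt: "0 < ?e - \<phi> p" by (simp add: \<phi>_def)
  obtain n :: nat where n: "1 < real n * (?e - \<phi> p)"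
    using reals_Archimedean3[OF lt] by blast
  \<comment> \<open>The largest integer strictly below n p(\<beta>). Strictness keeps the
    combination positive under evaluation even when n p(\<beta>) is an integer, and the gap of more
    than 1 makes its value under the state negative.\<close>
  define k where "k = \<lceil>real n * ?e\<rceil> - 1"
  have k: "of_int k < real n * ?e" "real n * ?e \<le> of_int k + 1"
    unfolding k_def by linarith+
  let ?q = "frag_cmul (int n) p + frag_cmul (- k) (tpow 0)"
  have "laurent_eval ?q \<beta> = real n * ?e - of_int k"
    unfolding laurent_eval_add
      additive_frag_cmul[of "\<lambda>p. laurent_eval p \<beta>", OF laurent_eval_add] laurent_eval_1 by simp
  then have "0 \<le> \<phi> ?q" using k(1) by (intro pos) linarith
  moreover have "\<phi> ?q = real n * \<phi> p - of_int k"
    unfolding add additive_frag_cmul[of \<phi>, OF add] one by simp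
  moreover have "real n * (?e - \<phi> p) = real n * ?e - real n * \<phi> p" by (rule right_diff_distrib)
  ultimately show False using n k(2) by linarith
qed

text \<open>The one-sided bound \<open>state_ge_eval\<close>, applied to \<open>p\<close> and to
  \<open>- p\<close>, gives equality.\<close>

lemma state_unique:
  assumes "is_state \<tau> ps \<omega>"
  shows "\<omega> = eval_state"
proof (rule extensionalityI[of _ "carrier G"])
  show "\<omega> \<in> extensional (carrier G)" using assms by (simp add: is_state_def)
  show "eval_state \<in> extensional (carrier G)" by (simp add: eval_state_def)
  fix A assume "A \<in> carrier G"
  then obtain p where A: "A = laurent_class p" by (auto simp: carrier_G)
  have add: "\<omega> (laurent_class (q + r)) = \<omega> (laurent_class q) + \<omega> (laurent_class r)" for q r
    using assms laurent_class_in_G[of q] laurent_class_in_G[of r]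
    by (simp add: is_state_def hom_def mult_laurent_class[symmetric] real_add_group_def)
  have "laurent_eval (p + - p) \<beta> = 0" by (simp add: laurent_eval_def)
  then have "laurent_eval (- p) \<beta> = - laurent_eval p \<beta>" using laurent_eval_add[of p "- p"] by linarith
  moreover have "\<omega> (laurent_class (- p)) = - \<omega> (laurent_class p)"
    using add[of p "- p"] add[of 0 0] by simp
  ultimately show "\<omega> A = eval_state A"
    using state_ge_eval[OF assms, of p] state_ge_eval[OF assms, of "- p"]
    unfolding A eval_state_laurent_class by linarith
qed

lemma DG_le_laurent_class: "DG_le \<tau> ps (laurent_class p) (laurent_class q) \<longleftrightarrow> laurent_eval p \<beta> < laurent_eval q \<beta> \<or> p = q"
  unfolding DG_le_def inv_laurent_class mult_laurent_class DG_nonneg_laurent_class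
  by (auto simp: laurent_eval_diff)

end

theorem proposition10p5:
  fixes \<beta> :: real and \<tau> :: "real \<Rightarrow> real" and a :: "real list"
  assumes "\<beta> > 1"
    and "\<tau> = beta_map \<beta>" and "a = beta_partition \<beta>"
    and "\<not> eventually_periodic \<tau> 1"
  shows "laurent_act \<tau> a \<in> iso laurent_group (DG \<tau> a)
    \<and> (\<forall>p. laurent_act \<tau> a (laurent_t * p) = L_star \<tau> a (laurent_act \<tau> a p))
    \<and> (\<exists>\<omega>. is_state \<tau> a \<omega>
        \<and> (\<forall>\<omega>'. is_state \<tau> a \<omega>' \<longrightarrow> \<omega>' = \<omega>)
        \<and> (\<forall>p. \<omega> (laurent_act \<tau> a p) = laurent_eval p \<beta>)
        \<and> (\<forall>A\<in>carrier (DG \<tau> a). \<forall>B\<in>carrier (DG \<tau> a).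
             DG_le \<tau> a A B \<longleftrightarrow> \<omega> A < \<omega> B \<or> A = B))"
proof -
  interpret beta_shift \<beta>
    using assms by unfold_locales auto
  have order: "DG_le (beta_map \<beta>) (beta_partition \<beta>) A B \<longleftrightarrow> eval_state A < eval_state B \<or> A = B"
    if "A \<in> carrier G" "B \<in> carrier G" for A B
    using that by (auto simp: carrier_G DG_le_laurent_class eval_state_laurent_class laurent_class_eq_iff)
  show ?thesis
    unfolding assms(2,3)
  proof (intro conjI exI[of _ eval_state])
    show "laurent_act (beta_map \<beta>) (beta_partition \<beta>) \<in> iso laurent_group G"
      by (rule laurent_act_iso)
    show "is_state (beta_map \<beta>) (beta_partition \<beta>) eval_state"
      by (rule is_state_eval_state)
  qed (use order state_unique in \<open>auto simp: laurent_act_eq L_star_laurent_class eval_state_laurent_class\<close>)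
qed

end
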